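(* Let $\mathbf c=(c_1,\dots,c_k)$ be a composition of a positive integer $n$, let $P\subset SL(n,\mathbb C)$ be the parabolic subgroup containing the upper triangular Borel subgroup whose Levi factor consists of the diagonal blocks of sizes $c_1,\dots,c_k$, let $P'$ be its derived group and $\mathfrak m$ the nilradical of $\mathrm{Lie}\,P$ (the strictly block upper triangular matrices). Let $e=\sum x_{i,j}$, the sum over all lines of $\ell(\mathscr D)$ with label $1$ joining $b(i)$ (left end point) to $b(j)$ (right end point), and let $V=\bigoplus \mathbb C x_{i,j}$, the sum over all lines of $\ell(\mathscr D)$ with label $\ast$ joining $b(i)$ (left) to $b(j)$ (right), where $x_{i,j}$ is the matrix unit with entry $1$ in position $(i,j)$. Then $e+V$ is a Weierstrass section for the adjoint action of $P'$ on $\mathfrak m$; that is, restriction of functions from $\mathfrak m$ to $e+V$ induces an algebra isomorphism of $\mathbb C[\mathfrak m]^{P'}$ onto $\mathbb C[e+V]\cong\mathbb C[V]$.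
   Context: Diagram. $\mathscr D$ has columns $C_1,\dots,C_k$ (left to right), all starting in row $R_1$ (rows are numbered $1,2,\dots$ from top to bottom); $C_i$ consists of $c_i$ boxes, in rows $R_1,\dots,R_{c_i}$, and its height is $c_i$. $\mathscr T$ is the tableau obtained by inserting $1,\dots,n$ into the boxes of $\mathscr D$, down the columns and then from left to right over columns; $b(s)$ is the box of $\mathscr D$ labelled $s$ in $\mathscr T$. A column $C_j$ has a left neighbour if some $C_i$ with $i<j$ has the same height. The tableau $\mathscr T(\infty)$. Let $\preceq$ be the total order on $\{1,\dots,n\}$ in which labels of $\mathscr T$ increase strictly down each column and then from right to left over columns (all labels in $C_k$ from top to bottom, then those of $C_{k-1}$ from top to bottom, etc.). Enlarge $\mathscr D$ by allowing arbitrarily many rows in each of the $k$ columns; "height" always refers to $\mathscr D$. Start with $\mathscr T$ and treat the labels one after another in increasing $\preceq$-order. For the current label $l$, repeat: let $R_p\cap C_j$ be the rightmost position currently containing $l$; if $j=k$ stop. If $c_{j+1}<p$: when $R_p\cap C_{j+1}$ is empty put $l$ there, otherwise stop. If $c_{j+1}=p$: when $C_{j+1}$ has a left neighbour in $\mathscr D$ and $R_{p+1}\cap C_{j+1}$ is empty put $l$ in $R_{p+1}\cap C_{j+1}$, otherwise stop. If $c_{j+1}>p$ stop. The result after treating all labels is $\mathscr T(\infty)$. The lines $\ell(\mathscr D)$. A line joins a box (its left end point) to a box in a column strictly further right (its right end point) and carries a label $1$ or $\ast$. For each $m\in\{2,\dots,k\}$ put $h=c_m$, and let $r_i$ be the entry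 of $\mathscr T(\infty)$ in $R_i\cap C_{m-1}$ ($r_i=0$ if empty). The lines of $\ell(\mathscr D)$ with right end point in $C_m$ are exactly: (1) for $1\le i\le h-1$ with $r_i\ne0$, a line labelled $1$ from $b(r_i)$ to $C_m\cap R_i$; (2) if some column to the left of $C_m$ has height $h$: a line labelled $\ast$ from $b(r_h)$ to $C_m\cap R_h$ and, if $r_{h+1}\neq0$, a line labelled $1$ from $b(r_{h+1})$ to $C_m\cap R_h$; (3) if no column to the left of $C_m$ has height $h$ and $r_h\ne0$: a line labelled $1$ from $b(r_h)$ to $C_m\cap R_h$. *)

theory Defs
  imports
    "HOL-Algebra.Generated_Groups"
    "HOL-Algebra.QuotRing"
    "Jordan_Normal_Form.Determinant"
begin

section \<open>Coordinate algebras and Weierstrass sections\<close>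

text \<open>Functions on \<open>n \<times> n\<close> complex matrices that are polynomial in the entries.\<close>

inductive_set poly_maps :: "nat \<Rightarrow> (complex mat \<Rightarrow> complex) set" for n :: nat where
  const: "(\<lambda>_. a) \<in> poly_maps n"
| entry: "i < n \<Longrightarrow> j < n \<Longrightarrow> (\<lambda>A. A $$ (i, j)) \<in> poly_maps n"
| add: "f \<in> poly_maps n \<Longrightarrow> g \<in> poly_maps n \<Longrightarrow> (\<lambda>A. f A + g A) \<in> poly_maps n"
| mult: "f \<in> poly_maps n \<Longrightarrow> g \<in> poly_maps n \<Longrightarrow> (\<lambda>A. f A * g A) \<in> poly_maps n"

text \<open>
  The algebra \<open>\<complex>[X]\<close> of polynomial functions on a Zariski closed set \<open>X\<close> of \<open>n \<times> n\<close> matrices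
  (below \<open>X\<close> is always an affine subspace).  Its elements are represented by functions that are
  \<open>undefined\<close> outside \<open>X\<close>, so that equality in the algebra is equality of functions on \<open>X\<close>.
\<close>

definition coord_algebra ::
  "nat \<Rightarrow> complex mat set \<Rightarrow> (complex, complex mat \<Rightarrow> complex) module" where
  "coord_algebra n X =
    \<lparr> carrier = (\<lambda>f. restrict f X) ` poly_maps n,
      monoid.mult = (\<lambda>f g. \<lambda>x\<in>X. f x * g x),
      one = (\<lambda>x\<in>X. 1),
      zero = (\<lambda>x\<in>X. 0),
      add = (\<lambda>f g. \<lambda>x\<in>X. f x + g x),
      module.smult = (\<lambda>a f. \<lambda>x\<in>X. a * f x) \<rparr>"

definition SL :: "nat \<Rightarrow> complex mat monoid" where
  "SL n = \<lparr> carrier = {A \<in> carrier_mat n n. det A = 1}, monoid.mult = (*), one = 1\<^sub>m n \<rparr>"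

text \<open>The invariants \<open>\<complex>[X]\<^sup>H\<close> for the action of \<open>H \<subseteq> SL(n, \<complex>)\<close> by conjugation.\<close>

definition invariant_algebra ::
  "nat \<Rightarrow> complex mat set \<Rightarrow> complex mat set \<Rightarrow> (complex, complex mat \<Rightarrow> complex) module" where
  "invariant_algebra n H X = (coord_algebra n X)
    \<lparr> carrier := {f \<in> carrier (coord_algebra n X).
                   \<forall>g\<in>H. \<forall>x\<in>X. f (g * x * inv\<^bsub>SL n\<^esub> g) = f x} \<rparr>"

definition algebra_iso ::
  "(complex, 'a) module \<Rightarrow> (complex, 'b) module \<Rightarrow> ('a \<Rightarrow> 'b) set" where
  "algebra_iso A B =
    {h \<in> ring_iso A B. \<forall>a. \<forall>f\<in>carrier A. h (a \<odot>\<^bsub>A\<^esub> f) = a \<odot>\<^bsub>B\<^esub> h f}"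

definition translate :: "complex mat \<Rightarrow> complex mat set \<Rightarrow> complex mat set" where
  "translate e V = {e + v | v. v \<in> V}"

definition weierstrass_section ::
  "nat \<Rightarrow> complex mat set \<Rightarrow> complex mat set \<Rightarrow> complex mat \<Rightarrow> complex mat set \<Rightarrow> bool" where
  "weierstrass_section n H X e V \<longleftrightarrow>
     translate e V \<subseteq> X \<and>
     (\<lambda>f. restrict f (translate e V))
       \<in> algebra_iso (invariant_algebra n H X) (coord_algebra n (translate e V))"


section \<open>The parabolic subgroup of a composition\<close>

text \<open>
  \<open>block c i\<close> is the number (in \<open>1, \<dots>, k\<close>) of the diagonal block containing the matrix index \<open>i\<close>.
  Matrix indices start at 0.
\<close>

definition block :: "nat list \<Rightarrow> nat \<Rightarrow> nat" where
  "block c i = (LEAST j. i < sum_list (take j c))"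

definition parabolic :: "nat \<Rightarrow> nat list \<Rightarrow> complex mat set" where
  "parabolic n c =
    {A \<in> carrier (SL n). \<forall>i<n. \<forall>j<n. block c j < block c i \<longrightarrow> A $$ (i, j) = 0}"

definition nilradical :: "nat \<Rightarrow> nat list \<Rightarrow> complex mat set" where
  "nilradical n c =
    {A \<in> carrier_mat n n. \<forall>i<n. \<forall>j<n. \<not> block c i < block c j \<longrightarrow> A $$ (i, j) = 0}"


section \<open>Tableaux\<close>

text \<open>
  The position \<open>(p, j)\<close> is the intersection of row \<open>R\<^sub>p\<close> and column \<open>C\<^sub>j\<close>, both counted from 1.
  A filling maps empty positions to 0.
\<close>

type_synonym box = "nat \<times> nat"
type_synonym filling = "box \<Rightarrow> nat"

definition height :: "nat list \<Rightarrow> nat \<Rightarrow> nat" where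
  "height c j = c ! (j - 1)"

definition diagram :: "nat list \<Rightarrow> box set" where
  "diagram c = {(p, j). 1 \<le> j \<and> j \<le> length c \<and> 1 \<le> p \<and> p \<le> height c j}"

definition has_left_neighbour :: "nat list \<Rightarrow> nat \<Rightarrow> bool" where
  "has_left_neighbour c j \<longleftrightarrow> (\<exists>i. 1 \<le> i \<and> i < j \<and> height c i = height c j)"

definition tableau :: "nat list \<Rightarrow> filling" where
  "tableau c = (\<lambda>(p, j). if (p, j) \<in> diagram c then sum_list (take (j - 1) c) + p else 0)"

definition box_of :: "nat list \<Rightarrow> nat \<Rightarrow> box" where
  "box_of c s = inv_into (diagram c) (tableau c) s"

text \<open>
  The treatment of one label \<open>l\<close>.  The argument \<open>(p, j)\<close> is the rightmost position containing \<open>l\<close>: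
  at the start this is \<open>b(l)\<close>, since \<open>l\<close> has not been copied before, and afterwards it is the
  position in column \<open>j + 1\<close> that \<open>l\<close> has just been put into.
\<close>

function treat :: "nat list \<Rightarrow> nat \<Rightarrow> box \<Rightarrow> filling \<Rightarrow> filling" where
  "treat c l (p, j) F =
    (if length c \<le> j then F
     else if height c (j + 1) < p then
       (if F (p, j + 1) = 0 then treat c l (p, j + 1) (F((p, j + 1) := l)) else F)
     else if height c (j + 1) = p then
       (if has_left_neighbour c (j + 1) \<and> F (p + 1, j + 1) = 0
        then treat c l (p + 1, j + 1) (F((p + 1, j + 1) := l)) else F)
     else F)"
  by pat_completeness auto
termination
  by (relation "measure (\<lambda>(c, l, (p, j), F). length c - j)") auto

text \<open>The labels \<open>1, \<dots>, n\<close> listed in increasing \<open>\<preceq>\<close>-order.\<close>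

definition ordered_labels :: "nat list \<Rightarrow> nat list" where
  "ordered_labels c =
    concat (map (\<lambda>j. map (\<lambda>p. tableau c (p, j)) [1..<height c j + 1]) (rev [1..<length c + 1]))"

definition tableau_infinity :: "nat list \<Rightarrow> filling" where
  "tableau_infinity c = fold (\<lambda>l. treat c l (box_of c l)) (ordered_labels c) (tableau c)"


section \<open>Lines\<close>

datatype line_label = Label_one | Label_star

text \<open>A line is given as (left end point, label, right end point).\<close>

type_synonym line = "box \<times> line_label \<times> box"

text \<open>
  If \<open>C\<^sub>m\<close> has a left neighbour, the position \<open>R\<^sub>h \<inter> C\<^bsub>m-1\<^esub>\<close> of \<open>\<T>(\<infinity>)\<close> is never empty, so
  \<open>b(r\<^sub>h)\<close> is meaningful for the line with label \<open>Label_star\<close>.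
\<close>

definition lines_into :: "nat list \<Rightarrow> nat \<Rightarrow> line set" where
  "lines_into c m =
    (let h = height c m; r = (\<lambda>i. tableau_infinity c (i, m - 1)) in
      {(box_of c (r i), Label_one, (i, m)) | i. 1 \<le> i \<and> i < h \<and> r i \<noteq> 0} \<union>
      (if has_left_neighbour c m then
         {(box_of c (r h), Label_star, (h, m))} \<union>
         (if r (h + 1) \<noteq> 0 then {(box_of c (r (h + 1)), Label_one, (h, m))} else {})
       else
         (if r h \<noteq> 0 then {(box_of c (r h), Label_one, (h, m))} else {})))"

definition lines :: "nat list \<Rightarrow> line set" where
  "lines c = (\<Union>m\<in>{2..length c}. lines_into c m)"

definition line_pairs :: "nat \<Rightarrow> nat list \<Rightarrow> line_label \<Rightarrow> (nat \<times> nat) set" where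
  "line_pairs n c a =
    {(i, j). i \<in> {1..n} \<and> j \<in> {1..n} \<and> (box_of c i, a, box_of c j) \<in> lines c}"


section \<open>The element \<open>e\<close> and the space \<open>V\<close>\<close>

text \<open>The matrix unit \<open>x\<^bsub>i,j\<^esub>\<close> with \<open>i, j\<close> counted from 1.\<close>

definition matrix_unit :: "nat \<Rightarrow> nat \<Rightarrow> nat \<Rightarrow> complex mat" where
  "matrix_unit n i j = mat n n (\<lambda>(a, b). if a + 1 = i \<and> b + 1 = j then 1 else 0)"

definition section_point :: "nat \<Rightarrow> nat list \<Rightarrow> complex mat" where
  "section_point n c =
    finsum (module_mat TYPE(complex) n n) (\<lambda>(i, j). matrix_unit n i j) (line_pairs n c Label_one)"

definition section_space :: "nat \<Rightarrow> nat list \<Rightarrow> complex mat set" where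
  "section_space n c =
    {finsum (module_mat TYPE(complex) n n) (\<lambda>(i, j). a (i, j) \<cdot>\<^sub>m matrix_unit n i j)
       (line_pairs n c Label_star) | a. True}"

end

(*
  For a column C_m with nearest left neighbour C_i of the same height, the lowest coefficient in
  lambda of the minor of x + lambda with rows in the blocks i, ..., m-1 and columns in the blocks
  i+1, ..., m is a semi-invariant of the parabolic group, hence an invariant of P'.  On e + V each
  such determinant has only one contributing permutation, and the invariant is, up to sign, the
  coordinate of the starred line into C_m.  So restriction to e + V is surjective.

  For injectivity consider the matrices that map every box to the previous box of its row, with
  a free coefficient at the last box of each column that has a left neighbour.  At such a point y
  one checks [p', y] + (free directions) = m, so an invariant that vanishes on this row family is
  zero: its lowest homogeneous component at y is constant along [p', y].  On the row family the
  minors are monomials with unitriangular exponents.  Therefore every invariant f satisfies an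
  identity f * (monomial in the minors) = (polynomial in the minors), and if f vanishes on e + V,
  where the minors are independent coordinates, the right-hand side is zero.
*)

theory Submission
  imports Defs
begin

section \<open>Boxes and the limiting tableau\<close>

text \<open>The row family is useful because bracketing with its point y only moves boxes to their
  row neighbours, so the tangent computation never meets the tableau. Inside one block the available
  diagonal directions are differences of diagonal units. The single units are recovered by
  descending on heights: left of the first column of height h, row h meets only taller columns, and
  each further column of height h brings its own free coefficient. All directions of P' in use have
  square zero. Conjugation is then polynomial in its parameter, and a limit s -> 0 takes the place
  of differentiation. A minor has one contributing permutation because each label in the rows up to
  h is lost at a definite column; ranking the rows by this column makes the determinant triangular.
  The proof is uniform in the predicate \<open>N\<close> that marks the columns past which a label
  steps down one row, so it treats e + V (\<open>N = LN\<close>) and the row family (no steps) at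
  once.\<close>

definition index_of :: "nat list \<Rightarrow> box \<Rightarrow> nat" where
  "index_of c b = sum_list (take (snd b - 1) c) + fst b - 1"

definition precedes :: "box \<Rightarrow> box \<Rightarrow> bool" where
  "precedes b b' \<longleftrightarrow> snd b' < snd b \<or> snd b' = snd b \<and> fst b < fst b'"

text \<open>For \<open>N = has_left_neighbour c\<close>, this is the box whose label occupies the position \<open>(p, m)\<close> of
  the limiting tableau; \<open>(0, 0)\<close> stands for an empty position.  For \<open>N = (\<lambda>_. False)\<close> labels never
  change their row.\<close>

fun track :: "nat list \<Rightarrow> (nat \<Rightarrow> bool) \<Rightarrow> nat \<Rightarrow> nat \<Rightarrow> box" where
  "track c N 0 p = (0, 0)"
| "track c N (Suc m) p =
     (if p = 0 then (0, 0)
      else if p \<le> height c (Suc m) then (p, Suc m)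
      else if p = height c (Suc m) + 1 \<and> N (Suc m) then track c N m (p - 1)
      else track c N m p)"

lemma track_0_row [simp]: "track c N m 0 = (0, 0)"
  by (cases m) auto

section \<open>Boxes of the diagram and matrix indices\<close>

locale composition =
  fixes n :: nat and c :: "nat list"
  assumes no_zero: "0 \<notin> set c" and sum_c: "sum_list c = n"
begin

abbreviation "H \<equiv> height c"
abbreviation "D \<equiv> diagram c"
abbreviation "ix \<equiv> index_of c"
abbreviation "LN \<equiv> has_left_neighbour c"
abbreviation "blk \<equiv> block c"

definition bx :: "nat \<Rightarrow> box" where "bx a = box_of c (a + 1)"

lemma height_pos: "1 \<le> j \<Longrightarrow> j \<le> length c \<Longrightarrow> 1 \<le> H j"
  using no_zero by (force simp: height_def Suc_le_eq in_set_conv_nth intro!: gr0I)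

lemma psum_Suc: "j < length c \<Longrightarrow> sum_list (take (Suc j) c) = sum_list (take j c) + H (Suc j)"
  by (simp add: take_Suc_conv_app_nth height_def)

lemma psum_mono: "i \<le> j \<Longrightarrow> sum_list (take i c) \<le> sum_list (take j c)"
  by (metis le_add1 min.absorb2 sum_list.append take_add take_take le_add_diff_inverse)

lemma psum_le: "sum_list (take i c) \<le> n"
  using psum_mono[of i "max i (length c)"] sum_c by simp

lemma D_iff: "(p, j) \<in> D \<longleftrightarrow> 1 \<le> j \<and> j \<le> length c \<and> 1 \<le> p \<and> p \<le> H j"
  by (simp add: diagram_def)

lemma not_D_0 [simp]: "(0, j) \<notin> D" "(p, 0) \<notin> D"
  by (auto simp: diagram_def)

lemma ix_bounds:
  assumes "(p, j) \<in> D"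
  shows "sum_list (take (j - 1) c) \<le> ix (p, j)" "ix (p, j) < sum_list (take j c)"
  using assms psum_Suc[of "j - 1"] by (auto simp: D_iff index_of_def)

lemma ix_less: "b \<in> D \<Longrightarrow> ix b < n"
  using ix_bounds(2)[of "fst b" "snd b"] psum_le[of "snd b"] by (simp add: less_le_trans)

lemma col_ix: "b \<in> D \<Longrightarrow> blk (ix b) = snd b"
proof -
  assume b: "b \<in> D"
  obtain p j where bj: "b = (p, j)" by (cases b)
  have "(LEAST j'. ix b < sum_list (take j' c)) = j"
  proof (rule Least_equality)
    show "ix b < sum_list (take j c)" using ix_bounds(2) b bj by auto
    fix j' assume "ix b < sum_list (take j' c)"
    then show "j \<le> j'"
      using ix_bounds(1)[of p j] psum_mono[of j' "j - 1"] b bj by (cases "j' \<le> j - 1") auto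
  qed
  then show ?thesis by (simp add: block_def bj)
qed

lemma ix_inj: "inj_on ix D"
proof (rule inj_onI)
  fix b b' assume *: "b \<in> D" "b' \<in> D" "ix b = ix b'"
  then have "snd b = snd b'" using col_ix by metis
  with * show "b = b'" by (cases b; cases b') (auto simp: index_of_def D_iff)
qed

lemma ix_surj: assumes "a < n" shows "\<exists>b\<in>D. ix b = a"
proof -
  define j where "j = blk a"
  have ex: "a < sum_list (take (length c) c)" using assms sum_c by simp
  have j: "a < sum_list (take j c)" unfolding j_def block_def by (rule LeastI[where P = "\<lambda>j. a < sum_list (take j c)", OF ex])
  have jk: "j \<le> length c" unfolding j_def block_def by (rule Least_le[where P = "\<lambda>j. a < sum_list (take j c)", OF ex])
  have j1: "1 \<le> j" using j by (cases j) auto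
  have "\<not> a < sum_list (take (j - 1) c)"
    using not_less_Least[of "j - 1" "\<lambda>j. a < sum_list (take j c)"] j1 unfolding j_def block_def by auto
  then have "(a - sum_list (take (j - 1) c) + 1, j) \<in> D" "ix (a - sum_list (take (j - 1) c) + 1, j) = a"
    using j jk j1 psum_Suc[of "j - 1"] by (auto simp: D_iff index_of_def)
  then show ?thesis by blast
qed

lemma tableau_D: "b \<in> D \<Longrightarrow> tableau c b = ix b + 1"
  by (cases b) (auto simp: tableau_def index_of_def D_iff)

lemma tableau_not_D: "b \<notin> D \<Longrightarrow> tableau c b = 0"
  by (cases b) (auto simp: tableau_def)

lemma tableau_inj: "inj_on (tableau c) D"
  using ix_inj by (auto simp: inj_on_def tableau_D)

lemma box_of_tableau: "b \<in> D \<Longrightarrow> box_of c (tableau c b) = b"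
  unfolding box_of_def by (rule inv_into_f_f[OF tableau_inj])

lemma bx_ix: "b \<in> D \<Longrightarrow> bx (ix b) = b"
  using box_of_tableau[of b] by (simp add: bx_def tableau_D)

lemma bx_D: "a < n \<Longrightarrow> bx a \<in> D" and ix_bx: "a < n \<Longrightarrow> ix (bx a) = a"
  using ix_surj[of a] bx_ix by force+

lemma col_bx: "a < n \<Longrightarrow> snd (bx a) = blk a"
  using col_ix[OF bx_D] ix_bx by metis

lemma bij_ix: "bij_betw ix D {..<n}"
  by (rule bij_betw_byWitness[where f' = bx]) (auto simp: bx_ix ix_bx bx_D ix_less)

lemma finite_D: "finite D"
  using bij_betw_finite[OF bij_ix] by simp

section \<open>How a label moves through the columns\<close>

lemma track_mem:
  "m \<le> length c \<Longrightarrow> track c N m p \<noteq> (0, 0) \<Longrightarrow>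
     track c N m p \<in> D \<and> snd (track c N m p) \<le> m \<and> fst (track c N m p) \<le> p"
proof (induction m arbitrary: p)
  case (Suc m)
  show ?case
  proof (cases "p = 0 \<or> p \<le> H (Suc m)")
    case True
    then show ?thesis using Suc.prems by (cases "p = 0") (auto simp: D_iff)
  next
    case False
    define q where "q = (if p = H (Suc m) + 1 \<and> N (Suc m) then p - 1 else p)"
    have "track c N (Suc m) p = track c N m q" "q \<le> p" using False by (auto simp: q_def)
    then show ?thesis using Suc.IH[of q] Suc.prems by force
  qed
qed auto

lemma track_col: "m \<le> length c \<Longrightarrow> snd (track c N m p) \<le> m"
  using track_mem[of m N p] by (cases "track c N m p = (0,0)") auto

lemma track_D: "m \<le> length c \<Longrightarrow> track c N m p \<in> D \<longleftrightarrow> track c N m p \<noteq> (0, 0)"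
  using track_mem by (metis not_D_0(1))

lemma track_own: "b \<in> D \<Longrightarrow> track c N (snd b) (fst b) = b"
  by (cases b; cases "snd b") (auto simp: D_iff)

lemma track_current: "m \<le> length c \<Longrightarrow> 1 \<le> m \<Longrightarrow> snd (track c N m p) = m \<Longrightarrow> track c N m p = (p, m) \<and> (p, m) \<in> D"
proof (cases m)
  case (Suc m')
  assume *: "m \<le> length c" "1 \<le> m" "snd (track c N m p) = m"
  show ?thesis
    using * track_col[of m' N p] track_col[of m' N "p - 1"] Suc
    by (auto simp: D_iff split: if_splits)
qed auto

lemma track_nonempty: "1 \<le> j \<Longrightarrow> j \<le> m \<Longrightarrow> m \<le> length c \<Longrightarrow> 1 \<le> p \<Longrightarrow> p \<le> H j \<Longrightarrow> track c N m p \<noteq> (0, 0)"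
proof (induction m arbitrary: p)
  case (Suc m)
  then show ?case using height_pos[of "Suc m"] by (cases "j = Suc m") auto
qed auto

text \<open>The labels of a column increase downwards in the order \<preceq>, without gaps. A
  column's own labels precede all labels from further left, and a label that steps down replaces the
  one just below it, so the order survives. Hence a label displaced by a step down always finds its
  place taken by an earlier label.\<close>

lemma track_strict:
  "m \<le> length c \<Longrightarrow> 1 \<le> p \<Longrightarrow> p < p' \<Longrightarrow> track c N m p' \<noteq> (0, 0) \<Longrightarrow>
     track c N m p \<noteq> (0, 0) \<and> precedes (track c N m p) (track c N m p')"
proof (induction m arbitrary: p p')
  case (Suc m)
  have m: "m \<le> length c" using Suc.prems by simp
  let ?h = "H (Suc m)"
  have h: "1 \<le> ?h" using height_pos[of "Suc m"] Suc.prems by simp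
  have *: "snd (track c N m q) < Suc m" for q using track_col[OF m, of N q] by simp
  show ?case
  proof (cases "p \<le> ?h")
    case True
    then show ?thesis using Suc.prems *[of p'] *[of "p' - 1"] by (auto simp: precedes_def split: if_splits)
  next
    case False
    show ?thesis
    proof (cases "p = ?h + 1 \<and> N (Suc m)")
      case True
      then show ?thesis using Suc.prems h Suc.IH[of ?h p'] m by (auto split: if_splits)
    next
      case nF: False
      then have "track c N (Suc m) p = track c N m p" "track c N (Suc m) p' = track c N m p'"
        using False Suc.prems by auto
      then show ?thesis using Suc.IH[of p p'] Suc.prems m by simp
    qed
  qed
qed auto

lemma precedes_irrefl: "\<not> precedes b b" and precedes_asym: "precedes b b' \<Longrightarrow> \<not> precedes b' b"
  by (auto simp: precedes_def)

lemma track_row_pos: "track c N m p \<noteq> (0, 0) \<Longrightarrow> 1 \<le> p"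
  by (cases p) auto

lemma track_inj:
  "m \<le> length c \<Longrightarrow> track c N m p = track c N m p' \<Longrightarrow> track c N m p \<noteq> (0, 0) \<Longrightarrow> p = p'"
  by (metis linorder_neqE_nat precedes_irrefl track_row_pos track_strict)

lemma track_persist:
  assumes "track c N (Suc m) p \<noteq> (0, 0)" "snd (track c N (Suc m) p) \<noteq> Suc m"
  shows "\<exists>p'\<le>p. track c N m p' = track c N (Suc m) p"
  using assms by (auto split: if_splits intro: exI[of _ "p - 1"])

text \<open>A column receives labels only from itself and from the column before it, so a label that
  has been lost cannot return.\<close>

lemma track_gone:
  assumes "b \<noteq> (0, 0)" "\<forall>p. track c N m p \<noteq> b" "snd b \<le> m" "m \<le> m'"
  shows "track c N m' p \<noteq> b"
  using assms(4)
proof (induction m' arbitrary: p rule: dec_induct)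
  case base
  then show ?case using assms by simp
next
  case (step m')
  show ?case
  proof
    assume *: "track c N (Suc m') p = b"
    then have "snd (track c N (Suc m') p) \<noteq> Suc m'" using assms step by simp
    then obtain p' where "track c N m' p' = track c N (Suc m') p" using track_persist * assms(1) by metis
    then show False using step.IH * by simp
  qed
qed

text \<open>The filling reached once the labels of the boxes in \<open>S\<close> have been treated and the label of
  \<open>b\<close> has been copied as far as column \<open>j\<close>.\<close>

definition partial_filling :: "box set \<Rightarrow> box \<Rightarrow> nat \<Rightarrow> filling" where
  "partial_filling S b j = (\<lambda>(p', j').
     if j' \<le> length c \<and> ((p', j') \<in> D \<or> track c LN j' p' \<in> S \<or> track c LN j' p' = b \<and> j' \<le> j)
     then tableau c (track c LN j' p') else 0)"

section \<open>Correctness of the insertion procedure\<close>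

lemma partial_filling_stop:
  assumes "b \<in> D" "snd b \<le> j" "j < length c" "\<forall>p. track c LN (Suc j) p \<noteq> b"
  shows "partial_filling S b j = partial_filling S b (length c)"
proof -
  have "b \<noteq> (0, 0)" using assms(1) by auto
  then have *: "track c LN j' p \<noteq> b" if "j < j'" for j' p
    using track_gone[of b LN "Suc j" j' p] assms that by auto
  have "track c LN j' p = b \<and> j' \<le> j \<longleftrightarrow> track c LN j' p = b \<and> j' \<le> length c" if "j' \<le> length c" for j' p
    using * that by (metis not_le)
  then show ?thesis by (auto simp: partial_filling_def fun_eq_iff simp del: track.simps)
qed

lemma partial_filling_step:
  assumes "b \<in> D" "j < length c" "track c LN (Suc j) p = b" "snd b \<le> j"
  shows "(partial_filling S b j)((p, Suc j) := tableau c b) = partial_filling S b (Suc j)"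
proof -
  have "b \<noteq> (0, 0)" using assms(1) by auto
  then have *: "track c LN (Suc j) p' = b \<Longrightarrow> p' = p" for p'
    using track_inj[of "Suc j" LN p' p] assms(2,3) by auto
  show ?thesis
  proof (rule ext, clarify)
    fix p' j'
    show "((partial_filling S b j)((p, Suc j) := tableau c b)) (p', j') = partial_filling S b (Suc j) (p', j')"
    proof (cases "(p', j') = (p, Suc j)")
      case True
      then show ?thesis using assms by (simp add: partial_filling_def del: track.simps)
    next
      case False
      then have "track c LN j' p' = b \<and> j' \<le> Suc j \<longleftrightarrow> track c LN j' p' = b \<and> j' \<le> j"
        using * by (metis le_Suc_eq)
      with False show ?thesis by (simp only: partial_filling_def fun_upd_def split: prod.splits if_splits) auto
    qed
  qed
qed

text \<open>The hypotheses on \<open>S\<close> decide the emptiness test. Since \<open>b\<close> is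
  not in \<open>S\<close>, the cell that \<open>track\<close> assigns to it is still empty; since
  all predecessors of \<open>b\<close> are in \<open>S\<close>, a cell that \<open>track\<close>
  gives to one of them is already full.\<close>

lemma treat_partial_filling:
  assumes "b \<in> D" "b \<notin> S" "\<forall>b'\<in>D. precedes b' b \<longrightarrow> b' \<in> S"
  shows "j \<le> length c \<Longrightarrow> snd b \<le> j \<Longrightarrow> track c LN j p = b \<Longrightarrow>
    treat c (tableau c b) (p, j) (partial_filling S b j) = partial_filling S b (length c)"
proof (induction "length c - j" arbitrary: j p)
  case 0
  then show ?case by simp
next
  case (Suc d)
  have b0: "b \<noteq> (0, 0)" using assms(1) by auto
  have jl: "j < length c" using Suc.hyps by simp
  have p1: "1 \<le> p" using Suc.prems(3) b0 track_row_pos by metis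
  have inj: "p' = p" if "track c LN j p' = b" for p'
    using track_inj[of j LN p' p] that Suc.prems b0 by auto
  let ?h = "H (Suc j)" and ?F = "partial_filling S b j"
  have h: "1 \<le> ?h" using height_pos[of "Suc j"] jl by simp
  have IH: "treat c (tableau c b) (p', Suc j) (?F((p', Suc j) := tableau c b)) = partial_filling S b (length c)"
    if "track c LN (Suc j) p' = b" for p'
    using Suc.hyps(1)[of "Suc j" p'] Suc.hyps(2) that jl Suc.prems
      partial_filling_step[OF assms(1) jl that, of S] by (simp del: track.simps treat.simps)
  have empty: "?F (p', Suc j) = 0" if "track c LN (Suc j) p' = b" "?h < p'" for p'
    using that assms(2) by (auto simp: partial_filling_def D_iff simp del: track.simps)
  have stop: "?F = partial_filling S b (length c)" if "\<forall>p'. track c LN (Suc j) p' \<noteq> b"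
    using partial_filling_stop[OF assms(1) Suc.prems(2) jl that] .
  have own: "(p', Suc j) \<noteq> b" for p' using Suc.prems(2) by auto
  consider "?h < p" | "?h = p" | "p < ?h" by linarith
  then show ?case
  proof cases
    case 1
    show ?thesis
    proof (cases "p = ?h + 1 \<and> LN (Suc j)")
      case True
      then have tr: "track c LN (Suc j) p = track c LN j ?h" by simp
      \<comment> \<open>The cell to the right is occupied: the label of row \<open>?h\<close> in
        column j steps down into it and has been treated earlier.\<close>
      have "track c LN j ?h \<noteq> (0, 0) \<and> precedes (track c LN j ?h) b"
        using track_strict[of j ?h p LN] Suc.prems h True b0 by auto
      then have "?F (p, Suc j) \<noteq> 0"
        using tr assms(3) track_D[of j LN ?h] jl tableau_D
        by (auto simp: partial_filling_def simp del: track.simps)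
      moreover have "track c LN j ?h \<noteq> b" using inj[of ?h] True by auto
      then have "\<forall>p'. track c LN (Suc j) p' \<noteq> b"
        using inj own True b0 by (auto split: if_splits)
      ultimately show ?thesis using stop 1 jl by simp
    next
      case False
      then have "track c LN (Suc j) p = b" using 1 Suc.prems p1 by auto
      then show ?thesis using empty[of p] IH[of p] 1 jl by simp
    qed
  next
    case 2
    show ?thesis
    proof (cases "LN (Suc j)")
      case True
      then have "track c LN (Suc j) (p + 1) = b" using 2 Suc.prems by simp
      then show ?thesis using empty[of "p + 1"] IH[of "p + 1"] 2 jl True by simp
    next
      case False
      then have "\<forall>p'. track c LN (Suc j) p' \<noteq> b" using inj own 2 b0 by (auto split: if_splits)
      then show ?thesis using stop 2 jl False by simp
    qed
  next
    case 3
    then have "\<forall>p'. track c LN (Suc j) p' \<noteq> b" using inj own b0 by (auto split: if_splits)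
    then show ?thesis using stop 3 jl by simp
  qed
qed

definition ordered_boxes :: "box list" where
  "ordered_boxes = concat (map (\<lambda>j. map (\<lambda>p. (p, j)) [1..<H j + 1]) (rev [1..<length c + 1]))"

lemma ordered_labels_eq: "ordered_labels c = map (tableau c) ordered_boxes"
  by (simp add: ordered_labels_def ordered_boxes_def map_concat comp_def)

lemma set_ordered_boxes: "set ordered_boxes = D"
  by (auto simp: ordered_boxes_def D_iff image_iff)

lemma sorted_ordered_boxes: "sorted_wrt precedes ordered_boxes"
proof -
  have "sorted_wrt precedes (concat (map (\<lambda>j. map (\<lambda>p. (p, j)) [1..<H j + 1]) js))"
    if "sorted_wrt (>) js" for js
    using that
  proof (induction js)
    case (Cons j js)
    have "sorted_wrt precedes (map (\<lambda>p. (p, j)) [1..<H j + 1])"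
      using sorted_wrt_upt[of 1 "H j + 1"]
      by (auto simp: sorted_wrt_map precedes_def intro: sorted_wrt_mono_rel[rotated])
    then show ?case using Cons by (simp del: upt_Suc add: sorted_wrt_append) (auto simp: precedes_def)
  qed auto
  then show ?thesis by (simp add: ordered_boxes_def sorted_wrt_rev del: upt_Suc)
qed

text \<open>Up to its own column a label occurs only in its own box, which is filled from the
  beginning. The arguments \<open>(0, 0) 0\<close> stand for no label in progress, as the tableau
  has value 0 at \<open>(0, 0)\<close>.\<close>

lemma partial_filling_start:
  assumes "b \<in> D"
  shows "partial_filling S b (snd b) = partial_filling S (0, 0) 0"
proof (rule ext, clarify)
  fix p j
  have b0: "b \<noteq> (0, 0)" using assms by auto
  have "(p, j) \<in> D" if *: "track c LN j p = b" "j \<le> snd b" "j \<le> length c"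
    using track_current[of j LN p] track_col[of j LN p] * b0
    by (cases "j = 0") auto
  then have "(p, j) \<in> D \<or> track c LN j p = b \<and> j \<le> snd b \<longleftrightarrow> (p, j) \<in> D" if "j \<le> length c"
    using that by blast
  then show "partial_filling S b (snd b) (p, j) = partial_filling S (0, 0) 0 (p, j)"
    using tableau_not_D[of "(0, 0)"] by (auto simp: partial_filling_def)
qed

lemma partial_filling_insert:
  "partial_filling S b (length c) = partial_filling (insert b S) (0, 0) 0"
  using tableau_not_D[of "(0, 0)"] by (auto simp: partial_filling_def fun_eq_iff)

lemma fold_treat:
  "sorted_wrt precedes (xs @ ys) \<Longrightarrow> set (xs @ ys) = D \<Longrightarrow>
    fold (\<lambda>l. treat c l (box_of c l)) (map (tableau c) ys) (partial_filling (set xs) (0, 0) 0)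
      = partial_filling D (0, 0) 0"
proof (induction ys arbitrary: xs)
  case Nil
  then show ?case by simp
next
  case (Cons b ys)
  have b: "b \<in> D" using Cons.prems by auto
  have bS: "b \<notin> set xs" using Cons.prems(1) precedes_irrefl[of b] by (auto simp: sorted_wrt_append)
  have prec: "\<forall>b'\<in>D. precedes b' b \<longrightarrow> b' \<in> set xs"
  proof clarify
    fix p' j' assume *: "(p', j') \<in> D" "precedes (p', j') b"
    show "(p', j') \<in> set xs"
    proof (rule ccontr)
      assume "(p', j') \<notin> set xs"
      then have "(p', j') \<in> set (b # ys)" using * Cons.prems(2) by auto
      then show False using Cons.prems(1) * precedes_irrefl[of b] precedes_asym[of "(p', j')" b] by (auto simp: sorted_wrt_append)
    qed
  qed
  have "b = (fst b, snd b)" by simp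
  have "treat c (tableau c b) b (partial_filling (set xs) (0, 0) 0) = partial_filling (set xs) b (length c)"
    using treat_partial_filling[OF b bS prec, of "snd b" "fst b"] track_own[OF b] b
      partial_filling_start[OF b] by (cases b) (auto simp: D_iff simp del: treat.simps)
  then show ?case
    using Cons.IH[of "xs @ [b]"] Cons.prems by (simp add: box_of_tableau[OF b] partial_filling_insert del: treat.simps)
qed

lemma tableau_infinity_eq:
  assumes "m \<le> length c"
  shows "tableau_infinity c (p, m) = tableau c (track c LN m p)"
proof -
  have "tableau c = partial_filling {} (0, 0) 0"
  proof (rule ext, clarify)
    fix p j
    show "tableau c (p, j) = partial_filling {} (0, 0) 0 (p, j)"
      using track_own[of "(p, j)" LN] tableau_not_D[of "(0,0)"] tableau_not_D[of "(p,j)"]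
      by (auto simp: partial_filling_def D_iff)
  qed
  then have "tableau_infinity c = partial_filling D (0, 0) 0"
    using fold_treat[of "[]" ordered_boxes] sorted_ordered_boxes set_ordered_boxes
    by (simp add: tableau_infinity_def ordered_labels_eq)
  then show ?thesis
    using assms track_D[OF assms, of LN p] tableau_not_D[of "(0,0)"]
    by (auto simp: partial_filling_def)
qed

end

section \<open>The entries of the section\<close>

lemma index_finsum_mat:
  fixes f :: "'i \<Rightarrow> 'a :: comm_ring_1 mat"
  assumes "finite F" "f \<in> F \<rightarrow> carrier_mat nr nc" "i < nr" "j < nc"
  shows "finsum (module_mat TYPE('a) nr nc) f F $$ (i, j) = (\<Sum>x\<in>F. f x $$ (i, j))"
proof -
  interpret abelian_group "module_mat TYPE('a) nr nc" by (rule abelian_group_mat)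
  \<comment> \<open>The carrier statement is carried along because reading an entry of a sum
    requires the dimensions of its summands.\<close>
  have "finsum (module_mat TYPE('a) nr nc) f F \<in> carrier_mat nr nc \<and>
      finsum (module_mat TYPE('a) nr nc) f F $$ (i, j) = (\<Sum>x\<in>F. f x $$ (i, j))"
    using assms(1,2)
  proof (induction F)
    case empty
    then show ?case using assms(3,4) by (simp add: module_mat_simps)
  next
    case (insert x F)
    then show ?case using assms(3,4) finsum_insert[of F x f]
      by (simp add: module_mat_simps) (subst index_add_mat(1), auto)
  qed
  then show ?thesis by blast
qed

lemma finsum_mat_carrier:
  fixes f :: "'i \<Rightarrow> 'a :: comm_ring_1 mat"
  assumes "f \<in> F \<rightarrow> carrier_mat nr nc"
  shows "finsum (module_mat TYPE('a) nr nc) f F \<in> carrier_mat nr nc"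
proof -
  interpret abelian_group "module_mat TYPE('a) nr nc" by (rule abelian_group_mat)
  show ?thesis using finsum_closed[of f F] assms by (simp add: module_mat_simps)
qed

lemma index_sum_matrix_units:
  assumes "F \<subseteq> {1..n} \<times> {1..n}" "i < n" "j < n"
  shows "finsum (module_mat TYPE(complex) n n) (\<lambda>(i, j). g (i, j) \<cdot>\<^sub>m matrix_unit n i j) F $$ (i, j)
    = (if (i + 1, j + 1) \<in> F then g (i + 1, j + 1) else 0)"
proof -
  have fin: "finite F" using assms(1) finite_subset by blast
  have "finsum (module_mat TYPE(complex) n n) (\<lambda>(i, j). g (i, j) \<cdot>\<^sub>m matrix_unit n i j) F $$ (i, j)
      = (\<Sum>x\<in>F. (case x of (i, j) \<Rightarrow> g (i, j) \<cdot>\<^sub>m matrix_unit n i j) $$ (i, j))"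
    using fin assms by (intro index_finsum_mat) (auto simp: matrix_unit_def)
  also have "\<dots> = (\<Sum>x\<in>F. if x = (i + 1, j + 1) then g (i + 1, j + 1) else 0)"
    using assms(2,3) by (intro sum.cong) (auto simp: matrix_unit_def split: if_splits)
  finally show ?thesis using fin by simp
qed

context composition
begin

text \<open>The entry type is left free because the pencils have polynomial entries.\<close>

definition bmat :: "(box \<Rightarrow> box \<Rightarrow> 'a) \<Rightarrow> 'a mat" where
  "bmat f = mat n n (\<lambda>(a, b). f (bx a) (bx b))"

lemma bmat_carrier [simp]: "bmat f \<in> carrier_mat n n"
  and dim_bmat [simp]: "dim_row (bmat f) = n" "dim_col (bmat f) = n"
  by (simp_all add: bmat_def)

lemma bmat_index [simp]: "b \<in> D \<Longrightarrow> b' \<in> D \<Longrightarrow> bmat f $$ (ix b, ix b') = f b b'"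
  by (simp add: bmat_def ix_less bx_ix)

lemma eq_bmatI:
  assumes "A \<in> carrier_mat n n" "\<And>b b'. b \<in> D \<Longrightarrow> b' \<in> D \<Longrightarrow> A $$ (ix b, ix b') = f b b'"
  shows "A = bmat f"
proof (rule eq_matI)
  fix a a' assume "a < dim_row (bmat f)" "a' < dim_col (bmat f)"
  then show "A $$ (a, a') = bmat f $$ (a, a')"
    using assms(2)[of "bx a" "bx a'"] bmat_index[of "bx a" "bx a'" f] bx_D ix_bx by auto
qed (use assms in auto)

lemma bmat_cong:
  "(\<And>b b'. b \<in> D \<Longrightarrow> b' \<in> D \<Longrightarrow> f b b' = g b b') \<Longrightarrow> bmat f = bmat g"
  by (rule eq_bmatI) auto

text \<open>The left end point of the line labelled 1 into \<open>b\<close>, or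
  \<open>(0, 0)\<close> if there is none. At the bottom of a marked column it is taken one row
  lower, since the position in the same row belongs to the starred line.\<close>

definition source :: "(nat \<Rightarrow> bool) \<Rightarrow> box \<Rightarrow> box" where
  "source N b = (if fst b = H (snd b) \<and> N (snd b) then track c N (snd b - 1) (fst b + 1)
                 else track c N (snd b - 1) (fst b))"

text \<open>The matrices \<open>family LN \<sigma>\<close> make up \<open>e + V\<close>.  The matrices \<open>family (\<lambda>_. False) \<sigma>\<close> map every
  box to a multiple of the previous box of its row.\<close>

definition family :: "(nat \<Rightarrow> bool) \<Rightarrow> (nat \<Rightarrow> complex) \<Rightarrow> complex mat" where
  "family N \<sigma> = bmat (\<lambda>b b'.
     (if b = source N b' then if fst b' = H (snd b') \<and> LN (snd b') \<and> \<not> N (snd b') then \<sigma> (snd b') else 1 else 0) +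
     (if fst b' = H (snd b') \<and> N (snd b') \<and> b = track c N (snd b' - 1) (fst b') then \<sigma> (snd b') else 0))"

lemma box_of_tableau_infinity:
  assumes "m \<le> length c" "tableau_infinity c (p, m) \<noteq> 0"
  shows "box_of c (tableau_infinity c (p, m)) = track c LN m p" "track c LN m p \<in> D"
  using assms tableau_not_D box_of_tableau unfolding tableau_infinity_eq[OF assms(1)] by metis+

lemma tableau_infinity_zero_iff:
  "m \<le> length c \<Longrightarrow> tableau_infinity c (p, m) = 0 \<longleftrightarrow> track c LN m p \<notin> D"
  by (cases "track c LN m p \<in> D") (simp_all add: tableau_infinity_eq tableau_not_D tableau_D)

lemma LN_2: "LN m \<Longrightarrow> 2 \<le> m"
  by (auto simp: has_left_neighbour_def)

lemma left_neighbour_track_D: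
  assumes "LN m" "m \<le> length c"
  shows "track c N (m - 1) (H m) \<in> D"
proof -
  obtain i where i: "1 \<le> i" "i < m" "H i = H m" using assms by (auto simp: has_left_neighbour_def)
  then show ?thesis
    using track_nonempty[of i "m - 1" "H m" N] track_D[of "m - 1" N "H m"] height_pos[of m] assms by auto
qed

lemma lines_iff:
  assumes "(p, m) \<in> D"
  shows "(b, a, (p, m)) \<in> lines c \<longleftrightarrow> 2 \<le> m \<and> (b, a, (p, m)) \<in> lines_into c m"
proof -
  have "snd x = m'" if "(b, a, x) \<in> lines_into c m'" for m' x
    using that by (auto simp: lines_into_def Let_def split: if_splits)
  then have "(b, a, (p, m)) \<in> lines_into c m' \<Longrightarrow> m' = m" for m' by fastforce
  moreover have "m \<le> length c" using assms by (simp add: D_iff)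
  ultimately show ?thesis unfolding lines_def UN_iff Bex_def atLeastAtMost_iff by metis
qed

lemma star_line_iff:
  assumes "b \<in> D" "b' \<in> D"
  shows "(b, Label_star, b') \<in> lines c \<longleftrightarrow>
    fst b' = H (snd b') \<and> LN (snd b') \<and> b = track c LN (snd b' - 1) (fst b')"
proof -
  obtain p m where b': "b' = (p, m)" by (cases b')
  have m: "m \<le> length c" "1 \<le> m" using assms b' by (auto simp: D_iff)
  have "(b, Label_star, b') \<in> lines c \<longleftrightarrow> 2 \<le> m \<and> LN m \<and> p = H m \<and> b = box_of c (tableau_infinity c (H m, m - 1))"
    unfolding b' using assms by (subst lines_iff) (auto simp: b' lines_into_def Let_def split: if_splits)
  moreover have "tableau_infinity c (H m, m - 1) \<noteq> 0" if "LN m"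
    using left_neighbour_track_D[OF that] tableau_infinity_zero_iff[of "m - 1" "H m"] m by simp
  ultimately show ?thesis
    using box_of_tableau_infinity(1)[of "m - 1" "H m"] m b' LN_2[of m]
    by (cases "LN m \<and> p = H m") (auto simp: le_diff_conv)
qed

lemma one_line_iff:
  assumes "b \<in> D" "b' \<in> D"
  shows "(b, Label_one, b') \<in> lines c \<longleftrightarrow> b = source LN b'"
proof -
  obtain p m where b': "b' = (p, m)" by (cases b')
  have m: "m \<le> length c" "1 \<le> m" and p: "1 \<le> p" "p \<le> H m" using assms b' by (auto simp: D_iff)
  define q where "q = (if p = H m \<and> LN m then p + 1 else p)"
  have "(b, Label_one, b') \<in> lines c \<longleftrightarrow> 2 \<le> m \<and> tableau_infinity c (q, m - 1) \<noteq> 0 \<and>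
      b = box_of c (tableau_infinity c (q, m - 1))"
    unfolding b' using assms p
    by (subst lines_iff) (auto simp: b' lines_into_def Let_def q_def split: if_splits)
  also have "\<dots> \<longleftrightarrow> 2 \<le> m \<and> b = track c LN (m - 1) q"
    using box_of_tableau_infinity(1)[of "m - 1" q] tableau_infinity_zero_iff[of "m - 1" q] assms(1) m by auto
  \<comment> \<open>For m = 1 the track is taken in column 0, which is empty, so neither side
    holds.\<close>
  also have "\<dots> \<longleftrightarrow> b = track c LN (m - 1) q"
    using assms(1) m(2) by (cases "m = 1") auto
  finally show ?thesis by (auto simp: source_def b' q_def)
qed

lemma line_pairs_iff:
  assumes "b \<in> D" "b' \<in> D"
  shows "(ix b + 1, ix b' + 1) \<in> line_pairs n c a \<longleftrightarrow> (b, a, b') \<in> lines c"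
  using assms ix_less[of b] ix_less[of b'] bx_ix[of b] bx_ix[of b']
  by (simp add: line_pairs_def bx_def Suc_le_eq)

lemma line_pairs_subset: "line_pairs n c a \<subseteq> {1..n} \<times> {1..n}"
  by (auto simp: line_pairs_def)

lemma sum_line_pairs:
  "finsum (module_mat TYPE(complex) n n) (\<lambda>(i, j). g (i, j) \<cdot>\<^sub>m matrix_unit n i j) (line_pairs n c a)
    = bmat (\<lambda>b b'. if (b, a, b') \<in> lines c then g (ix b + 1, ix b' + 1) else 0)" (is "?S = _")
proof (rule eq_bmatI)
  show "?S \<in> carrier_mat n n" by (rule finsum_mat_carrier) (auto simp: matrix_unit_def)
  fix b b' assume "b \<in> D" "b' \<in> D"
  then show "?S $$ (ix b, ix b') = (if (b, a, b') \<in> lines c then g (ix b + 1, ix b' + 1) else 0)"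
    using line_pairs_iff[of b b' a] by (simp only: index_sum_matrix_units[OF line_pairs_subset] ix_less)
qed

lemma section_point_eq: "section_point n c = bmat (\<lambda>b b'. if b = source LN b' then 1 else 0)"
proof -
  have "(\<lambda>(i, j). matrix_unit n i j) = (\<lambda>(i, j). 1 \<cdot>\<^sub>m matrix_unit n i j)"
    by (auto simp: fun_eq_iff)
  then have "section_point n c = finsum (module_mat TYPE(complex) n n)
      (\<lambda>(i, j). (\<lambda>_. 1) (i, j) \<cdot>\<^sub>m matrix_unit n i j) (line_pairs n c Label_one)"
    by (simp add: section_point_def)
  then show ?thesis using sum_line_pairs[of "\<lambda>_. 1" Label_one] by (simp add: one_line_iff cong: bmat_cong)
qed

definition star_matrix :: "(nat \<Rightarrow> complex) \<Rightarrow> complex mat" where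
  "star_matrix \<sigma> = bmat (\<lambda>b b'.
     if fst b' = H (snd b') \<and> LN (snd b') \<and> b = track c LN (snd b' - 1) (fst b') then \<sigma> (snd b') else 0)"

lemma section_space_eq: "section_space n c = range star_matrix"
proof -
  let ?S = "\<lambda>a. finsum (module_mat TYPE(complex) n n) (\<lambda>(i, j). a (i, j) \<cdot>\<^sub>m matrix_unit n i j)
       (line_pairs n c Label_star)"
  have S: "?S a = bmat (\<lambda>b b'. if fst b' = H (snd b') \<and> LN (snd b') \<and> b = track c LN (snd b' - 1) (fst b')
      then a (ix b + 1, ix b' + 1) else 0)" for a
    unfolding sum_line_pairs by (simp add: star_line_iff cong: bmat_cong)
  have "?S a = star_matrix (\<lambda>m. a (ix (track c LN (m - 1) (H m)) + 1, ix (H m, m) + 1))" for a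
    unfolding S star_matrix_def
    by (rule bmat_cong) (auto simp del: track.simps)
  \<comment> \<open>A column has at most one starred line into it, so the coefficient can be read
    off from the column of the right end point; \<open>j - 1\<close> is the matrix index of the
    label j.\<close>
  moreover have "star_matrix \<sigma> = ?S (\<lambda>(i, j). \<sigma> (blk (j - 1)))" for \<sigma>
    unfolding S unfolding star_matrix_def
    by (rule bmat_cong) (simp add: col_ix)
  ultimately show ?thesis unfolding section_space_def by blast
qed

lemma section_point_add_star_matrix: "section_point n c + star_matrix \<sigma> = family LN \<sigma>"
  unfolding section_point_eq family_def by (rule eq_bmatI) (auto simp: star_matrix_def ix_less)

lemma translate_section: "translate (section_point n c) (section_space n c) = range (family LN)"
  unfolding translate_def section_space_eq using section_point_add_star_matrix by (auto; metis rangeI)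

lemma family_carrier [simp]: "family N \<sigma> \<in> carrier_mat n n"
  by (simp add: family_def)

lemma nilradical_iff:
  "x \<in> nilradical n c \<longleftrightarrow> x \<in> carrier_mat n n \<and>
    (\<forall>b\<in>D. \<forall>b'\<in>D. \<not> snd b < snd b' \<longrightarrow> x $$ (ix b, ix b') = 0)"
  (is "_ = ?R")
proof
  assume "x \<in> nilradical n c" then show ?R by (auto simp: nilradical_def ix_less col_ix)
next
  assume R: ?R
  have "x $$ (i, j) = 0" if "i < n" "j < n" "\<not> blk i < blk j" for i j
    using R that bx_D[of i] bx_D[of j] ix_bx[of i] ix_bx[of j] col_bx[of i] col_bx[of j] by metis
  then show "x \<in> nilradical n c" using R by (auto simp: nilradical_def)
qed

lemma snd_track_less: "(p, m) \<in> D \<Longrightarrow> snd (track c N (m - 1) q) < m"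
  using track_col[of "m - 1" N q] unfolding D_iff by linarith

lemma family_nilradical: "family N \<sigma> \<in> nilradical n c"
  unfolding nilradical_iff
  using snd_track_less[of _ _ N] by (auto simp: family_def source_def split: if_splits)

end

section \<open>Minors of the pencil\<close>

lemma coeff_0_prod: "coeff (prod f A) 0 = (\<Prod>a\<in>A. coeff (f a) 0)" for f :: "'b \<Rightarrow> 'a :: comm_semiring_1 poly"
  by (induction A rule: infinite_finite_induct) (auto simp: coeff_mult)

lemma coeff_monom_mult_self: "coeff (monom 1 k * r) k = coeff r 0" for r :: "'a :: comm_semiring_1 poly"
  by (simp add: coeff_monom_mult)

lemma poly_maps_diff: "f \<in> poly_maps n \<Longrightarrow> g \<in> poly_maps n \<Longrightarrow> (\<lambda>A. f A - g A) \<in> poly_maps n"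
  using poly_maps.add[OF _ poly_maps.mult[OF poly_maps.const[of "-1"]], of f n g] by simp

lemma poly_maps_sum: "(\<And>a. a \<in> S \<Longrightarrow> f a \<in> poly_maps n) \<Longrightarrow> (\<lambda>A. \<Sum>a\<in>S. f a A) \<in> poly_maps n"
  by (induction S rule: infinite_finite_induct) (auto intro: poly_maps.intros)

definition coeff_poly_maps :: "nat \<Rightarrow> (complex mat \<Rightarrow> complex poly) set" where
  "coeff_poly_maps n = {F. \<forall>k. (\<lambda>A. coeff (F A) k) \<in> poly_maps n}"

lemma coeff_poly_maps_const: "(\<lambda>A. q) \<in> coeff_poly_maps n"
  by (auto simp: coeff_poly_maps_def intro: poly_maps.const)

lemma coeff_poly_maps_entry: "i < n \<Longrightarrow> j < n \<Longrightarrow> (\<lambda>A. [:A $$ (i, j):]) \<in> coeff_poly_maps n"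
proof -
  assume "i < n" "j < n"
  then have "(\<lambda>A. coeff [:A $$ (i, j):] k) \<in> poly_maps n" for k
    by (cases k) (auto intro: poly_maps.intros)
  then show ?thesis by (simp add: coeff_poly_maps_def)
qed

lemma coeff_poly_maps_add:
  "F \<in> coeff_poly_maps n \<Longrightarrow> G \<in> coeff_poly_maps n \<Longrightarrow> (\<lambda>A. F A + G A) \<in> coeff_poly_maps n"
  by (auto simp: coeff_poly_maps_def intro: poly_maps.add)

lemma coeff_poly_maps_mult:
  "F \<in> coeff_poly_maps n \<Longrightarrow> G \<in> coeff_poly_maps n \<Longrightarrow> (\<lambda>A. F A * G A) \<in> coeff_poly_maps n"
  by (auto simp: coeff_poly_maps_def coeff_mult intro!: poly_maps_sum poly_maps.mult)

lemma coeff_poly_maps_sum: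
  "(\<And>a. a \<in> S \<Longrightarrow> F a \<in> coeff_poly_maps n) \<Longrightarrow> (\<lambda>A. \<Sum>a\<in>S. F a A) \<in> coeff_poly_maps n"
  by (induction S rule: infinite_finite_induct) (auto intro: coeff_poly_maps_const coeff_poly_maps_add)

lemma coeff_poly_maps_prod:
  "(\<And>a. a \<in> S \<Longrightarrow> F a \<in> coeff_poly_maps n) \<Longrightarrow> (\<lambda>A. \<Prod>a\<in>S. F a A) \<in> coeff_poly_maps n"
  by (induction S rule: infinite_finite_induct) (auto intro: coeff_poly_maps_const coeff_poly_maps_mult)

text \<open>A permutation that contributes to the determinant can only increase the ranks, and the ranks
  of all rows have a fixed sum.\<close>

lemma det_unique_permutation:
  fixes A :: "'a :: comm_ring_1 mat" and rank :: "nat \<Rightarrow> nat"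
  assumes A: "A \<in> carrier_mat n n" and \<tau>: "\<tau> permutes {0..<n}"
    and unique: "\<And>i j. i < n \<Longrightarrow> j < n \<Longrightarrow> A $$ (i, j) \<noteq> 0 \<Longrightarrow> i = \<tau> j \<or> rank (\<tau> j) < rank i"
  shows "det A = signof \<tau> * (\<Prod>j<n. A $$ (\<tau> j, j))"
proof -
  have zero: "(\<Prod>j<n. A $$ (p j, j)) = 0" if p: "p permutes {0..<n}" "p \<noteq> \<tau>" for p
  proof (rule ccontr)
    assume "(\<Prod>j<n. A $$ (p j, j)) \<noteq> 0"
    then have nz: "A $$ (p j, j) \<noteq> 0" if "j < n" for j
      using that prod_zero[of "{..<n}" "\<lambda>j. A $$ (p j, j)"] by auto
    have less: "p j < n" if "j < n" for j using permutes_in_image[OF p(1), of j] that by simp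
    have le: "rank (\<tau> j) \<le> rank (p j)" if "j < n" for j
      using unique[OF less[OF that] that nz[OF that]] by auto
    have "(\<Sum>j\<in>{0..<n}. rank (p j)) = (\<Sum>j\<in>{0..<n}. rank (\<tau> j))"
      using sum.permute[OF p(1), of rank] sum.permute[OF \<tau>, of rank] by (simp add: comp_def)
    then have "rank (p j) = rank (\<tau> j)" if "j < n" for j
      using sum_mono_inv[of "\<lambda>j. rank (\<tau> j)" "{0..<n}" "\<lambda>j. rank (p j)" j] le that by auto
    then have "p j = \<tau> j" if "j < n" for j
      using unique[OF less[OF that] that nz[OF that]] that by auto
    moreover have "p j = \<tau> j" if "\<not> j < n" for j
      using that permutes_not_in[OF p(1), of j] permutes_not_in[OF \<tau>, of j] by simp
    ultimately have "p = \<tau>" by blast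
    then show False using p(2) by simp
  qed
  have "det A = (\<Sum>p | p permutes {0..<n}. if p = \<tau> then signof \<tau> * (\<Prod>j<n. A $$ (\<tau> j, j)) else 0)"
    unfolding det_col[OF A] using zero by (intro sum.cong) auto
  then show ?thesis using \<tau> by (simp add: finite_permutations)
qed

context composition
begin

section \<open>Determinants with rows and columns indexed by boxes\<close>

definition box_perm :: "(nat \<Rightarrow> nat) \<Rightarrow> box \<Rightarrow> box" where
  "box_perm p b = bx (p (ix b))"

lemma box_perm_bij:
  assumes "p permutes {0..<n}"
  shows "bij_betw (box_perm p) D D"
proof -
  have "bij_betw p {..<n} {..<n}" using permutes_imp_bij[OF assms] by (simp add: atLeast0LessThan)
  moreover have "bij_betw bx {..<n} D"
    by (rule bij_betw_byWitness[where f' = ix]) (auto simp: bx_ix ix_bx bx_D ix_less)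
  ultimately show ?thesis using bij_betw_trans[OF bij_betw_trans[OF bij_ix]]
    by (simp add: box_perm_def[abs_def] comp_def)
qed

lemma det_bmat:
  fixes f :: "box \<Rightarrow> box \<Rightarrow> 'a :: comm_ring_1"
  shows "det (bmat f) = (\<Sum>p | p permutes {0..<n}. signof p * (\<Prod>b\<in>D. f (box_perm p b) b))"
proof -
  have "(\<Prod>j<n. bmat f $$ (p j, j)) = (\<Prod>b\<in>D. f (box_perm p b) b)" if "p permutes {0..<n}" for p
  proof -
    have "(\<Prod>j<n. bmat f $$ (p j, j)) = (\<Prod>b\<in>D. bmat f $$ (p (ix b), ix b))"
      using prod.reindex_bij_betw[OF bij_ix, of "\<lambda>j. bmat f $$ (p j, j)"] by simp
    also have "\<dots> = (\<Prod>b\<in>D. f (box_perm p b) b)"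
      using permutes_in_image[OF that] ix_less bx_D ix_bx
      by (intro prod.cong) (auto simp: box_perm_def bmat_def bx_ix)
    finally show ?thesis .
  qed
  then show ?thesis unfolding det_col[OF bmat_carrier] by (intro sum.cong) auto
qed

text \<open>The sign is chosen before f because it depends on \<tau> alone. One sign must serve all
  parameters of a family.\<close>

lemma det_bmat_unique:
  fixes rank :: "box \<Rightarrow> nat"
  assumes "bij_betw \<tau> D D"
  shows "\<exists>\<epsilon> :: int. \<epsilon> * \<epsilon> = 1 \<and> (\<forall>f :: box \<Rightarrow> box \<Rightarrow> 'a :: comm_ring_1.
       (\<forall>b\<in>D. \<forall>b'\<in>D. f b b' \<noteq> 0 \<longrightarrow> b = \<tau> b' \<or> rank (\<tau> b') < rank b) \<longrightarrow>
       det (bmat f) = of_int \<epsilon> * (\<Prod>b\<in>D. f (\<tau> b) b))"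
proof -
  define t where "t a = (if a < n then ix (\<tau> (bx a)) else a)" for a
  have \<tau>D: "\<tau> b \<in> D" if "b \<in> D" for b using assms that by (auto simp: bij_betw_def)
  have "bij_betw t {0..<n} {0..<n}"
  proof -
    have "bij_betw bx {..<n} D"
      by (rule bij_betw_byWitness[where f' = ix]) (auto simp: bx_ix ix_bx bx_D ix_less)
    then have "bij_betw (\<lambda>a. ix (\<tau> (bx a))) {..<n} {..<n}"
      using bij_betw_trans[OF bij_betw_trans[OF _ assms] bij_ix] by (auto simp: comp_def)
    then show ?thesis unfolding atLeast0LessThan by (subst bij_betw_cong[of _ _ "\<lambda>a. ix (\<tau> (bx a))"]) (auto simp: t_def)
  qed
  then have t: "t permutes {0..<n}" by (rule bij_imp_permutes) (auto simp: t_def)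
  show ?thesis
  proof (intro exI[of _ "sign t"] conjI allI impI)
    show "sign t * sign t = 1" by simp
    fix f :: "box \<Rightarrow> box \<Rightarrow> 'a"
    assume *: "\<forall>b\<in>D. \<forall>b'\<in>D. f b b' \<noteq> 0 \<longrightarrow> b = \<tau> b' \<or> rank (\<tau> b') < rank b"
    have "det (bmat f) = signof t * (\<Prod>j<n. bmat f $$ (t j, j))"
    proof (rule det_unique_permutation[OF bmat_carrier t, where rank = "\<lambda>a. rank (bx a)"])
      fix i j assume ij: "i < n" "j < n" "bmat f $$ (i, j) \<noteq> 0"
      then have "bx i = \<tau> (bx j) \<or> rank (\<tau> (bx j)) < rank (bx i)"
        using * bx_D[of i] bx_D[of j] by (simp add: bmat_def)
      then show "i = t j \<or> rank (bx (t j)) < rank (bx i)"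
        using ij bx_ix[OF \<tau>D[OF bx_D]] ix_bx[of i] by (auto simp: t_def)
    qed
    also have "(\<Prod>j<n. bmat f $$ (t j, j)) = (\<Prod>b\<in>D. bmat f $$ (t (ix b), ix b))"
      using prod.reindex_bij_betw[OF bij_ix, of "\<lambda>j. bmat f $$ (t j, j)"] by simp
    also have "\<dots> = (\<Prod>b\<in>D. f (\<tau> b) b)"
      by (intro prod.cong) (auto simp: t_def ix_less bx_ix \<tau>D)
    finally show "det (bmat f) = signof t * (\<Prod>b\<in>D. f (\<tau> b) b)" .
  qed
qed

text \<open>The minor is completed to a matrix of size n, which avoids submatrices. For strictly
  upper x, the rows of column m and the columns of column i have no entry of x within the blocks i,
  ..., m; they are joined by an identity block, possible as the heights agree. The variable stands
  only in the diagonal blocks common to the rows and columns of the minor, those strictly between i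
  and m.\<close>

definition pencil_entry :: "nat \<Rightarrow> nat \<Rightarrow> complex mat \<Rightarrow> box \<Rightarrow> box \<Rightarrow> complex poly" where
  "pencil_entry i m x b b' =
     (if i \<le> snd b \<and> snd b \<le> m \<and> i \<le> snd b' \<and> snd b' \<le> m then
        [:x $$ (ix b, ix b'):] + (if b = b' \<and> i < snd b \<and> snd b < m then [:0, 1:] else 0) +
        (if snd b = m \<and> snd b' = i \<and> fst b = fst b' then 1 else 0)
      else if b = b' then 1 else 0)"

definition excess :: "nat \<Rightarrow> nat \<Rightarrow> nat" where
  "excess i m = card {b \<in> D. i < snd b \<and> snd b < m \<and> H m < fst b}"

text \<open>Up to sign, the determinant is the minor of \<open>x + \<lambda>\<close> with rows in the blocks \<open>i, \<dots>, m - 1\<close>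
  and columns in the blocks \<open>i + 1, \<dots>, m\<close>.  Its lowest term in \<open>\<lambda>\<close> has degree \<open>excess i m\<close>.\<close>

definition bs_invariant :: "nat \<Rightarrow> nat \<Rightarrow> complex mat \<Rightarrow> complex" where
  "bs_invariant i m x = coeff (det (bmat (pencil_entry i m x))) (excess i m)"

lemma bs_invariant_poly_maps: "bs_invariant i m \<in> poly_maps n"
proof -
  have entry: "(\<lambda>x. pencil_entry i m x b b') \<in> coeff_poly_maps n" if "b \<in> D" "b' \<in> D" for b b'
  proof -
    have "(\<lambda>x. [:x $$ (ix b, ix b'):] + r + s) \<in> coeff_poly_maps n" for r s
      using that by (intro coeff_poly_maps_add coeff_poly_maps_entry coeff_poly_maps_const ix_less)
    then show ?thesis
      by (cases "i \<le> snd b \<and> snd b \<le> m \<and> i \<le> snd b' \<and> snd b' \<le> m")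
        (simp_all only: pencil_entry_def if_True if_False simp_thms coeff_poly_maps_const)
  qed
  have "box_perm p b \<in> D" if "p permutes {0..<n}" "b \<in> D" for p b
    using box_perm_bij[OF that(1)] that(2) by (auto simp: bij_betw_def)
  then have "(\<lambda>x. det (bmat (pencil_entry i m x))) \<in> coeff_poly_maps n"
    unfolding det_bmat
    by (intro coeff_poly_maps_sum coeff_poly_maps_mult coeff_poly_maps_prod coeff_poly_maps_const entry) auto
  then show ?thesis unfolding bs_invariant_def[abs_def] by (simp add: coeff_poly_maps_def)
qed

section \<open>The lowest degree in the determinant of the pencil\<close>

lemma card_block: "1 \<le> j \<Longrightarrow> j \<le> length c \<Longrightarrow> card {b \<in> D. snd b = j} = H j"
proof -
  assume "1 \<le> j" "j \<le> length c"
  then have "{b \<in> D. snd b = j} = (\<lambda>p. (p, j)) ` {1..H j}" by (auto simp: D_iff)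
  then show ?thesis by (simp add: card_image inj_on_def)
qed

lemma card_block_below: "1 \<le> j \<Longrightarrow> j \<le> length c \<Longrightarrow> card {b \<in> D. snd b = j \<and> h < fst b} = H j - h"
proof -
  assume "1 \<le> j" "j \<le> length c"
  then have "{b \<in> D. snd b = j \<and> h < fst b} = (\<lambda>p. (p, j)) ` {h<..H j}" by (auto simp: D_iff)
  then show ?thesis by (simp add: card_image inj_on_def)
qed

lemma card_middle:
  "(\<And>b. P b \<Longrightarrow> i < snd b \<and> snd b < m) \<Longrightarrow>
    card {b \<in> D. P b} = (\<Sum>j\<in>{i<..<m}. card {b \<in> D. snd b = j \<and> P b})"
proof -
  assume "\<And>b. P b \<Longrightarrow> i < snd b \<and> snd b < m"
  then have "{b \<in> D. P b} = (\<Union>j\<in>{i<..<m}. {b \<in> D. snd b = j \<and> P b})" by auto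
  then show ?thesis using finite_D by (simp, subst card_UN_disjoint) auto
qed

text \<open>A count for each column j in between: the boxes strictly between columns i and j,
  together with the moved boxes of column j, are sent injectively into the columns i, ..., j - 1. So
  at most \<open>H i = H m\<close> boxes of column j are moved, and at least
  \<open>H j - H m\<close> are fixed.\<close>

lemma many_fixed_points:
  assumes i: "1 \<le> i" "i < m" "m \<le> length c" "H i = H m"
    and q: "bij_betw q D D"
    and nz: "\<And>b. b \<in> D \<Longrightarrow> i < snd b \<Longrightarrow> snd b < m \<Longrightarrow> q b \<noteq> b \<Longrightarrow> i \<le> snd (q b) \<and> snd (q b) < snd b"
  shows "excess i m \<le> card {b \<in> D. i < snd b \<and> snd b < m \<and> q b = b}"
proof -
  have "H j - H m \<le> card {b \<in> D. snd b = j \<and> q b = b}" if j: "i < j" "j < m" for j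
  proof -
    define T where "T = {b \<in> D. i \<le> snd b \<and> snd b < j}"
    define U where "U = {b \<in> D. i < snd b \<and> snd b < j} \<union> {b \<in> D. snd b = j \<and> q b \<noteq> b}"
    have qD: "q b \<in> D" if "b \<in> D" for b using q that by (auto simp: bij_betw_def)
    have "q b \<in> T" if "b \<in> U" for b
      using nz[of b] that j qD[of b] by (cases "q b = b") (auto simp: T_def U_def)
    moreover have "inj_on q U" using q by (auto simp: bij_betw_def U_def intro: inj_on_subset)
    ultimately have "card U \<le> card T"
      using card_inj_on_le[of q U T] finite_D by (simp add: T_def image_subset_iff)
    moreover have "card U = card {b \<in> D. i < snd b \<and> snd b < j} + card {b \<in> D. snd b = j \<and> q b \<noteq> b}"
      unfolding U_def using finite_D by (intro card_Un_disjoint) auto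
    moreover have "T = {b \<in> D. i < snd b \<and> snd b < j} \<union> {b \<in> D. snd b = i}"
      using j by (auto simp: T_def)
    then have "card T = card {b \<in> D. i < snd b \<and> snd b < j} + H i"
      using finite_D i by (simp, subst card_Un_disjoint) (auto simp: card_block)
    moreover have "{b \<in> D. snd b = j} = {b \<in> D. snd b = j \<and> q b = b} \<union> {b \<in> D. snd b = j \<and> q b \<noteq> b}"
      by auto
    then have "H j = card {b \<in> D. snd b = j \<and> q b = b} + card {b \<in> D. snd b = j \<and> q b \<noteq> b}"
      using finite_D card_block[of j] i j by (simp, subst (asm) card_Un_disjoint) auto
    ultimately show ?thesis using i by simp
  qed
  moreover have "excess i m = (\<Sum>j\<in>{i<..<m}. H j - H m)"
  proof -
    have "card {b \<in> D. snd b = j \<and> i < snd b \<and> snd b < m \<and> H m < fst b} = H j - H m"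
      if "j \<in> {i<..<m}" for j
    proof -
      have "{b \<in> D. snd b = j \<and> i < snd b \<and> snd b < m \<and> H m < fst b} = {b \<in> D. snd b = j \<and> H m < fst b}"
        using that by auto
      then show ?thesis using card_block_below[of j "H m"] that i by simp
    qed
    then show ?thesis unfolding excess_def by (subst card_middle[of _ i m]) auto
  qed
  moreover have "card {b \<in> D. i < snd b \<and> snd b < m \<and> q b = b} = (\<Sum>j\<in>{i<..<m}. card {b \<in> D. snd b = j \<and> q b = b})"
    by (subst card_middle[of _ i m]) (auto intro!: sum.cong arg_cong[where f = card])
  ultimately show ?thesis by (auto intro!: sum_mono)
qed

text \<open>By \<open>many_fixed_points\<close>, a contributing permutation already collects the factor
  \<open>\<lambda>\<^bsup>excess i m\<^esup>\<close> from its fixed points, so one more factor \<open>\<lambda>\<close> raises the degree.\<close>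

lemma coeff_det_perturbed:
  assumes i: "1 \<le> i" "i < m" "m \<le> length c" "H i = H m"
    and x: "x \<in> nilradical n c"
    and E: "\<And>b b'. E b b' \<noteq> 0 \<Longrightarrow> i \<le> snd b \<and> snd b < m \<and> i < snd b' \<and> snd b' \<le> m \<and> (snd b = i \<or> snd b' = m)"
  shows "coeff (det (bmat (\<lambda>b b'. pencil_entry i m x b b' + [:0, E b b':]))) (excess i m) = bs_invariant i m x"
proof -
  define P where "P E p = (\<Prod>b\<in>D. pencil_entry i m x (box_perm p b) b + [:0, E (box_perm p b) b:])"
    for E :: "box \<Rightarrow> box \<Rightarrow> complex" and p
  have P: "coeff (P E p) (excess i m) = (if card F = excess i m
      then \<Prod>b\<in>D - F. coeff (pencil_entry i m x (box_perm p b) b) 0 else 0)"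
    if p: "p permutes {0..<n}" and F: "F = {b \<in> D. i < snd b \<and> snd b < m \<and> box_perm p b = b}"
      and E: "\<And>b b'. E b b' \<noteq> 0 \<Longrightarrow> i \<le> snd b \<and> snd b < m \<and> i < snd b' \<and> snd b' \<le> m \<and> (snd b = i \<or> snd b' = m)"
    for E p F
  proof -
    let ?g = "\<lambda>b. pencil_entry i m x (box_perm p b) b + [:0, E (box_perm p b) b:]"
    have "?g b = [:0, 1:]" if "b \<in> F" for b
      using that x E[of b b] unfolding nilradical_iff F by (auto simp: pencil_entry_def)
    then have "(\<Prod>b\<in>F. ?g b) = monom 1 (card F)"
      by (simp add: monom_altdef)
    moreover have "P E p = (\<Prod>b\<in>F. ?g b) * (\<Prod>b\<in>D - F. ?g b)"
      unfolding P_def by (subst mult.commute, rule prod.subset_diff) (auto simp: F finite_D)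
    ultimately have eq: "P E p = monom 1 (card F) * (\<Prod>b\<in>D - F. ?g b)" by simp
    show ?thesis
    proof (cases "P E p = 0")
      case False
      then have nz: "?g b \<noteq> 0" if "b \<in> D" for b
        using that finite_D by (auto simp: P_def)
      have "excess i m \<le> card F" unfolding F
      proof (rule many_fixed_points[OF i box_perm_bij[OF p]])
        fix b assume b: "b \<in> D" "i < snd b" "snd b < m" "box_perm p b \<noteq> b"
        then have qD: "box_perm p b \<in> D" using box_perm_bij[OF p] by (auto simp: bij_betw_def)
        consider "pencil_entry i m x (box_perm p b) b \<noteq> 0" | "E (box_perm p b) b \<noteq> 0"
          using nz[OF b(1)] by fastforce
        then show "i \<le> snd (box_perm p b) \<and> snd (box_perm p b) < snd b"
        proof cases
          case 1
          then have "i \<le> snd (box_perm p b) \<and> x $$ (ix (box_perm p b), ix b) \<noteq> 0"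
            using b by (auto simp: pencil_entry_def split: if_splits)
          then show ?thesis using x qD b(1) unfolding nilradical_iff by blast
        next
          case 2
          then show ?thesis using E[OF 2] b by auto
        qed
      qed
      then show ?thesis unfolding eq by (auto simp: coeff_monom_mult coeff_0_prod)
    next
      case True
      then have "(\<Prod>b\<in>D - F. ?g b) = 0" using eq by auto
      then have "(\<Prod>b\<in>D - F. coeff (pencil_entry i m x (box_perm p b) b) 0) = 0"
        using coeff_0_prod[of ?g "D - F"] by simp
      then show ?thesis using True by simp
    qed
  qed
  \<comment> \<open>The formula \<open>P\<close> for the coefficient does not mention E, so it can
    be compared with E = 0.\<close>
  have "coeff (P E p) (excess i m) = coeff (P (\<lambda>_ _. 0) p) (excess i m)" if "p permutes {0..<n}" for p
    using P[OF that refl, of E] P[OF that refl, of "\<lambda>_ _. 0"] E by simp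
  then have "coeff (signof p * P E p) (excess i m) = coeff (signof p * P (\<lambda>_ _. 0) p) (excess i m)"
    if "p permutes {0..<n}" for p
    using that by (cases p rule: sign_cases) auto
  then show ?thesis
    unfolding bs_invariant_def det_bmat coeff_sum by (intro sum.cong) (auto simp: P_def)
qed

end

section \<open>The minors on the section and on the row family\<close>

locale neighbours = composition +
  fixes N :: "nat \<Rightarrow> bool" and i m :: nat
  assumes range: "1 \<le> i" "i < m" "m \<le> length c"
    and heights: "H i = H m" "\<And>j. i < j \<Longrightarrow> j < m \<Longrightarrow> H j \<noteq> H m"
begin

abbreviation "tr \<equiv> track c N"
abbreviation "h \<equiv> H m"

lemma h_pos: "1 \<le> h"
  using height_pos[of m] range by simp

text \<open>A label changes its row only on passing a column whose height equals that row, and then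
  by one. Column i fills exactly the rows up to h with its own labels, and no column strictly
  between i and m has height h, so the rows up to h and the rows below never exchange
  labels.\<close>

lemma track_low_high:
  assumes "i \<le> j" "j < m"
  shows "(\<forall>p. 1 \<le> p \<and> p \<le> h \<longrightarrow> tr j p \<in> D \<and> i \<le> snd (tr j p) \<and> fst (tr j p) \<le> h) \<and>
    (\<forall>p. h < p \<and> tr j p \<noteq> (0, 0) \<longrightarrow> h < fst (tr j p) \<or> snd (tr j p) < i)"
  using assms
proof (induction j rule: dec_induct)
  case base
  obtain i' where i': "i = Suc i'" using range(1) by (cases i) auto
  then show ?case
    using range heights(1) track_col[of i' N] by (auto simp: D_iff less_Suc_eq_le)
next
  case (step j)
  then have IH: "\<And>p. 1 \<le> p \<Longrightarrow> p \<le> h \<Longrightarrow> tr j p \<in> D \<and> i \<le> snd (tr j p) \<and> fst (tr j p) \<le> h"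
    "\<And>p. h < p \<Longrightarrow> tr j p \<noteq> (0, 0) \<Longrightarrow> h < fst (tr j p) \<or> snd (tr j p) < i"
    by auto
  have hj: "1 \<le> H (Suc j)" "H (Suc j) \<noteq> h"
    using height_pos[of "Suc j"] heights(2)[of "Suc j"] range step by auto
  have "tr (Suc j) p \<in> D \<and> i \<le> snd (tr (Suc j) p) \<and> fst (tr (Suc j) p) \<le> h" if "1 \<le> p" "p \<le> h" for p
    using that hj IH(1)[of p] IH(1)[of "p - 1"] step range by (auto simp: D_iff)
  moreover have "h < fst (tr (Suc j) p) \<or> snd (tr (Suc j) p) < i" if "h < p" "tr (Suc j) p \<noteq> (0, 0)" for p
    using that hj IH(2)[of p] IH(2)[of "p - 1"] by (auto split: if_splits)
  ultimately show ?case by blast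
qed

lemma track_low:
  assumes "i \<le> j" "j < m" "1 \<le> p" "p \<le> h"
  shows "tr j p \<in> D" "i \<le> snd (tr j p)" "snd (tr j p) \<le> j" "fst (tr j p) \<le> h"
  using track_low_high[OF assms(1,2)] assms track_col[of j N p] range by auto

lemma track_high:
  assumes "i \<le> j" "j < m" "h < p" "tr j p \<in> D" "i \<le> snd (tr j p)"
  shows "h < fst (tr j p)"
  using track_low_high[OF assms(1,2)] assms by (metis not_D_0(1) not_le)

definition alive :: "nat \<Rightarrow> box \<Rightarrow> bool" where
  "alive j b \<longleftrightarrow> (\<exists>p. 1 \<le> p \<and> p \<le> h \<and> b = tr j p)"

lemma alive_back:
  assumes "i \<le> j" "Suc j < m" "alive (Suc j) b" "snd b \<le> j"
  shows "alive j b"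
proof -
  obtain p where p: "1 \<le> p" "p \<le> h" "b = tr (Suc j) p" using assms by (auto simp: alive_def)
  then have b: "b \<in> D" using track_low(1)[of "Suc j" p] assms by auto
  then have "b \<noteq> (0, 0)" by auto
  then obtain p' where p': "p' \<le> p" "tr j p' = b"
    using track_persist[of N j p] assms(4) p(3) by auto
  then have "1 \<le> p'" using \<open>b \<noteq> (0, 0)\<close> track_row_pos by metis
  then show ?thesis using p' p by (auto simp: alive_def)
qed

lemma not_alive_later:
  assumes "i \<le> j" "\<not> alive j b" "snd b \<le> j" "j \<le> j'" "j' < m"
  shows "\<not> alive j' b"
  using assms(4,5)
proof (induction j' rule: dec_induct)
  case (step j')
  then show ?case using alive_back[of j' b] assms by auto
qed (use assms in auto)

text \<open>The column at which the label of \<open>b\<close> is lost from the rows 1, ..., h, or m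
  if it is still there in column m - 1. It is evaluated only at labels that are alive somewhere, so
  that the set under \<open>Max\<close> is not empty.\<close>

definition death :: "box \<Rightarrow> nat" where
  "death b = Suc (Max {j. i \<le> j \<and> j < m \<and> alive j b})"

lemma alive_death: "i \<le> j \<Longrightarrow> j < m \<Longrightarrow> alive j b \<Longrightarrow> j < death b"
  unfolding death_def by (intro le_imp_less_Suc Max_ge) auto

lemma deathI:
  assumes "i < j" "j \<le> m" "alive (j - 1) b" "j < m \<Longrightarrow> \<not> alive j b"
  shows "death b = j"
proof -
  have "snd b \<le> j - 1"
    using assms track_low(3)[of "j - 1"] by (auto simp: alive_def)
  then have "\<not> alive j' b" if "j \<le> j'" "j' < m" for j'
    using not_alive_later[of j b j'] assms that by auto
  then have "{j. i \<le> j \<and> j < m \<and> alive j b} \<subseteq> {..j - 1}"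
    by (auto simp: le_diff_conv2) (metis Suc_leI Suc_pred assms(1) gr0I leI not_less_zero less_Suc_eq_le)
  then have "Max {j. i \<le> j \<and> j < m \<and> alive j b} = j - 1"
    using assms by (intro Max_eqI) (auto intro: finite_subset)
  then show ?thesis using assms by (simp add: death_def)
qed

text \<open>A box of column j stops the label arriving in its row. At the bottom of a marked column
  that label steps down instead and displaces the one from the next row. In both cases the label
  that is lost is the one at the source.\<close>

lemma source_low:
  assumes "(p, j) \<in> D" "i < j" "j < m" "p \<le> h"
  defines "q \<equiv> (if p = H j \<and> N j then p + 1 else p)"
  shows "source N (p, j) = tr (j - 1) q" "1 \<le> q" "q \<le> h" "\<not> alive j (tr (j - 1) q)"
proof -
  \<comment> \<open>If q = p + 1, then p = \<open>H j\<close> differs from h, so p < h and q stays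
    within the rows up to h.\<close>
  show q1: "1 \<le> q" and qh: "q \<le> h"
    using assms heights(2)[of j] by (auto simp: q_def D_iff)
  show "source N (p, j) = tr (j - 1) q" by (simp add: source_def q_def)
  have j: "j - 1 < m" "i \<le> j - 1" "j = Suc (j - 1)" using assms by auto
  have inj: "p' = q" if "tr (j - 1) p' = tr (j - 1) q" for p'
  proof -
    have "tr (j - 1) q \<noteq> (0, 0)" using track_low(1)[OF j(2,1) q1 qh] by (metis not_D_0(1))
    then show ?thesis using track_inj[of "j - 1" N p' q] that j range by simp
  qed
  have "snd (tr (j - 1) q) < j" using track_low(3)[OF j(2,1) q1 qh] j(3) by linarith
  then have own: "(p', j) \<noteq> tr (j - 1) q" for p' by (metis less_irrefl snd_conv)
  have "tr j p' \<noteq> tr (j - 1) q" if "1 \<le> p'" for p'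
  proof
    assume *: "tr j p' = tr (j - 1) q"
    have eq: "tr j p' = (if p' \<le> H j then (p', j) else if p' = H j + 1 \<and> N j then tr (j - 1) (p' - 1) else tr (j - 1) p')"
      by (cases j) (use that assms(2) in auto)
    have pj: "p \<le> H j" using assms(1) by (simp add: D_iff)
    consider "p' \<le> H j" "(p', j) = tr (j - 1) q" | "p' = H j + 1" "N j" "p' - 1 = q" | "H j < p'" "p' = H j + 1 \<longrightarrow> \<not> N j" "p' = q"
      using * eq inj[of p'] inj[of "p' - 1"] by (metis not_le)
    then show False
    proof cases
      case 1
      then show False using own by blast
    next
      case 2
      then have "q = H j" by linarith
      moreover have "p = H j \<Longrightarrow> q = p + 1" using 2(2) unfolding q_def by simp
      moreover have "p \<noteq> H j \<Longrightarrow> q = p" unfolding q_def by simp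
      ultimately show False by (cases "p = H j") auto
    next
      case 3
      have "p = H j \<and> N j \<Longrightarrow> q = p + 1" unfolding q_def by simp
      moreover have "\<not> (p = H j \<and> N j) \<Longrightarrow> q = p" unfolding q_def by (rule if_not_P)
      ultimately show False using 3 pj by (metis not_le)
    qed
  qed
  then show "\<not> alive j (tr (j - 1) q)" unfolding alive_def by metis
qed

text \<open>The row from which the determinant of \<open>pencil_entry\<close> picks its entry in a given column.\<close>

definition pick :: "box \<Rightarrow> box" where
  "pick b = (if snd b = i then (fst b, m)
     else if i < snd b \<and> snd b < m \<and> fst b \<le> h then source N b
     else if snd b = m then tr (m - 1) (fst b)
     else b)"

section \<open>The contributing permutation\<close>

lemma fst_le_h: "b \<in> D \<Longrightarrow> snd b = m \<or> snd b = i \<Longrightarrow> fst b \<le> h"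
  using heights(1) by (cases b) (auto simp: D_iff)

text \<open>The last conclusion recovers the column of a box from its picked row: the picked label
  is lost exactly in this column.\<close>

lemma pick_low:
  assumes "b \<in> D" "i < snd b" "snd b \<le> m" "fst b \<le> h"
  shows "pick b \<in> D" "i \<le> snd (pick b)" "snd (pick b) < snd b" "fst (pick b) \<le> h" "death (pick b) = snd b"
proof -
  obtain p j where b: "b = (p, j)" by (cases b)
  have "\<exists>q. 1 \<le> q \<and> q \<le> h \<and> pick b = tr (j - 1) q \<and> (j < m \<longrightarrow> \<not> alive j (pick b))"
  proof (cases "j < m")
    case True
    then show ?thesis using source_low[of p j] assms b by (auto simp: pick_def)
  next
    case False
    then have "pick b = tr (j - 1) p" using assms b range by (auto simp: pick_def)
    then show ?thesis using False assms b by (auto simp: D_iff)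
  qed
  then obtain q where q: "1 \<le> q" "q \<le> h" "pick b = tr (j - 1) q" "j < m \<Longrightarrow> \<not> alive j (pick b)" by blast
  have j: "i \<le> j - 1" "j - 1 < m" "i < j" "j \<le> m" using assms b by auto
  show "pick b \<in> D" "i \<le> snd (pick b)" "snd (pick b) < snd b" "fst (pick b) \<le> h"
    using track_low[OF j(1,2) q(1,2)] q b j by auto
  show "death (pick b) = snd b"
    using deathI[of j "pick b"] q j b by (auto simp: alive_def)
qed

text \<open>Three kinds of values never meet: low boxes have their values in the columns i, ..., m -
  1 and rows up to h, boxes of column i in column m, and the remaining boxes are fixed points
  elsewhere. Among low boxes \<open>death\<close> gives the column and \<open>track_inj\<close> the
  row.\<close>

lemma pick_inj: "inj_on pick D"
proof (rule inj_onI)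
  fix b b' assume D: "b \<in> D" "b' \<in> D" and eq: "pick b = pick b'"
  define low where "low b \<longleftrightarrow> i < snd b \<and> snd b \<le> m \<and> fst b \<le> h" for b :: box
  have other: "pick b = b" if "\<not> low b" "snd b \<noteq> i" "b \<in> D" for b
    using that fst_le_h[of b] range by (auto simp: pick_def low_def)
  have start: "pick b = (fst b, m)" if "snd b = i" for b using that by (simp add: pick_def)
  have low_class: "\<not> (low (pick b) \<and> snd (pick b) = m)" "i \<le> snd (pick b) \<and> snd (pick b) < m \<and> fst (pick b) \<le> h"
    if "low b" "b \<in> D" for b
    using pick_low[of b] that by (auto simp: low_def)
  have same: "b = b'" if "low b" "low b'"
  proof -
    have j: "snd b = snd b'" using pick_low(5)[of b] pick_low(5)[of b'] D that eq by (auto simp: low_def)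
    define j where "j = snd b"
    define q where "q b = (if snd b < m \<and> fst b = H (snd b) \<and> N (snd b) then fst b + 1 else fst b)" for b :: box
    have pq: "pick b = tr (j - 1) (q b)" if "low b" "snd b = j" for b
      using that by (auto simp: pick_def low_def source_def q_def)
    have "q b = q b'"
    proof (rule track_inj)
      show "tr (j - 1) (q b) = tr (j - 1) (q b')" using pq[of b] pq[of b'] that eq j by (simp add: j_def)
      have "pick b \<in> D" using pick_low(1)[OF D(1)] that(1) by (simp add: low_def)
      then show "tr (j - 1) (q b) \<noteq> (0, 0)" using pq[of b] that(1) by (auto simp: j_def)
      show "j - 1 \<le> length c" using that(1) range unfolding j_def low_def by linarith
    qed
    \<comment> \<open>Within a column \<open>q\<close> moves only the bottom row, to a row below the
      column, so equal values of \<open>q\<close> force equal rows.\<close>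
    moreover have "fst b \<le> H (snd b)" using D_iff[of "fst b" "snd b"] D by simp
    moreover have "fst b' \<le> H (snd b)" using D_iff[of "fst b'" "snd b'"] D j by simp
    ultimately have "fst b = fst b'" unfolding q_def j[symmetric] by (simp split: if_splits)
    then show ?thesis using j by (simp add: prod_eq_iff)
  qed
  have not_mixed: False if "low b" "\<not> low b'" "b \<in> D" "b' \<in> D" "pick b = pick b'" for b b'
  proof (cases "snd b' = i")
    case True
    then show False using start[of b'] low_class[OF that(1,3)] that(5) by simp
  next
    case False
    then have "b' = pick b" using other[of b'] that by simp
    then show False using low_class[OF that(1,3)] that(2) False by (auto simp: low_def)
  qed
  have not_start: False if "snd b = i" "snd b' \<noteq> i" "\<not> low b'" "b \<in> D" "b' \<in> D" "pick b = pick b'" for b b'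
  proof -
    have "b' = (fst b, m)" using other[of b'] start[of b] that by simp
    then show False using fst_le_h[of b] that range by (simp add: low_def)
  qed
  have "low b \<longleftrightarrow> low b'"
    using not_mixed[OF _ _ D eq] not_mixed[OF _ _ D(2,1) eq[symmetric]] by blast
  moreover have "snd b = i \<longleftrightarrow> snd b' = i" if "\<not> low b" "\<not> low b'"
    using not_start[OF _ _ that(2) D eq] not_start[OF _ _ that(1) D(2,1) eq[symmetric]] by blast
  ultimately consider "low b" "low b'" | "snd b = i" "snd b' = i" | "\<not> low b" "\<not> low b'" "snd b \<noteq> i" "snd b' \<noteq> i"
    by blast
  then show "b = b'"
  proof cases
    case 2
    then show ?thesis using start eq by (simp add: prod_eq_iff)
  next
    case 3
    then show ?thesis using other D eq by metis
  qed (rule same)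
qed

lemma pick_bij: "bij_betw pick D D"
proof -
  have "pick b \<in> D" if "b \<in> D" for b
  proof (cases "i < snd b \<and> snd b \<le> m \<and> fst b \<le> h")
    case True
    then show ?thesis using pick_low(1) that by blast
  next
    case False
    then show ?thesis using that fst_le_h[of b] heights(1) range by (cases b) (auto simp: pick_def D_iff)
  qed
  then show ?thesis
    using endo_inj_surj[OF finite_D _ pick_inj] pick_inj by (simp add: bij_betw_def image_subset_iff)
qed

text \<open>A label is lost at column m at the latest, so with the offset \<open>2 * m\<close> the
  boxes below row h outrank the others; among themselves they rank higher the further left they
  are.\<close>

definition rank :: "box \<Rightarrow> nat" where
  "rank b = (if snd b < i \<or> m \<le> snd b then 0 else if fst b \<le> h then death b else 2 * m + (m - snd b))"

lemma family_entry:
  assumes "b \<in> D" "b' \<in> D"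
  shows "family N \<sigma> $$ (ix b, ix b') =
     (if b = source N b' then if fst b' = H (snd b') \<and> LN (snd b') \<and> \<not> N (snd b') then \<sigma> (snd b') else 1 else 0) +
     (if fst b' = H (snd b') \<and> N (snd b') \<and> b = tr (snd b' - 1) (fst b') then \<sigma> (snd b') else 0)"
  using assms by (simp add: family_def)

lemma family_nonzero:
  assumes "b \<in> D" "b' \<in> D" "family N \<sigma> $$ (ix b, ix b') \<noteq> 0"
  shows "b = source N b' \<or> b = tr (snd b' - 1) (fst b')"
proof (rule ccontr)
  assume "\<not> ?thesis"
  then have "family N \<sigma> $$ (ix b, ix b') = 0" by (simp add: family_entry[OF assms(1,2)])
  then show False using assms(3) by simp
qed

lemma family_zero: "b \<in> D \<Longrightarrow> b' \<in> D \<Longrightarrow> snd b' \<le> snd b \<Longrightarrow> family N \<sigma> $$ (ix b, ix b') = 0"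
  using family_nilradical[of N \<sigma>] unfolding nilradical_iff by simp

text \<open>In a column through a low box, the other nonzero entries are the diagonal one and the
  starred one. Both belong to labels that survive this column and are lost later than the picked
  one. For a box below row h the competitors are boxes below row h further left. In column m the
  competitor comes from row h + 1 and outranks all low boxes.\<close>

lemma pencil_rank:
  assumes D: "b \<in> D" "b' \<in> D" and nz: "pencil_entry i m (family N \<sigma>) b b' \<noteq> 0"
  shows "b = pick b' \<or> rank (pick b') < rank b"
proof -
  obtain p j where b': "b' = (p, j)" by (cases b')
  have pj: "1 \<le> p" "p \<le> H j" "1 \<le> j" "j \<le> length c" using D b' by (auto simp: D_iff)
  consider "j < i \<or> m < j" | "j = i" | "i < j" "j < m" "p \<le> h" | "i < j" "j < m" "h < p" | "j = m" by linarith
  then show ?thesis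
  proof cases
    case 1
    then show ?thesis using nz b' range by (auto simp: pencil_entry_def pick_def split: if_splits)
  next
    case 2
    then have "snd b = m \<and> fst b = p"
      using nz b' range family_zero[OF D, of \<sigma>] by (auto simp: pencil_entry_def split: if_splits)
    then show ?thesis using 2 b' by (auto simp: pick_def prod_eq_iff)
  next
    case 3
    have low: "rank (pick b') = j"
      using pick_low[of b'] D b' 3 range by (auto simp: rank_def)
    have pick: "pick b' = source N b'" using 3 b' by (auto simp: pick_def)
    have b: "i \<le> snd b" using nz b' 3 by (auto simp: pencil_entry_def split: if_splits)
    have "b = source N b' \<or> p = H j \<and> N j \<and> b = tr (j - 1) p \<or> b = b'"
      using nz 3 b' range family_entry[OF D, of \<sigma>] by (auto simp: pencil_entry_def split: if_splits)
    then have "b = pick b' \<or> (alive j b \<and> snd b < m \<and> fst b \<le> h)"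
    proof (elim disjE conjE)
      assume *: "p = H j" "N j" "b = tr (j - 1) p"
      then have "b = tr j (p + 1)" using pj by (cases j) auto
      moreover have "p + 1 \<le> h" using * 3 heights(2)[of j] by auto
      moreover have "i \<le> j - 1" "j - 1 < m" using 3 by auto
      then have "snd b < m" "fst b \<le> h" using track_low[of "j - 1" p] 3 pj * by (auto intro: le_less_trans)
      ultimately show ?thesis by (auto simp: alive_def)
    next
      assume *: "b = b'"
      then have "b = tr j p" using track_own[of b N] D b' by simp
      then have "alive j b" using 3 pj unfolding alive_def by blast
      then show ?thesis using * b' 3 by simp
    qed (simp add: pick)
    then show ?thesis
      using low alive_death[of j b] 3 b by (auto simp: rank_def)
  next
    case 4
    then have pick: "pick b' = b'" using b' by (auto simp: pick_def)
    have b: "i \<le> snd b" using nz b' 4 by (auto simp: pencil_entry_def split: if_splits)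
    have "b = b' \<or> family N \<sigma> $$ (ix b, ix b') \<noteq> 0"
      using nz 4 b' by (auto simp: pencil_entry_def split: if_splits)
    then have "b = b' \<or> b = source N b' \<or> b = tr (j - 1) p"
      using family_nonzero[OF D] b' by auto
    then have "b = b' \<or> b = tr (j - 1) p \<or> b = tr (j - 1) (p + 1)"
      using b' by (auto simp: source_def split: if_splits)
    then have "b = b' \<or> (\<exists>q. p \<le> q \<and> b = tr (j - 1) q)" using le_add1 by blast
    then show ?thesis
    proof
      assume "\<exists>q\<ge>p. b = tr (j - 1) q"
      then obtain q where q: "p \<le> q" "b = tr (j - 1) q" by blast
      then have "h < fst b" "snd b \<le> j - 1"
        using track_high[of "j - 1" q] track_col[of "j - 1" N q] 4 D b pj by auto
      then show ?thesis using 4 b unfolding pick unfolding b' by (auto simp: rank_def)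
    qed (simp add: pick)
  next
    case 5
    have low: "rank (pick b') = m"
      using pick_low[of b'] D b' 5 range pj by (auto simp: rank_def)
    have pick: "pick b' = tr (m - 1) p" using 5 b' range by (auto simp: pick_def)
    have b: "i \<le> snd b" using nz b' 5 range by (auto simp: pencil_entry_def split: if_splits)
    have "family N \<sigma> $$ (ix b, ix b') \<noteq> 0"
      using nz 5 b' range by (auto simp: pencil_entry_def split: if_splits)
    then have "b = source N b' \<or> b = tr (m - 1) p"
      using family_nonzero[OF D] b' 5 by auto
    then have "b = tr (m - 1) p \<or> p = h \<and> b = tr (m - 1) (h + 1)"
      using b' 5 by (auto simp: source_def split: if_splits)
    moreover have "rank (pick b') < rank b" if "b = tr (m - 1) (h + 1)"
    proof -
      have "h < fst b"
        using that track_high[of "m - 1" "h + 1"] D b range by auto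
      moreover have "snd b \<le> m - 1" using that track_col[of "m - 1" N "h + 1"] range by simp
      then have "snd b < m" using range by linarith
      ultimately show ?thesis using low b range by (auto simp: rank_def)
    qed
    ultimately show ?thesis using pick by auto
  qed
qed

lemma pencil_pick:
  assumes "b \<in> D"
  shows "pencil_entry i m (family N \<sigma>) (pick b) b =
    (if i < snd b \<and> snd b < m \<and> h < fst b then [:0, 1:]
     else if b = (h, m) \<or> i < snd b \<and> snd b < m \<and> fst b = H (snd b) \<and> LN (snd b) \<and> \<not> N (snd b)
     then [:\<sigma> (snd b):] else 1)"
proof -
  obtain p j where b: "b = (p, j)" by (cases b)
  have pj: "1 \<le> p" "p \<le> H j" "1 \<le> j" "j \<le> length c" using assms b by (auto simp: D_iff)
  have LNm: "LN m" using range heights by (auto simp: has_left_neighbour_def)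
  \<comment> \<open>The source of a bottom box and the starred position have different labels, so
    the two summands of an entry of \<open>family\<close> are never added.\<close>
  have ne: "tr (j - 1) (p + 1) \<noteq> tr (j - 1) p" if "i < j" "j \<le> m" "p \<le> h"
  proof -
    have "tr (j - 1) p \<in> D" using track_low(1)[of "j - 1" p] that pj range by auto
    then have "tr (j - 1) p \<noteq> (0, 0)" by (metis not_D_0(1))
    then show ?thesis using track_inj[of "j - 1" N p "p + 1"] that pj by force
  qed
  consider "j < i \<or> m < j" | "j = i" | "i < j" "j < m" "p \<le> h" | "i < j" "j < m" "h < p" | "j = m" by linarith
  then show ?thesis
  proof cases
    case 1
    then have pick: "pick b = b" using b range by (auto simp: pick_def)
    from 1 show ?thesis
    proof
      assume "j < i"
      then show ?thesis unfolding pick using range(2) by (simp add: pencil_entry_def b)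
    next
      assume "m < j"
      then show ?thesis unfolding pick by (simp add: pencil_entry_def b)
    qed
  next
    case 2
    then have pick: "pick b = (p, m)" using b by (simp add: pick_def)
    then have "(p, m) \<in> D" using pick_bij assms by (metis bij_betwE)
    then show ?thesis using pick b 2 range family_zero[of "(p, m)" b \<sigma>] assms by (auto simp: pencil_entry_def)
  next
    case 3
    have pick: "pick b = source N b" using 3 b by (auto simp: pick_def)
    note low = pick_low[OF assms]
    have "family N \<sigma> $$ (ix (pick b), ix b) = (if p = H j \<and> LN j \<and> \<not> N j then \<sigma> j else 1)"
      using family_entry[OF low(1) assms, of \<sigma>] ne 3 b pick by (auto simp: source_def split: if_splits)
    then show ?thesis
      using low 3 b by (auto simp: pencil_entry_def one_pCons)
  next
    case 4
    then have "pick b = b" using b by (auto simp: pick_def)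
    then show ?thesis using 4 b range family_zero[OF assms assms, of \<sigma>] by (auto simp: pencil_entry_def)
  next
    case 5
    have pick: "pick b = tr (m - 1) p" using 5 b range by (auto simp: pick_def)
    have ph: "p \<le> h" using 5 pj by simp
    note low = pick_low[OF assms]
    have "family N \<sigma> $$ (ix (pick b), ix b) = (if p = h then \<sigma> m else 1)"
    proof -
      have "source N (p, m) = (if p = h \<and> N m then tr (m - 1) (p + 1) else tr (m - 1) p)"
        by (simp add: source_def)
      moreover have "tr (m - 1) p \<noteq> tr (m - 1) (p + 1)" using ne 5 ph range by force
      moreover have "pick b \<in> D" using pick_bij assms by (metis bij_betwE)
      ultimately show ?thesis
        using family_entry[OF _ assms, of "pick b" \<sigma>] LNm pick unfolding b 5
        by (cases "p = h"; cases "N m") simp_all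
    qed
    then show ?thesis
      using low 5 b range ph by (auto simp: pencil_entry_def one_pCons)
  qed
qed

text \<open>The factor \<lambda> is picked exactly at the boxes counted by \<open>excess\<close>, so
  the chosen coefficient is the product of the constants picked elsewhere. For \<open>N = LN\<close>
  the final product is empty; without steps it runs over columns before m only, which is the
  unitriangularity.\<close>

lemma bs_invariant_family:
  obtains \<epsilon> :: complex where "\<epsilon> * \<epsilon> = 1"
    "\<And>\<sigma>. bs_invariant i m (family N \<sigma>) =
       \<epsilon> * \<sigma> m * (\<Prod>j | i < j \<and> j < m \<and> H j < h \<and> LN j \<and> \<not> N j. \<sigma> j)"
proof -
  obtain \<epsilon> :: int where e: "\<epsilon> * \<epsilon> = 1"
    "\<forall>f :: box \<Rightarrow> box \<Rightarrow> complex poly.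
       (\<forall>b\<in>D. \<forall>b'\<in>D. f b b' \<noteq> 0 \<longrightarrow> b = pick b' \<or> rank (pick b') < rank b) \<longrightarrow>
       det (bmat f) = of_int \<epsilon> * (\<Prod>b\<in>D. f (pick b) b)"
    using det_bmat_unique[OF pick_bij, where rank = rank and 'a = "complex poly"] by (elim exE conjE)
  define J where "J = {j. i < j \<and> j < m \<and> H j < h \<and> LN j \<and> \<not> N j}"
  have "bs_invariant i m (family N \<sigma>) = of_int \<epsilon> * \<sigma> m * (\<Prod>j\<in>J. \<sigma> j)" for \<sigma>
  proof -
    let ?A = "{b \<in> D. i < snd b \<and> snd b < m \<and> h < fst b}"
    let ?B = "insert (h, m) ((\<lambda>j. (H j, j)) ` J)"
    have BA: "?B \<subseteq> D - ?A" using range height_pos h_pos by (auto simp: J_def D_iff)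
    have "(\<Prod>b\<in>D. pencil_entry i m (family N \<sigma>) (pick b) b)
        = (\<Prod>b\<in>D. if b \<in> ?A then [:0, 1:] else if b \<in> ?B then [:\<sigma> (snd b):] else 1)"
    proof (rule prod.cong[OF refl])
      fix b assume b: "b \<in> D"
      have iff: "b = (h, m) \<or> i < snd b \<and> snd b < m \<and> fst b = H (snd b) \<and> LN (snd b) \<and> \<not> N (snd b) \<longleftrightarrow> b \<in> ?B"
        if "b \<notin> ?A"
        using that b heights(2)[of "snd b"] by (cases b) (auto simp: J_def not_less le_less)
      show "pencil_entry i m (family N \<sigma>) (pick b) b
          = (if b \<in> ?A then [:0, 1:] else if b \<in> ?B then [:\<sigma> (snd b):] else 1)"
      proof (cases "b \<in> ?A")
        case True
        then show ?thesis unfolding pencil_pick[OF b] by simp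
      next
        case False
        then show ?thesis unfolding pencil_pick[OF b] iff[OF False] using b by simp
      qed
    qed
    also have "\<dots> = (\<Prod>b\<in>?A. [:0, 1:]) * (\<Prod>b\<in>D - ?A. if b \<in> ?B then [:\<sigma> (snd b):] else 1)"
    proof -
      let ?F = "\<lambda>b. if b \<in> ?A then [:0, 1:] else if b \<in> ?B then [:\<sigma> (snd b):] else 1"
      have "(\<Prod>b\<in>D. ?F b) = (\<Prod>b\<in>D - ?A. ?F b) * (\<Prod>b\<in>?A. ?F b)"
        by (rule prod.subset_diff) (use finite_D in auto)
      moreover have "(\<Prod>b\<in>?A. ?F b) = (\<Prod>b\<in>?A. [:0, 1:])" by (rule prod.cong) auto
      moreover have "(\<Prod>b\<in>D - ?A. ?F b) = (\<Prod>b\<in>D - ?A. if b \<in> ?B then [:\<sigma> (snd b):] else 1)"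
        by (rule prod.cong) auto
      ultimately show ?thesis by (simp only: mult.commute)
    qed
    also have "(\<Prod>b\<in>D - ?A. if b \<in> ?B then [:\<sigma> (snd b):] else 1) = (\<Prod>b\<in>?B. [:\<sigma> (snd b):])"
      using BA finite_D by (intro prod.mono_neutral_cong_right) auto
    also have "\<dots> = [:\<sigma> m:] * (\<Prod>j\<in>J. [:\<sigma> j:])"
      by (subst prod.insert) (auto simp: J_def prod.reindex inj_on_def)
    also have "(\<Prod>b\<in>?A. [:0, 1:]) = monom (1 :: complex) (excess i m)"
      by (simp add: monom_altdef excess_def)
    finally have "det (bmat (pencil_entry i m (family N \<sigma>)))
        = of_int \<epsilon> * (monom 1 (excess i m) * ([:\<sigma> m:] * (\<Prod>j\<in>J. [:\<sigma> j:])))"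
      using e(2)[rule_format, OF pencil_rank] by simp
    then have "bs_invariant i m (family N \<sigma>) = of_int \<epsilon> * coeff ([:\<sigma> m:] * (\<Prod>j\<in>J. [:\<sigma> j:])) 0"
      by (simp add: bs_invariant_def of_int_poly coeff_monom_mult_self del: mult_pCons_right)
    then show ?thesis by (simp add: coeff_0_prod coeff_mult)
  qed
  then show ?thesis using that[of "of_int \<epsilon>"] e(1) unfolding J_def by (metis of_int_1 of_int_mult)
qed

end

section \<open>Semi-invariance\<close>

lemma prod_const_poly: "(\<Prod>a\<in>S. [:f a:]) = [:\<Prod>a\<in>S. f a:]" for f :: "'b \<Rightarrow> 'a :: comm_ring_1"
  by (induction S rule: infinite_finite_induct) (auto simp: one_pCons)

lemma sum_const_poly: "(\<Sum>a\<in>S. [:f a:]) = [:\<Sum>a\<in>S. f a:]" for f :: "'b \<Rightarrow> 'a :: comm_ring_1"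
  by (induction S rule: infinite_finite_induct) auto

lemma sum_linear_poly: "(\<Sum>a\<in>S. [:f a, g a:]) = [:\<Sum>a\<in>S. f a, \<Sum>a\<in>S. g a:]" for f :: "'b \<Rightarrow> 'a :: comm_ring_1"
  by (induction S rule: infinite_finite_induct) auto

lemma SL_simps [simp]:
  "carrier (SL n) = {A \<in> carrier_mat n n. det A = 1}" "monoid.mult (SL n) = (*)" "one (SL n) = 1\<^sub>m n"
  by (simp_all add: SL_def)

lemma SL_group: "group (SL n)"
proof (rule groupI)
  fix A assume A: "A \<in> carrier (SL n)"
  have "adj_mat A \<in> carrier_mat n n" "adj_mat A * A = 1\<^sub>m n"
    using A adj_mat[of A n] by auto
  moreover have "det (adj_mat A) = 1"
    using det_mult[of "adj_mat A" n A] A calculation by simp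
  ultimately show "\<exists>B\<in>carrier (SL n). B \<otimes>\<^bsub>SL n\<^esub> A = \<one>\<^bsub>SL n\<^esub>" by auto
qed (auto simp: det_mult assoc_mult_mat)

lemma SL_inv:
  assumes "A \<in> carrier (SL n)"
  shows "inv\<^bsub>SL n\<^esub> A \<in> carrier_mat n n" "det (inv\<^bsub>SL n\<^esub> A) = 1"
    "A * inv\<^bsub>SL n\<^esub> A = 1\<^sub>m n" "inv\<^bsub>SL n\<^esub> A * A = 1\<^sub>m n"
  using group.inv_closed[OF SL_group assms] group.r_inv[OF SL_group assms] group.l_inv[OF SL_group assms]
  by auto

lemma SL_inv_eq:
  assumes "A \<in> carrier (SL n)" "B \<in> carrier (SL n)" "A * B = 1\<^sub>m n"
  shows "inv\<^bsub>SL n\<^esub> A = B"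
  by (rule group.inv_equality[OF SL_group]) (use assms mat_mult_left_right_inverse[of A n B] in auto)

section \<open>Block triangular matrices and the parabolic subgroup\<close>

context composition
begin

abbreviation entry :: "'a mat \<Rightarrow> box \<Rightarrow> box \<Rightarrow> 'a" where
  "entry A b b' \<equiv> A $$ (ix b, ix b')"

lemma sum_D: "(\<Sum>b\<in>D. f (ix b)) = (\<Sum>j<n. f j)"
  using sum.reindex_bij_betw[OF bij_ix, of f] by simp

lemma entry_mult:
  assumes "A \<in> carrier_mat n n" "B \<in> carrier_mat n n" "b \<in> D" "b' \<in> D"
  shows "entry (A * B) b b' = (\<Sum>u\<in>D. entry A b u * entry B u b')"
  using assms ix_less[of b] ix_less[of b']
  by (simp add: sum_D[of "\<lambda>u. A $$ (ix b, u) * B $$ (u, ix b')"] times_mat_def scalar_prod_def atLeast0LessThan)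

lemma entry_one: "b \<in> D \<Longrightarrow> b' \<in> D \<Longrightarrow> entry (1\<^sub>m n) b b' = (if b = b' then 1 else 0)"
  using ix_less ix_inj by (auto simp: inj_on_def)

lemma entry_smult_one: "b \<in> D \<Longrightarrow> b' \<in> D \<Longrightarrow> entry (d \<cdot>\<^sub>m 1\<^sub>m n) b b' = (if b = b' then d else 0)"
  for d :: "'a :: comm_ring_1"
  using ix_less inj_onD[OF ix_inj, of b b'] by auto

lemma eq_entriesI:
  assumes "A \<in> carrier_mat n n" "B \<in> carrier_mat n n" "\<And>b b'. b \<in> D \<Longrightarrow> b' \<in> D \<Longrightarrow> entry A b b' = entry B b b'"
  shows "A = B"
  using eq_bmatI[OF assms(1), of "entry B"] eq_bmatI[OF assms(2), of "entry B"] assms(3) by simp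

lemma bmat_mult: "bmat f * bmat g = bmat (\<lambda>b b'. \<Sum>u\<in>D. f b u * g u b')"
  by (rule eq_bmatI) (auto simp: entry_mult)

definition upper :: "'a :: zero mat \<Rightarrow> bool" where
  "upper g \<longleftrightarrow> g \<in> carrier_mat n n \<and> (\<forall>b\<in>D. \<forall>b'\<in>D. snd b' < snd b \<longrightarrow> entry g b b' = 0)"

lemma upperD: "upper g \<Longrightarrow> g \<in> carrier_mat n n" "upper g \<Longrightarrow> b \<in> D \<Longrightarrow> b' \<in> D \<Longrightarrow> entry g b b' \<noteq> 0 \<Longrightarrow> snd b \<le> snd b'"
  by (force simp: upper_def)+

lemma parabolic_iff: "g \<in> parabolic n c \<longleftrightarrow> upper g \<and> det g = 1"
proof -
  have "(\<forall>i<n. \<forall>j<n. blk j < blk i \<longrightarrow> g $$ (i, j) = 0) \<longleftrightarrow> (\<forall>b\<in>D. \<forall>b'\<in>D. snd b' < snd b \<longrightarrow> entry g b b' = 0)"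
    using bx_D ix_bx col_bx ix_less col_ix by metis
  then show ?thesis by (auto simp: parabolic_def upper_def)
qed

lemma upper_mult: "upper g \<Longrightarrow> upper g' \<Longrightarrow> upper (g * g')" for g g' :: "'a :: comm_ring_1 mat"
proof -
  assume g: "upper g" "upper g'"
  note carr = upperD(1)[OF g(1)] upperD(1)[OF g(2)]
  have "entry (g * g') b b' = 0" if b: "b \<in> D" "b' \<in> D" "snd b' < snd b" for b b'
  proof -
    have "entry g b u * entry g' u b' = 0" if "u \<in> D" for u
      using upperD(2)[OF g(1) b(1) that] upperD(2)[OF g(2) that b(2)] b(3) by force
    then show ?thesis unfolding entry_mult[OF carr b(1,2)] by (simp add: sum.neutral)
  qed
  then show ?thesis using carr by (simp add: upper_def)
qed

text \<open>For each \<open>j\<close>, the square \<open>A\<close> of \<open>g\<close> on the blocks \<open>1, \<dots>, j\<close>, completed by the identity, is a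
  factor of \<open>g\<close> and hence invertible.\<close>

lemma upper_inverse:
  fixes g :: "complex mat"
  assumes g: "upper g" and g': "g' \<in> carrier_mat n n" "g * g' = 1\<^sub>m n" "g' * g = 1\<^sub>m n"
  shows "upper g'"
proof -
  note gc = upperD(1)[OF g]
  have "entry g' b b' = 0" if b: "b \<in> D" "b' \<in> D" "snd b' < snd b" for b b'
  proof -
    define j where "j = snd b'"
    define A where "A = bmat (\<lambda>b u. if snd b \<le> j \<and> snd u \<le> j then entry g b u else if b = u then 1 else 0)"
    define C where "C = bmat (\<lambda>b u. if snd u \<le> j then if b = u then 1 else 0 else entry g b u)"
    define B where "B = adj_mat A"
    have Ac: "A \<in> carrier_mat n n" and Cc: "C \<in> carrier_mat n n" by (simp_all add: A_def C_def)
    have Bc: "B \<in> carrier_mat n n" and AB: "A * B = det A \<cdot>\<^sub>m 1\<^sub>m n"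
      using adj_mat[OF Ac] by (simp_all add: B_def)
    have lower: "entry g u v = 0" if "u \<in> D" "v \<in> D" "j < snd u" "snd v \<le> j" for u v
      using upperD(2)[OF g that(1,2)] that by force
    have "g = C * A"
    proof (rule eq_entriesI[OF gc])
      show "C * A \<in> carrier_mat n n" using Ac Cc by simp
      fix u v assume uv: "u \<in> D" "v \<in> D"
      have "(\<Sum>w\<in>D. entry C u w * entry A w v) = (\<Sum>w\<in>D. if w = (if snd v \<le> j then u else v) then entry g u v else 0)"
      proof (rule sum.cong[OF refl])
        fix w assume w: "w \<in> D"
        show "entry C u w * entry A w v = (if w = (if snd v \<le> j then u else v) then entry g u v else 0)"
          using uv w lower[of u v] lower[of w v] by (auto simp: A_def C_def not_le)
      qed
      then show "entry g u v = entry (C * A) u v"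
        using uv finite_D by (simp add: entry_mult[OF Cc Ac uv])
    qed
    moreover have "det g \<noteq> 0" using det_mult[OF gc g'(1)] g'(2) by auto
    ultimately have dA: "det A \<noteq> 0" using det_mult[OF Cc Ac] by auto
    have B0: "entry B u b' = 0" if u: "u \<in> D" "j < snd u" for u
    proof -
      have "entry (A * B) u b' = (\<Sum>w\<in>D. if w = u then entry B u b' else 0)"
        unfolding entry_mult[OF Ac Bc u(1) b(2)] using u by (intro sum.cong) (auto simp: A_def)
      moreover have "entry (A * B) u b' = 0"
        using u by (auto simp: AB entry_smult_one[OF u(1) b(2)] j_def)
      ultimately show ?thesis using u finite_D by simp
    qed
    have gB: "(\<Sum>w\<in>D. entry g u w * entry B w b') = (if u = b' then det A else 0)" if u: "u \<in> D" for u
    proof (cases "snd u \<le> j")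
      case True
      have "(\<Sum>w\<in>D. entry g u w * entry B w b') = (\<Sum>w\<in>D. entry A u w * entry B w b')"
        using True u B0 by (intro sum.cong) (auto simp: A_def not_le)
      also have "\<dots> = entry (A * B) u b'" by (rule entry_mult[OF Ac Bc u b(2), symmetric])
      also have "\<dots> = (if u = b' then det A else 0)"
        by (simp only: AB entry_smult_one[OF u b(2)])
      finally show ?thesis .
    next
      case False
      then have "entry g u w * entry B w b' = 0" if "w \<in> D" for w
        using lower[of u w] B0[of w] u that by (cases "snd w \<le> j") auto
      then show ?thesis using False by (auto simp: j_def sum.neutral)
    qed
    \<comment> \<open>By \<open>gB\<close>, column \<open>b'\<close> of \<open>g * B\<close> is
      \<open>det A\<close> times a unit vector; cancelling g turns the left-hand side into an entry
      of B that vanishes by \<open>B0\<close>.\<close>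
    have "entry (g' * (g * B)) b b' = (\<Sum>u\<in>D. entry g' b u * (if u = b' then det A else 0))"
      using gc Bc g'(1) b gB by (subst entry_mult[OF g'(1) _ b(1,2)]) (auto intro!: sum.cong simp: entry_mult)
    also have "\<dots> = entry g' b b' * det A" using b finite_D by (simp add: if_distrib sum.delta cong: if_cong)
    also have "g' * (g * B) = B"
      using g' gc Bc assoc_mult_mat[OF g'(1) gc Bc] by simp
    finally show ?thesis using B0[of b] b dA by (simp add: j_def)
  qed
  then show ?thesis using g' by (simp add: upper_def)
qed

lemma nilradical_carrier: "x \<in> nilradical n c \<Longrightarrow> x \<in> carrier_mat n n"
  by (simp add: nilradical_def)

lemma nilradicalD: "x \<in> nilradical n c \<Longrightarrow> b \<in> D \<Longrightarrow> b' \<in> D \<Longrightarrow> entry x b b' \<noteq> 0 \<Longrightarrow> snd b < snd b'"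
  using nilradical_iff by blast

lemma nilradical_mult:
  assumes "upper g" "x \<in> nilradical n c" "upper g'"
  shows "g * x * g' \<in> nilradical n c"
proof -
  note carr = upperD(1)[OF assms(1)] nilradical_carrier[OF assms(2)] upperD(1)[OF assms(3)]
  have "entry (g * x * g') b b' = 0" if b: "b \<in> D" "b' \<in> D" "\<not> snd b < snd b'" for b b'
  proof -
    have "entry (g * x) b u * entry g' u b' = 0" if u: "u \<in> D" for u
    proof (rule ccontr)
      assume nz: "entry (g * x) b u * entry g' u b' \<noteq> 0"
      then obtain v where "v \<in> D" "entry g b v * entry x v u \<noteq> 0"
        using entry_mult[OF carr(1,2) b(1) u] by (metis (no_types, lifting) mult_zero_left sum.neutral)
      then show False
        using nz upperD(2)[OF assms(1) b(1)] upperD(2)[OF assms(3) u b(2)] nilradicalD[OF assms(2) _ u] b(3)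
        by fastforce
    qed
    then show ?thesis using carr by (subst entry_mult[OF _ carr(3) b(1,2)]) (auto simp: sum.neutral)
  qed
  then show ?thesis using carr by (simp add: nilradical_iff)
qed

lemma parabolic_carrier: "parabolic n c \<subseteq> carrier (SL n)"
  by (auto simp: parabolic_def)

lemma parabolic_inv: "g \<in> parabolic n c \<Longrightarrow> inv\<^bsub>SL n\<^esub> g \<in> parabolic n c"
  using SL_inv[of g n] upper_inverse[of g "inv\<^bsub>SL n\<^esub> g"] parabolic_carrier by (auto simp: parabolic_iff)

lemma parabolic_subgroup: "subgroup (parabolic n c) (SL n)"
proof (rule group.subgroupI[OF SL_group])
  have "upper (1\<^sub>m n :: complex mat)" by (auto simp: upper_def entry_one)
  then show "parabolic n c \<noteq> {}" using det_one parabolic_iff by blast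
next
  fix a b assume "a \<in> parabolic n c" "b \<in> parabolic n c"
  then show "a \<otimes>\<^bsub>SL n\<^esub> b \<in> parabolic n c"
    using upper_mult[of a b] det_mult[of a n b] upperD(1)[of a] upperD(1)[of b] by (simp add: parabolic_iff)
qed (use parabolic_carrier parabolic_inv in auto)

lemma det_bmat_const: "det (bmat (\<lambda>b b'. [:f b b':])) = [:det (bmat f):]" for f :: "box \<Rightarrow> box \<Rightarrow> complex"
proof -
  have "signof p * [:a:] = [:signof p * a:]" for p :: "nat \<Rightarrow> nat" and a :: complex
    by (cases p rule: sign_cases) auto
  then show ?thesis unfolding det_bmat by (simp add: prod_const_poly sum_const_poly)
qed

end

context neighbours
begin

text \<open>Multiply the pencil by the parts of g and g' that belong to the rows and columns of the
  minor. In the blocks strictly between i and m the linear part stays the identity, by triangularity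
  and g g' = 1. The error lies in block row i or block column m, where
  \<open>coeff_det_perturbed\<close> ignores it. The factor is therefore a product of two
  determinants that do not involve x.\<close>

lemma bs_invariant_conj:
  fixes g g' :: "complex mat"
  assumes g: "upper g" and g': "upper g'" and gg': "g * g' = 1\<^sub>m n"
  obtains \<chi> where "\<And>x. x \<in> nilradical n c \<Longrightarrow> bs_invariant i m (g * x * g') = \<chi> * bs_invariant i m x"
proof -
  define S where "S b \<longleftrightarrow> i \<le> snd b \<and> snd b < m" for b :: box
  define S' where "S' b \<longleftrightarrow> i < snd b \<and> snd b \<le> m" for b :: box
  define l where "l b u = (if S b \<and> S u then entry g b u else if b = u then 1 else 0)" for b u
  define r where "r b u = (if S' b \<and> S' u then entry g' b u else if b = u then 1 else 0)" for b u
  define \<delta> where "\<delta> u v = (if u = v \<and> i < snd u \<and> snd u < m then 1 else 0 :: complex)" for u v :: box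
  define E where "E b b' = (if S b \<and> S' b' then
      (\<Sum>v\<in>D. \<Sum>u\<in>D. l b u * \<delta> u v * r v b') - \<delta> b b' else 0)" for b b'
  note gc = upperD(1)[OF g] and gc' = upperD(1)[OF g']
  \<comment> \<open>For strictly upper x the pencil splits into the minor, with rows
    \<open>S\<close> and columns \<open>S'\<close>, and a complement that by \<open>same\<close>
    does not depend on x.\<close>
  have zero: "pencil_entry i m x b b' = 0" if "x \<in> nilradical n c" "b \<in> D" "b' \<in> D" "S b \<noteq> S' b'" for x b b'
    using nilradicalD[OF that(1-3)] that(4) range(2)
    by (cases "snd b < snd b'") (auto simp: pencil_entry_def S_def S'_def)
  have same: "pencil_entry i m x b b' = pencil_entry i m x' b b'"
    if "x \<in> nilradical n c" "x' \<in> nilradical n c" "b \<in> D" "b' \<in> D" "\<not> S b" "\<not> S' b'" for x x' b b'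
  proof -
    note nil = nilradicalD[OF that(1,3,4)] nilradicalD[OF that(2-4)]
    have "entry x b b' = 0 \<and> entry x' b b' = 0" if neg: "\<not> snd b < snd b'"
      using nil neg by blast
    then show ?thesis
      using that(5,6) range(2) by (cases "snd b < snd b'") (auto simp: pencil_entry_def S_def S'_def)
  qed
  have inner: "pencil_entry i m x b b' = [:entry x b b', \<delta> b b':]" if "S b" "S' b'" for x b b'
    using that range(2) by (auto simp: pencil_entry_def S_def S'_def \<delta>_def)
  have l0: "l b u = 0" if "S b" "\<not> S u" for b u using that by (auto simp: l_def)
  have r0: "r u b = 0" if "S' b" "\<not> S' u" for b u using that by (auto simp: r_def)
  have E0: "i \<le> snd b \<and> snd b < m \<and> i < snd b' \<and> snd b' \<le> m \<and> (snd b = i \<or> snd b' = m)"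
    if bD: "b \<in> D" "b' \<in> D" and nz: "E b b' \<noteq> 0" for b b'
  proof (rule ccontr)
    assume neg: "\<not> ?thesis"
    have SS: "S b" "S' b'" using nz by (auto simp: E_def split: if_splits)
    then have mid: "i < snd b" "snd b < m" "i < snd b'" "snd b' < m" using neg by (auto simp: S_def S'_def)
    have "(\<Sum>u\<in>D. l b u * \<delta> u v * r v b') = entry g b v * entry g' v b'" if v: "v \<in> D" for v
    proof -
      have "(\<Sum>u\<in>D. l b u * \<delta> u v * r v b') = (\<Sum>u\<in>D. if u = v then l b v * \<delta> v v * r v b' else 0)"
        by (rule sum.cong) (auto simp: \<delta>_def)
      also have "\<dots> = l b v * \<delta> v v * r v b'" using v finite_D by simp
      also have "\<dots> = entry g b v * entry g' v b'"
      proof -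
        \<comment> \<open>Where both factors are nonzero, triangularity places v strictly between i
          and m, so \<open>l\<close>, \<open>r\<close> and \<open>\<delta>\<close> may be replaced
          by g, g' and 1.\<close>
        have "entry g b v = 0 \<or> i < snd v" "entry g' v b' = 0 \<or> snd v < m"
          using upperD(2)[OF g bD(1) v] upperD(2)[OF g' v bD(2)] mid by linarith+
        then show ?thesis using mid by (auto simp: \<delta>_def l_def r_def S_def S'_def)
      qed
      finally show ?thesis .
    qed
    then have "(\<Sum>v\<in>D. \<Sum>u\<in>D. l b u * \<delta> u v * r v b') = entry (g * g') b b'"
      by (simp add: entry_mult[OF gc gc' bD])
    then show False using nz SS mid entry_one[OF bD] by (auto simp: E_def \<delta>_def gg')
  qed
  \<comment> \<open>\<open>coeff_det_perturbed\<close> imposes its condition on all pairs, while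
    \<open>E0\<close> supplies it for boxes of the diagram.\<close>
  define E' where "E' b b' = (if b \<in> D \<and> b' \<in> D then E b b' else 0)" for b b'
  have key: "bmat (\<lambda>b b'. [:l b b':]) * bmat (pencil_entry i m x) * bmat (\<lambda>b b'. [:r b b':])
      = bmat (\<lambda>b b'. pencil_entry i m (g * x * g') b b' + [:0, E' b b':])"
    if x: "x \<in> nilradical n c" for x
    unfolding bmat_mult
  proof (rule bmat_cong)
    fix b b' assume b: "b \<in> D" "b' \<in> D"
    have x': "g * x * g' \<in> nilradical n c" by (rule nilradical_mult[OF g x g'])
    note xc = nilradical_carrier[OF x]
    let ?lhs = "\<Sum>v\<in>D. (\<Sum>u\<in>D. [:l b u:] * pencil_entry i m x u v) * [:r v b':]"
    show "?lhs = pencil_entry i m (g * x * g') b b' + [:0, E' b b':]"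
    proof (cases "S b")
      case nS: False
      then have "l b u = (if u = b then 1 else 0)" for u by (auto simp: l_def)
      then have "[:l b u:] * pencil_entry i m x u v = (if u = b then pencil_entry i m x b v else 0)" for u v
        by simp
      then have lhs: "?lhs = (\<Sum>v\<in>D. pencil_entry i m x b v * [:r v b':])"
        using b finite_D by simp
      show ?thesis
      proof (cases "S' b'")
        case True
        then have "pencil_entry i m x b v * [:r v b':] = 0" if "v \<in> D" for v
          using zero[OF x b(1) that] nS r0[of b' v] by (cases "S' v") auto
        then show ?thesis using lhs zero[OF x' b] nS True by (simp add: E'_def E_def sum.neutral)
      next
        case False
        then have "r v b' = (if v = b' then 1 else 0)" for v by (auto simp: r_def)
        then have "pencil_entry i m x b v * [:r v b':] = (if v = b' then pencil_entry i m x b b' else 0)" for v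
          by simp
        then have "?lhs = pencil_entry i m x b b'" using lhs b finite_D by simp
        then show ?thesis using same[OF x x' b nS False] nS by (simp add: E'_def E_def)
      qed
    next
      case S: True
      show ?thesis
      proof (cases "S' b'")
        case False
        have z: "[:l b u:] * pencil_entry i m x u v * [:r v b':] = 0" if "u \<in> D" "v \<in> D" for u v
          using zero[OF x that] l0[of b u] S False that by (cases "v = b'"; cases "S u") (auto simp: r_def)
        have "?lhs = 0" unfolding sum_distrib_right by (intro sum.neutral ballI z)
        then show ?thesis using zero[OF x' b] S False by (simp add: E'_def E_def)
      next
        case True
        have "[:l b u:] * pencil_entry i m x u v * [:r v b':]
            = [:l b u * entry x u v * r v b', l b u * \<delta> u v * r v b':]" for u v
          using inner[of u v x] l0[of b u] r0[of b' v] S True by (cases "S u"; cases "S' v") auto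
        then have "?lhs = [:\<Sum>v\<in>D. \<Sum>u\<in>D. l b u * entry x u v * r v b',
            \<Sum>v\<in>D. \<Sum>u\<in>D. l b u * \<delta> u v * r v b':]"
          by (simp only: sum_distrib_right sum_linear_poly)
        moreover have "l b u * entry x u v * r v b' = entry g b u * entry x u v * entry g' v b'"
          if "u \<in> D" "v \<in> D" for u v
        proof (cases "S u \<and> S' v")
          case SS: True
          then show ?thesis using S True by (simp add: l_def r_def)
        next
          case nSS: False
          then have "l b u * entry x u v * r v b' = 0" using l0[of b u] r0[of b' v] S True by auto
          moreover have "entry g b u * entry x u v * entry g' v b' = 0"
          proof (rule ccontr)
            assume "\<not> ?thesis"
            then have "snd b \<le> snd u" "snd u < snd v" "snd v \<le> snd b'"
              using upperD(2)[OF g b(1) that(1)] nilradicalD[OF x that] upperD(2)[OF g' that(2) b(2)] by auto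
            then show False using nSS S True by (auto simp: S_def S'_def)
          qed
          ultimately show ?thesis by argo
        qed
        then have "(\<Sum>v\<in>D. \<Sum>u\<in>D. l b u * entry x u v * r v b') = entry (g * x * g') b b'"
          using gc xc gc' b
          by (subst entry_mult[OF _ gc' b]) (auto simp: entry_mult sum_distrib_right intro!: sum.cong)
        ultimately show ?thesis
          using inner[OF S True] S True b by (simp add: E'_def E_def)
      qed
    qed
  qed
  have "bs_invariant i m (g * x * g') = det (bmat l) * det (bmat r) * bs_invariant i m x"
    if x: "x \<in> nilradical n c" for x
  proof -
    have "coeff (det (bmat (\<lambda>b b'. pencil_entry i m (g * x * g') b b' + [:0, E' b b':]))) (excess i m)
        = bs_invariant i m (g * x * g')"
      using range heights(1) nilradical_mult[OF g x g'] E0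
      by (intro coeff_det_perturbed) (auto simp: E'_def split: if_splits)
    moreover have "det (bmat (\<lambda>b b'. pencil_entry i m (g * x * g') b b' + [:0, E' b b':]))
        = [:det (bmat l):] * det (bmat (pencil_entry i m x)) * [:det (bmat r):]"
      unfolding key[OF x, symmetric] det_bmat_const[symmetric]
      by (simp only: det_mult[OF mult_carrier_mat[OF bmat_carrier bmat_carrier] bmat_carrier] det_mult[OF bmat_carrier bmat_carrier])
    ultimately show ?thesis by (simp add: bs_invariant_def mult_ac)
  qed
  then show ?thesis by (rule that)
qed

end

context composition
begin

lemma conj_comp:
  assumes "g \<in> carrier (SL n)" "h \<in> carrier (SL n)" "x \<in> carrier_mat n n"
  shows "(g * h) * x * inv\<^bsub>SL n\<^esub> (g * h) = g * (h * x * inv\<^bsub>SL n\<^esub> h) * inv\<^bsub>SL n\<^esub> g"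
proof -
  have "inv\<^bsub>SL n\<^esub> (g * h) = inv\<^bsub>SL n\<^esub> h * inv\<^bsub>SL n\<^esub> g"
    using group.inv_mult_group[OF SL_group assms(1,2)] by simp
  then show ?thesis
    using assms SL_inv(1)[OF assms(1)] SL_inv(1)[OF assms(2)]
    by (simp add: assoc_mult_mat[of _ n n _ n _ n] mult_carrier_mat[of _ n n _ n])
qed

lemma conj_nilradical:
  "g \<in> parabolic n c \<Longrightarrow> x \<in> nilradical n c \<Longrightarrow> g * x * inv\<^bsub>SL n\<^esub> g \<in> nilradical n c"
  using nilradical_mult parabolic_inv by (simp add: parabolic_iff)

lemma derived_parabolic: "derived (SL n) (parabolic n c) \<subseteq> parabolic n c"
  by (rule group.derived_incl[OF SL_group subset_refl parabolic_subgroup])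

end

context neighbours
begin

text \<open>A semi-invariant of the parabolic subgroup is invariant under commutators.\<close>

lemma bs_invariant_derived:
  assumes "g \<in> derived (SL n) (parabolic n c)" "x \<in> nilradical n c"
  shows "bs_invariant i m (g * x * inv\<^bsub>SL n\<^esub> g) = bs_invariant i m x"
proof -
  let ?P = "parabolic n c"
  let ?f = "bs_invariant i m"
  let ?c = "\<lambda>g x. g * x * inv\<^bsub>SL n\<^esub> g"
  have SLP: "g \<in> carrier (SL n)" if "g \<in> ?P" for g using that parabolic_carrier by blast
  have comp: "?c (g * a) x = ?c g (?c a x)" if "g \<in> ?P" "a \<in> ?P" "x \<in> nilradical n c" for g a x
    using conj_comp[OF SLP SLP nilradical_carrier] that by blast
  have "\<exists>\<chi>. \<forall>x\<in>nilradical n c. ?f (?c g x) = \<chi> * ?f x" if "g \<in> ?P" for g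
    using bs_invariant_conj[of g "inv\<^bsub>SL n\<^esub> g"] that parabolic_inv[OF that] SL_inv(3)[OF SLP[OF that]]
    unfolding parabolic_iff by metis
  then obtain \<chi> where \<chi>: "?f (?c g x) = \<chi> g * ?f x" if "g \<in> ?P" "x \<in> nilradical n c" for g x by metis
  have cancel: "?c g (?c (inv\<^bsub>SL n\<^esub> g) x) = x" if "g \<in> ?P" "x \<in> nilradical n c" for g x
    using comp[OF that(1) parabolic_inv[OF that(1)] that(2)] SL_inv(3)[OF SLP[OF that(1)]]
      monoid.inv_one[OF group.is_monoid[OF SL_group], of n] nilradical_carrier[OF that(2)] by simp
  \<comment> \<open>The factors \<chi> are merely chosen, one for each g, and not known to be
    multiplicative; the relation therefore keeps the value of the function as a factor.\<close>
  have \<chi>_inv: "\<chi> g * \<chi> (inv\<^bsub>SL n\<^esub> g) * ?f x = ?f x" if "g \<in> ?P" "x \<in> nilradical n c" for g x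
    using cancel[OF that] \<chi>[OF that(1) conj_nilradical[OF parabolic_inv[OF that(1)] that(2)]]
      \<chi>[OF parabolic_inv[OF that(1)] that(2)] by simp
  have com: "g \<in> ?P \<and> (\<forall>x\<in>nilradical n c. ?f (?c g x) = ?f x)" if der: "g \<in> derived_set (SL n) ?P" for g
  proof -
    obtain a k where hk: "a \<in> ?P" "k \<in> ?P"
      and g: "g = a * k * inv\<^bsub>SL n\<^esub> a * inv\<^bsub>SL n\<^esub> k" using der by auto
    note P = hk parabolic_inv[OF hk(1)] parabolic_inv[OF hk(2)]
    have sub: "u * v \<in> ?P" if "u \<in> ?P" "v \<in> ?P" for u v
      using subgroup.m_closed[OF parabolic_subgroup that] by simp
    have "?f (?c g x) = ?f x" if x: "x \<in> nilradical n c" for x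
    proof -
      have "?c g x = ?c a (?c k (?c (inv\<^bsub>SL n\<^esub> a) (?c (inv\<^bsub>SL n\<^esub> k) x)))"
        unfolding g using P x sub conj_nilradical by (simp add: comp)
      then have "?f (?c g x) = \<chi> a * \<chi> (inv\<^bsub>SL n\<^esub> a) * (\<chi> k * \<chi> (inv\<^bsub>SL n\<^esub> k) * ?f x)"
        using P x conj_nilradical by (simp add: \<chi>)
      then show ?thesis using \<chi>_inv[OF hk(2) x] \<chi>_inv[OF hk(1) x] by simp
    qed
    then show ?thesis using sub P g by auto
  qed
  have "g \<in> ?P \<and> (\<forall>x\<in>nilradical n c. ?f (?c g x) = ?f x)"
    using assms(1) unfolding derived_def
  proof (induction rule: generate.induct)
    case one
    have "1\<^sub>m n \<in> ?P" using subgroup.one_closed[OF parabolic_subgroup] by simp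
    moreover have "1\<^sub>m n * x * 1\<^sub>m n = x" if "x \<in> nilradical n c" for x
      using nilradical_carrier[OF that] by simp
    ultimately show ?case using monoid.inv_one[OF group.is_monoid[OF SL_group], of n] by simp
  next
    case (incl a)
    then show ?case using com by blast
  next
    case (inv a)
    then show ?case using com[of a] parabolic_inv[of a] cancel[of a] conj_nilradical[of "inv\<^bsub>SL n\<^esub> a"] by metis
  next
    case (eng a k)
    then show ?case
      using comp[of a k] conj_nilradical[of k] subgroup.m_closed[OF parabolic_subgroup, of a k] by auto
  qed
  then show ?thesis using assms(2) by blast
qed

end

section \<open>Unipotent elements of the derived group\<close>

context composition
begin

definition transvection :: "box \<Rightarrow> box \<Rightarrow> complex \<Rightarrow> complex mat" where
  "transvection b b' s = bmat (\<lambda>u v. (if u = v then 1 else 0) + (if u = b \<and> v = b' then s else 0))"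

lemma transvection_mult:
  assumes "b \<in> D" "b' \<in> D"
  shows "transvection b b' s * bmat f = bmat (\<lambda>u v. f u v + (if u = b then s * f b' v else 0))"
    and "bmat f * transvection b b' s = bmat (\<lambda>u v. f u v + (if v = b' then s * f u b else 0))"
proof -
  show "transvection b b' s * bmat f = bmat (\<lambda>u v. f u v + (if u = b then s * f b' v else 0))"
    unfolding transvection_def bmat_mult
  proof (rule bmat_cong)
    fix u v assume "u \<in> D" "v \<in> D"
    have "(\<Sum>w\<in>D. ((if u = w then 1 else 0) + (if u = b \<and> w = b' then s else 0)) * f w v)
        = (\<Sum>w\<in>D. if u = w then f w v else 0) + (\<Sum>w\<in>D. if w = b' then if u = b then s * f w v else 0 else 0)"
      unfolding sum.distrib[symmetric] by (rule sum.cong) (auto simp: algebra_simps)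
    then show "(\<Sum>w\<in>D. ((if u = w then 1 else 0) + (if u = b \<and> w = b' then s else 0)) * f w v)
        = f u v + (if u = b then s * f b' v else 0)"
      using assms \<open>u \<in> D\<close> finite_D by simp
  qed
  show "bmat f * transvection b b' s = bmat (\<lambda>u v. f u v + (if v = b' then s * f u b else 0))"
    unfolding transvection_def bmat_mult
  proof (rule bmat_cong)
    fix u v assume "u \<in> D" "v \<in> D"
    have "(\<Sum>w\<in>D. f u w * ((if w = v then 1 else 0) + (if w = b \<and> v = b' then s else 0)))
        = (\<Sum>w\<in>D. if w = v then f u w else 0) + (\<Sum>w\<in>D. if w = b then if v = b' then s * f u w else 0 else 0)"
      unfolding sum.distrib[symmetric] by (rule sum.cong) (auto simp: algebra_simps)
    then show "(\<Sum>w\<in>D. f u w * ((if w = v then 1 else 0) + (if w = b \<and> v = b' then s else 0)))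
        = f u v + (if v = b' then s * f u b else 0)"
      using assms \<open>v \<in> D\<close> finite_D by simp
  qed
qed

lemma det_bmat_triangular:
  fixes f :: "box \<Rightarrow> box \<Rightarrow> complex" and rank :: "box \<Rightarrow> nat"
  assumes "\<And>b b'. f b b' \<noteq> 0 \<Longrightarrow> b = b' \<or> rank b' < rank b"
  shows "det (bmat f) = (\<Prod>b\<in>D. f b b)"
proof -
  have "det (bmat f) = signof id * (\<Prod>j<n. bmat f $$ (id j, j))"
  proof (rule det_unique_permutation[where rank = "\<lambda>a. rank (bx a)"])
    fix i j assume ij: "i < n" "j < n" "bmat f $$ (i, j) \<noteq> 0"
    then have "f (bx i) (bx j) \<noteq> 0" by (simp add: bmat_def)
    then have "bx i = bx j \<or> rank (bx j) < rank (bx i)" by (rule assms)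
    then show "i = id j \<or> rank (bx (id j)) < rank (bx i)" using ix_bx ij by (metis id_apply)
  qed (simp_all add: permutes_id)
  then show ?thesis using prod.reindex_bij_betw[OF bij_ix, of "\<lambda>j. bmat f $$ (j, j)"] by simp
qed

lemma one_bmat: "1\<^sub>m n = bmat (\<lambda>u v. if u = v then 1 else 0)"
  by (rule eq_bmatI) (auto simp: entry_one)

lemma transvection_SL:
  assumes "b \<in> D" "b' \<in> D" "b \<noteq> b'"
  shows "transvection b b' s \<in> carrier (SL n)"
    and "transvection b b' s * transvection b b' t = transvection b b' (s + t)"
    and "inv\<^bsub>SL n\<^esub> (transvection b b' s) = transvection b b' (- s)"
proof -
  have "det (transvection b b' s) = 1" for s
    unfolding transvection_def using assms(3)
    by (subst det_bmat_triangular[where rank = "\<lambda>u. if u = b then 1 else 0"]) (auto split: if_splits intro: prod.neutral)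
  then show SL: "transvection b b' s \<in> carrier (SL n)" for s by (simp add: transvection_def)
  show mult: "transvection b b' s * transvection b b' t = transvection b b' (s + t)" for s t
    unfolding transvection_def[of b b' t] transvection_mult(1)[OF assms(1,2)]
    unfolding transvection_def using assms(3) by (intro bmat_cong) (auto simp: algebra_simps)
  have "transvection b b' 0 = 1\<^sub>m n" unfolding one_bmat transvection_def by (rule bmat_cong) simp
  then show "inv\<^bsub>SL n\<^esub> (transvection b b' s) = transvection b b' (- s)"
    using SL_inv_eq[OF SL SL] mult by simp
qed

lemma transvection_derived:
  assumes b: "b \<in> D" "b' \<in> D" "b \<noteq> b'" "snd b \<le> snd b'"
  shows "transvection b b' s \<in> derived (SL n) (parabolic n c)"
proof -
  \<comment> \<open>The weights 2 and 1/2 keep the determinant 1 and multiply the entry at (b, b')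
    by 4. The commutator with a transvection of parameter t then has parameter 4t - t = 3t, which
    explains \<open>s / 3\<close> below.\<close>
  define w where "w u = (if u = b then 2 else if u = b' then 1 / 2 else 1 :: complex)" for u
  define d where "d = bmat (\<lambda>u v. if u = v then w u else 0)"
  define d' where "d' = bmat (\<lambda>u v. if u = v then 1 / w u else 0)"
  have w0: "w u \<noteq> 0" for u by (simp add: w_def)
  have prod_w: "(\<Prod>u\<in>D. w u) = 1"
  proof -
    have "(\<Prod>u\<in>D. w u) = w b * (w b' * (\<Prod>u\<in>D - {b} - {b'}. w u))"
      using b finite_D by (simp add: prod.remove[of D b] prod.remove[of "D - {b}" b'])
    also have "(\<Prod>u\<in>D - {b} - {b'}. w u) = 1" by (rule prod.neutral) (auto simp: w_def)
    finally show ?thesis using b by (simp add: w_def)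
  qed
  have diag_mult: "bmat (\<lambda>u v. if u = v then g u else 0) * bmat f = bmat (\<lambda>u v. g u * f u v)"
    and mult_diag: "bmat f * bmat (\<lambda>u v. if u = v then g u else 0) = bmat (\<lambda>u v. f u v * g v)"
    for f :: "box \<Rightarrow> box \<Rightarrow> complex" and g
    unfolding bmat_mult using finite_D
    by (intro bmat_cong; simp add: if_distrib[of "\<lambda>x. x * _"] if_distrib[of "\<lambda>x. _ * x"] cong: if_cong)+
  have dd': "d * d' = 1\<^sub>m n"
    unfolding d_def d'_def diag_mult one_bmat using w0 by (intro bmat_cong) auto
  have "det d = 1" "det d' = 1"
    unfolding d_def d'_def
    by (subst det_bmat_triangular[where rank = "\<lambda>_. 0"]; simp add: prod_w prod_dividef split: if_splits)+
  then have d: "d \<in> carrier (SL n)" "d' \<in> carrier (SL n)" by (simp_all add: d_def d'_def)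
  have dP: "d \<in> parabolic n c" using d by (auto simp: parabolic_iff upper_def d_def)
  let ?u = "transvection b b' (s / 3)"
  have uP: "?u \<in> parabolic n c"
    using transvection_SL(1)[OF b(1-3)] b(4) by (auto simp: parabolic_iff upper_def transvection_def)
  have "d * ?u * d' = transvection b b' (4 * (s / 3))"
    unfolding d_def d'_def transvection_def diag_mult mult_diag
    using w0 b(3) by (intro bmat_cong) (auto simp: w_def)
  then have "transvection b b' s = d * ?u * inv\<^bsub>SL n\<^esub> d * inv\<^bsub>SL n\<^esub> ?u"
    using transvection_SL(2,3)[OF b(1-3)] SL_inv_eq[OF d dd'] by simp
  then have "transvection b b' s \<in> derived_set (SL n) (parabolic n c)"
    using dP uP by auto
  then show ?thesis unfolding derived_def by (rule generate.incl)
qed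

text \<open>The exponential of s \<alpha> when \<alpha> has square zero.\<close>

definition unipotent :: "(box \<Rightarrow> box \<Rightarrow> complex) \<Rightarrow> complex \<Rightarrow> complex mat" where
  "unipotent \<alpha> s = bmat (\<lambda>u v. (if u = v then 1 else 0) + s * \<alpha> u v)"

text \<open>The condition on the inverse says that \<open>\<alpha>\<close> has square zero.\<close>

definition nilpotent_direction :: "(box \<Rightarrow> box \<Rightarrow> complex) \<Rightarrow> bool" where
  "nilpotent_direction \<alpha> \<longleftrightarrow> (\<forall>s. unipotent \<alpha> s \<in> derived (SL n) (parabolic n c) \<and>
     inv\<^bsub>SL n\<^esub> (unipotent \<alpha> s) = unipotent \<alpha> (- s))"

definition unit :: "box \<Rightarrow> box \<Rightarrow> box \<Rightarrow> box \<Rightarrow> complex" where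
  "unit b b' u v = (if u = b \<and> v = b' then 1 else 0)"

lemma nilpotent_direction_unit:
  assumes "b \<in> D" "b' \<in> D" "b \<noteq> b'" "snd b \<le> snd b'"
  shows "nilpotent_direction (unit b b')"
proof -
  have "unipotent (unit b b') s = transvection b b' s" for s
    unfolding unipotent_def transvection_def by (rule bmat_cong) (auto simp: unit_def)
  then show ?thesis
    using transvection_derived[OF assms] transvection_SL(3)[OF assms(1-3)] by (simp add: nilpotent_direction_def)
qed

text \<open>This is the unit at (b, b') conjugated by a transvection inside the same block. Removing
  the two off-diagonal units leaves a difference of diagonal units, which is not nilpotent and thus
  not reached by \<open>nilpotent_direction\<close> directly.\<close>

lemma nilpotent_direction_diagonal:
  assumes b: "b \<in> D" "b' \<in> D" "b \<noteq> b'" "snd b = snd b'"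
  shows "nilpotent_direction (\<lambda>u v. unit b b u v - unit b' b' u v + unit b b' u v - unit b' b u v)"
    (is "nilpotent_direction ?\<alpha>")
proof -
  have eq: "unipotent ?\<alpha> s = transvection b' b (-1) * transvection b b' s * transvection b' b 1" for s
    unfolding transvection_def[of b b' s] transvection_mult(1)[OF b(2,1)] transvection_mult(2)[OF b(2,1)]
    unfolding unipotent_def using b(3) by (intro bmat_cong) (auto simp: unit_def)
  note SL = transvection_SL[OF b(1-3)] transvection_SL[OF b(2,1) b(3)[symmetric]]
  have der: "transvection b' b (-1) * transvection b b' s * transvection b' b 1 \<in> derived (SL n) (parabolic n c)" for s
    using generate.eng[of _ "SL n" "derived_set (SL n) (parabolic n c)"]
      transvection_derived[OF b(1-3)] transvection_derived[OF b(2,1) b(3)[symmetric]] b(4)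
    unfolding derived_def by simp
  have "inv\<^bsub>SL n\<^esub> (transvection b' b (-1) * transvection b b' s * transvection b' b 1)
      = transvection b' b (-1) * transvection b b' (- s) * transvection b' b 1" for s
  proof -
    have "inv\<^bsub>SL n\<^esub> (transvection b' b (-1) * transvection b b' s * transvection b' b 1)
        = inv\<^bsub>SL n\<^esub> (transvection b' b 1) * (inv\<^bsub>SL n\<^esub> (transvection b b' s) * inv\<^bsub>SL n\<^esub> (transvection b' b (-1)))"
      using group.inv_mult_group[OF SL_group SL(1)[of s] SL(4)[of 1]]
        group.inv_mult_group[OF SL_group SL(4)[of "-1"] SL(1)[of s]]
        group.inv_mult_group[OF SL_group monoid.m_closed[OF group.is_monoid[OF SL_group] SL(4)[of "-1"] SL(1)[of s]] SL(4)[of 1]]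
      by simp
    then show ?thesis
      using SL(1,4) by (simp add: SL(3,6) assoc_mult_mat[of _ n n _ n _ n])
  qed
  then show ?thesis unfolding nilpotent_direction_def eq using der by blast
qed

end

section \<open>Tangent vectors at the row point\<close>

context composition
begin

text \<open>Without steps down, \<open>track\<close> finds the nearest column to the left that is
  long enough to contain the row; the value is \<open>(0, 0)\<close> at the start of a row.\<close>

definition prev :: "box \<Rightarrow> box" where
  "prev b = track c (\<lambda>_. False) (snd b - 1) (fst b)"

lemma track_False:
  "m \<le> length c \<Longrightarrow> 1 \<le> p \<Longrightarrow>
    (track c (\<lambda>_. False) m p \<in> D \<longrightarrow> fst (track c (\<lambda>_. False) m p) = p \<and> snd (track c (\<lambda>_. False) m p) \<le> m) \<and>
    (\<forall>j. 1 \<le> j \<and> j \<le> m \<and> p \<le> H j \<longrightarrow> track c (\<lambda>_. False) m p \<in> D \<and> j \<le> snd (track c (\<lambda>_. False) m p))"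
proof (induction m)
  case (Suc m)
  then show ?case by (auto simp: D_iff le_Suc_eq)
qed auto

lemma prev_D:
  assumes "v \<in> D" "prev v \<in> D"
  shows "fst (prev v) = fst v" "snd (prev v) < snd v"
  using track_False[of "snd v - 1" "fst v"] assms
  by (cases v; force simp: D_iff prev_def)+

lemma prev_latest:
  assumes "v \<in> D" "1 \<le> j" "j < snd v" "fst v \<le> H j"
  shows "prev v \<in> D" "j \<le> snd (prev v)"
  using track_False[of "snd v - 1" "fst v"] assms
  by (cases v; force simp: D_iff prev_def)+

lemma D_bounds: "b \<in> D \<Longrightarrow> 1 \<le> snd b \<and> snd b \<le> length c \<and> 1 \<le> fst b \<and> fst b \<le> H (snd b)"
  by (cases b) (simp add: D_iff)

lemma next_exists:
  assumes "b \<in> D" "snd b < j" "j \<le> length c" "fst b \<le> H j"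
  shows "\<exists>v\<in>D. prev v = b \<and> snd v \<le> j"
proof -
  define j0 where "j0 = (LEAST j. snd b < j \<and> fst b \<le> H j)"
  have j0: "snd b < j0" "fst b \<le> H j0"
    using LeastI[of "\<lambda>j. snd b < j \<and> fst b \<le> H j" j] assms unfolding j0_def by blast+
  have le: "j0 \<le> j'" if "snd b < j'" "fst b \<le> H j'" for j'
    unfolding j0_def using that by (intro Least_le) blast
  have v: "(fst b, j0) \<in> D" using j0 le[of j] assms D_bounds[OF assms(1)] by (simp add: D_iff)
  have p: "prev (fst b, j0) \<in> D" "snd b \<le> snd (prev (fst b, j0))"
    using prev_latest[OF v, of "snd b"] j0 D_bounds[OF assms(1)] by auto
  note q = prev_D[OF v p(1)]
  have "\<not> snd b < snd (prev (fst b, j0))"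
    using le[of "snd (prev (fst b, j0))"] q D_bounds[OF p(1)] by auto
  then have "prev (fst b, j0) = b" using p(2) q(1) by (simp add: prod_eq_iff)
  then show ?thesis using v le[of j] assms by force
qed

lemma prev_inj:
  assumes "v \<in> D" "v' \<in> D" "prev v \<in> D" "prev v = prev v'"
  shows "v = v'"
proof -
  have *: False if "v \<in> D" "v' \<in> D" "prev v \<in> D" "prev v = prev v'" "snd v < snd v'" for v v'
  proof -
    have "fst v = fst v'" using prev_D(1)[OF that(1,3)] prev_D(1)[OF that(2)] that(3,4) by simp
    then show False
      using prev_latest(2)[OF that(2), of "snd v"] prev_D(2)[OF that(1,3)] D_bounds[OF that(1)] that(4,5) by simp
  qed
  have "fst v = fst v'" using prev_D(1)[of v] prev_D(1)[of v'] assms by simp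
  moreover have "snd v = snd v'" using *[of v v'] *[of v' v] assms by (metis linorder_neqE_nat)
  ultimately show ?thesis by (simp add: prod_eq_iff)
qed

text \<open>\<open>bracket \<alpha>\<close> is \<open>[\<alpha>, y]\<close> for the matrix \<open>y\<close> that maps each box to the previous box of its row.\<close>

definition bracket :: "(box \<Rightarrow> box \<Rightarrow> complex) \<Rightarrow> box \<Rightarrow> box \<Rightarrow> complex" where
  "bracket \<alpha> u v = (\<Sum>w\<in>D. \<alpha> u w * (if w = prev v then 1 else 0)) - (\<Sum>w\<in>D. (if u = prev w then 1 else 0) * \<alpha> w v)"

lemma bracket_unit:
  assumes "b \<in> D" "b' \<in> D"
  shows "bracket (unit b b') u v = (if u = b \<and> prev v = b' then 1 else 0) - (if v = b' \<and> u = prev b then 1 else 0)"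
proof -
  have "(\<Sum>w\<in>D. unit b b' u w * (if w = prev v then 1 else 0)) = (\<Sum>w\<in>D. if w = b' then if u = b \<and> prev v = b' then 1 else 0 else 0)"
    by (rule sum.cong) (auto simp: unit_def)
  moreover have "(\<Sum>w\<in>D. (if u = prev w then 1 else 0) * unit b b' w v) = (\<Sum>w\<in>D. if w = b then if v = b' \<and> u = prev b then 1 else 0 else 0)"
    by (rule sum.cong) (auto simp: unit_def)
  ultimately show ?thesis using assms finite_D by (simp add: bracket_def)
qed

lemma bracket_add: "bracket (\<lambda>u v. \<alpha> u v + \<beta> u v) u v = bracket \<alpha> u v + bracket \<beta> u v"
  by (simp add: bracket_def distrib_left distrib_right sum.distrib)

lemma bracket_diff: "bracket (\<lambda>u v. \<alpha> u v - \<beta> u v) u v = bracket \<alpha> u v - bracket \<beta> u v"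
  by (simp add: bracket_def left_diff_distrib right_diff_distrib sum_subtractf)

end

text \<open>The set \<open>K\<close> is abstract because it will consist of directions defined
  through a function, not of the span of brackets itself. \<open>K_cong\<close> disregards values at
  pairs outside the diagram.\<close>

locale tangent = composition +
  fixes K :: "(box \<Rightarrow> box \<Rightarrow> complex) set"
  assumes K_zero: "(\<lambda>_ _. 0) \<in> K"
    and K_add: "\<zeta> \<in> K \<Longrightarrow> \<xi> \<in> K \<Longrightarrow> (\<lambda>u v. \<zeta> u v + \<xi> u v) \<in> K"
    and K_scale: "\<zeta> \<in> K \<Longrightarrow> (\<lambda>u v. a * \<zeta> u v) \<in> K"
    and K_cong: "\<zeta> \<in> K \<Longrightarrow> (\<And>u v. u \<in> D \<Longrightarrow> v \<in> D \<Longrightarrow> \<zeta> u v = \<xi> u v) \<Longrightarrow> \<xi> \<in> K"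
    and K_bracket: "nilpotent_direction \<alpha> \<Longrightarrow> bracket \<alpha> \<in> K"
    and K_star: "LN m \<Longrightarrow> m \<le> length c \<Longrightarrow> unit (prev (H m, m)) (H m, m) \<in> K"
begin

lemma K_diff: "\<zeta> \<in> K \<Longrightarrow> \<xi> \<in> K \<Longrightarrow> (\<lambda>u v. \<zeta> u v - \<xi> u v) \<in> K"
  using K_add[OF _ K_scale[of \<xi> "-1"]] by simp

lemma unit_zero: "b \<notin> D \<Longrightarrow> unit b b' \<in> K"
  by (rule K_cong[OF K_zero]) (auto simp: unit_def)

text \<open>The bracket of the unit at (b, prev b') is the unit at (b, b') minus the unit at (prev
  b, prev b'). Modulo \<open>K\<close> both ends may thus be moved left together.\<close>

lemma unit_moves_left:
  assumes "b \<in> D" "b' \<in> D" "prev b' \<in> D" "b \<noteq> prev b'" "snd b \<le> snd (prev b')"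
    and "prev b \<in> D \<Longrightarrow> unit (prev b) (prev b') \<in> K"
  shows "unit b b' \<in> K"
proof -
  have "bracket (unit b (prev b')) \<in> K"
    by (rule K_bracket[OF nilpotent_direction_unit[OF assms(1,3,4,5)]])
  moreover have "unit (prev b) (prev b') \<in> K" using assms(6) unit_zero by blast
  ultimately have "(\<lambda>u v. bracket (unit b (prev b')) u v + unit (prev b) (prev b') u v) \<in> K" by (rule K_add)
  then show ?thesis
  proof (rule K_cong)
    fix u v assume "u \<in> D" "v \<in> D"
    then have iff: "prev v = prev b' \<longleftrightarrow> v = b'" using prev_inj[OF assms(2) _ assms(3)] by metis
    show "bracket (unit b (prev b')) u v + unit (prev b) (prev b') u v = unit b b' u v"
      unfolding bracket_unit[OF assms(1,3)] unit_def iff by simp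
  qed
qed

text \<open>Move left: every column that contains the row of b also contains the higher row of b',
  so b reaches the start of its row first and the unit becomes zero.\<close>

lemma unit_lower_row:
  "b \<in> D \<Longrightarrow> b' \<in> D \<Longrightarrow> snd b < snd b' \<Longrightarrow> fst b' < fst b \<Longrightarrow> unit b b' \<in> K"
proof (induction "snd b'" arbitrary: b b' rule: less_induct)
  case less
  have p: "prev b' \<in> D" "snd b \<le> snd (prev b')"
    using prev_latest[of b' "snd b"] less.prems D_bounds[of b] by auto
  note q = prev_D[OF less.prems(2) p(1)]
  show ?case
  proof (rule unit_moves_left[OF less.prems(1,2) p(1) _ p(2)])
    show "b \<noteq> prev b'" using q less.prems by auto
    assume "prev b \<in> D"
    then show "unit (prev b) (prev b') \<in> K"
      using less.hyps[OF q(2)] p q prev_D[OF less.prems(1)] less.prems by auto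
  qed
qed

text \<open>Moving left keeps two boxes of a row non-consecutive, and b, being further left, reaches
  the start of the row first.\<close>

lemma unit_same_row:
  "b \<in> D \<Longrightarrow> b' \<in> D \<Longrightarrow> snd b < snd b' \<Longrightarrow> fst b' = fst b \<Longrightarrow> b \<noteq> prev b' \<Longrightarrow> unit b b' \<in> K"
proof (induction "snd b'" arbitrary: b b' rule: less_induct)
  case less
  have p: "prev b' \<in> D" "snd b \<le> snd (prev b')"
    using prev_latest[of b' "snd b"] less.prems D_bounds[of b] by auto
  note q = prev_D[OF less.prems(2) p(1)]
  have lt: "snd b < snd (prev b')" using p q less.prems by (auto simp: prod_eq_iff le_less)
  show ?case
  proof (rule unit_moves_left[OF less.prems(1,2) p(1) less.prems(5) p(2)])
    assume b0: "prev b \<in> D"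
    have "snd b \<le> snd (prev (prev b'))"
      using prev_latest(2)[OF p(1), of "snd b"] lt q less.prems D_bounds[of b] by auto
    then have "prev b \<noteq> prev (prev b')" using prev_D(2)[OF less.prems(1) b0] by auto
    then show "unit (prev b) (prev b') \<in> K"
      using less.hyps[OF q(2)] b0 p q prev_D[OF less.prems(1) b0] less.prems by auto
  qed
qed

text \<open>Now b' lies in the lower row, and the movement goes right: the column of b' contains the
  row of b, so b always has a next box, and the process ends when b' is the last box of its
  row.\<close>

lemma unit_upper_row:
  "b \<in> D \<Longrightarrow> b' \<in> D \<Longrightarrow> snd b < snd b' \<Longrightarrow> fst b < fst b' \<Longrightarrow> unit b b' \<in> K"
proof (induction "length c - snd b" arbitrary: b b' rule: less_induct)
  case less
  obtain v where v: "v \<in> D" "prev v = b" "snd v \<le> snd b'"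
    using next_exists[of b "snd b'"] less.prems D_bounds[of b'] by auto
  have fv: "fst v = fst b" "snd b < snd v" using prev_D[OF v(1)] v less.prems by auto
  have "v \<noteq> b'" using fv less.prems by auto
  then have br: "bracket (unit v b') \<in> K"
    using K_bracket[OF nilpotent_direction_unit[OF v(1) less.prems(2) _ v(3)]] by blast
  show ?case
  proof (cases "\<exists>v'\<in>D. prev v' = b'")
    case True
    then obtain v' where v': "v' \<in> D" "prev v' = b'" by blast
    have fv': "fst v' = fst b'" "snd b' < snd v'" using prev_D[OF v'(1)] v' less.prems by auto
    have "unit v v' \<in> K"
      using less.hyps[of v v'] v v' fv fv' less.prems D_bounds[OF v(1)] by auto
    then have "(\<lambda>u x. unit v v' u x - bracket (unit v b') u x) \<in> K" using br by (rule K_diff)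
    then show ?thesis
    proof (rule K_cong)
      fix u x assume "u \<in> D" "x \<in> D"
      then have iff: "prev x = b' \<longleftrightarrow> x = v'" using prev_inj[OF v'(1)] v' less.prems(2) by metis
      show "unit v v' u x - bracket (unit v b') u x = unit b b' u x"
        unfolding bracket_unit[OF v(1) less.prems(2)] unit_def iff v(2) by simp
    qed
  next
    case False
    have "(\<lambda>u x. (-1) * bracket (unit v b') u x) \<in> K" using br by (rule K_scale)
    then show ?thesis
    proof (rule K_cong)
      fix u x assume "u \<in> D" "x \<in> D"
      then have "prev x \<noteq> b'" using False by blast
      then show "(-1) * bracket (unit v b') u x = unit b b' u x"
        unfolding bracket_unit[OF v(1) less.prems(2)] unit_def v(2) by simp
    qed
  qed
qed

text \<open>Differences of diagonal units of one block are combinations of nilpotent directions, so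
  one box of a column decides for the whole column.\<close>

lemma bracket_same_column:
  assumes "b \<in> D" "b' \<in> D" "snd b = snd b'" "bracket (unit b' b') \<in> K"
  shows "bracket (unit b b) \<in> K"
proof (cases "b = b'")
  case False
  note n1 = nilpotent_direction_unit[OF assms(1,2) False] and n2 = nilpotent_direction_unit[OF assms(2,1) False[symmetric]]
  have "(\<lambda>u v. (bracket (\<lambda>u v. unit b b u v - unit b' b' u v + unit b b' u v - unit b' b u v) u v + bracket (unit b' b) u v)
      - bracket (unit b b') u v + bracket (unit b' b') u v) \<in> K"
    using assms(3,4) by (intro K_add K_diff K_bracket nilpotent_direction_diagonal assms False n1 n2) auto
  then show ?thesis by (rule K_cong) (simp add: bracket_add bracket_diff)
qed (use assms in simp)

lemma bracket_diagonal:
  assumes "b \<in> D" "u \<in> D"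
  shows "v \<in> D \<Longrightarrow> prev v = b \<Longrightarrow> x \<in> D \<Longrightarrow> bracket (unit b b) u x = unit (prev v) v u x - unit (prev b) b u x"
    and "\<not> (\<exists>v\<in>D. prev v = b) \<Longrightarrow> x \<in> D \<Longrightarrow> bracket (unit b b) u x = - unit (prev b) b u x"
proof -
  assume *: "v \<in> D" "prev v = b" "x \<in> D"
  then have iff: "prev x = b \<longleftrightarrow> x = v" using prev_inj[OF *(1)] assms(1) by metis
  show "bracket (unit b b) u x = unit (prev v) v u x - unit (prev b) b u x"
    unfolding bracket_unit[OF assms(1,1)] unit_def iff *(2) by simp
next
  assume "\<not> (\<exists>v\<in>D. prev v = b)" "x \<in> D"
  then have "prev x \<noteq> b" by blast
  then show "bracket (unit b b) u x = - unit (prev b) b u x"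
    unfolding bracket_unit[OF assms(1,1)] unit_def by simp
qed

text \<open>The bracket of the diagonal unit at a box is the link out of it minus the link into it;
  along a row this telescopes.\<close>

lemma link_from_left:
  "v \<in> D \<Longrightarrow> (\<And>b. b \<in> D \<Longrightarrow> fst b = fst v \<Longrightarrow> snd b < snd v \<Longrightarrow> bracket (unit b b) \<in> K) \<Longrightarrow> unit (prev v) v \<in> K"
proof (induction "snd v" arbitrary: v rule: less_induct)
  case less
  show ?case
  proof (cases "prev v \<in> D")
    case True
    note q = prev_D[OF less.prems(1) True]
    have "unit (prev (prev v)) (prev v) \<in> K"
      using less.hyps[OF q(2) True] less.prems(2) q by auto
    moreover have "bracket (unit (prev v) (prev v)) \<in> K" using less.prems(2)[OF True] q by simp
    ultimately have "(\<lambda>u x. bracket (unit (prev v) (prev v)) u x + unit (prev (prev v)) (prev v) u x) \<in> K"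
      by (rule K_add[rotated])
    then show ?thesis
      by (rule K_cong) (use bracket_diagonal(1)[OF True _ less.prems(1) refl] in simp)
  qed (rule unit_zero)
qed

text \<open>Downward induction on the height h of the column. Once all links in row h lie in
  \<open>K\<close>, so does the bracket of the diagonal unit at the bottom box, being a difference
  of links, and \<open>bracket_same_column\<close> covers the other boxes.\<close>

lemma bracket_diagonal_K: "b \<in> D \<Longrightarrow> bracket (unit b b) \<in> K"
proof (induction "Max (H ` {1..length c}) - H (snd b)" arbitrary: b rule: less_induct)
  case less
  define h where "h = H (snd b)"
  have Max: "H j \<le> Max (H ` {1..length c})" if "1 \<le> j" "j \<le> length c" for j using that by auto
  have IH: "bracket (unit b' b') \<in> K" if "b' \<in> D" "h < H (snd b')" for b'
  proof (rule less.hyps[OF _ that(1)])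
    have "H (snd b') \<le> Max (H ` {1..length c})" using Max[of "snd b'"] D_bounds[OF that(1)] by blast
    then show "Max (H ` {1..length c}) - H (snd b') < Max (H ` {1..length c}) - H (snd b)"
      using that(2) unfolding h_def by linarith
  qed
  \<comment> \<open>Either the link is a free direction, or no column to the left has height h; then
    all boxes to the left in row h lie in taller columns, which are settled by induction.\<close>
  have own: "unit (prev (h, j)) (h, j) \<in> K" if "(h, j) \<in> D" "H j = h" for j
  proof (cases "LN j")
    case True
    then show ?thesis using K_star[of j] that by (auto simp: D_iff)
  next
    case False
    show ?thesis
    proof (rule link_from_left[OF that(1)])
      fix b' assume b': "b' \<in> D" "fst b' = fst (h, j)" "snd b' < snd (h, j)"
      then have "H (snd b') \<noteq> h"
        using False that D_bounds[OF b'(1)] by (auto simp: has_left_neighbour_def)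
      then show "bracket (unit b' b') \<in> K" using IH[OF b'(1)] b' D_bounds[OF b'(1)] by auto
    qed
  qed
  \<comment> \<open>The remaining boxes of row h lie in taller columns. There the link into a box
    differs from the link out of it by an element of \<open>K\<close>, so one goes from right to
    left.\<close>
  have row: "unit (prev w) w \<in> K" if "w \<in> D" "fst w = h" for w
    using that
  proof (induction "length c - snd w" arbitrary: w rule: less_induct)
    case (less w)
    show ?case
    proof (cases "H (snd w) = h")
      case True
      then show ?thesis using own[of "snd w"] less.prems by (metis prod.collapse)
    next
      case False
      then have br: "bracket (unit w w) \<in> K" using IH[of w] less.prems D_bounds[of w] by auto
      show ?thesis
      proof (cases "\<exists>v\<in>D. prev v = w")
        case True
        then obtain v where v: "v \<in> D" "prev v = w" by blast
        have "fst v = h" "snd w < snd v" using prev_D[OF v(1)] v less.prems by auto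
        then have "unit (prev v) v \<in> K" using less.hyps[of v] v D_bounds[OF v(1)] by auto
        then have "(\<lambda>u x. unit (prev v) v u x - bracket (unit w w) u x) \<in> K" using br by (rule K_diff)
        then show ?thesis
          by (rule K_cong) (use bracket_diagonal(1)[OF less.prems(1) _ v] in simp)
      next
        case nex: False
        have "(\<lambda>u x. (-1) * bracket (unit w w) u x) \<in> K" using br by (rule K_scale)
        then show ?thesis
          by (rule K_cong) (use bracket_diagonal(2)[OF less.prems(1) _ nex] in simp)
      qed
    qed
  qed
  have w: "(h, snd b) \<in> D" using D_bounds[OF less.prems] by (simp add: D_iff h_def)
  have "bracket (unit (h, snd b) (h, snd b)) \<in> K"
  proof (cases "\<exists>v\<in>D. prev v = (h, snd b)")
    case True
    then obtain v where v: "v \<in> D" "prev v = (h, snd b)" by blast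
    have "fst v = h" using prev_D[OF v(1)] v w by auto
    then have "(\<lambda>u x. unit (prev v) v u x - unit (prev (h, snd b)) (h, snd b) u x) \<in> K"
      by (intro K_diff row v(1) w) simp_all
    then show ?thesis
      by (rule K_cong) (use bracket_diagonal(1)[OF w _ v] in simp)
  next
    case False
    have "(\<lambda>u x. (-1) * unit (prev (h, snd b)) (h, snd b) u x) \<in> K" using row w by (intro K_scale) auto
    then show ?thesis
      by (rule K_cong) (use bracket_diagonal(2)[OF w _ False] in simp)
  qed
  then show ?case using bracket_same_column[OF less.prems w] by simp
qed

lemma unit_K:
  assumes "b \<in> D" "b' \<in> D" "snd b < snd b'"
  shows "unit b b' \<in> K"
  using unit_lower_row[OF assms] unit_upper_row[OF assms] unit_same_row[OF assms]
    link_from_left[OF assms(2) bracket_diagonal_K] by (metis linorder_neqE_nat)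

lemma nilradical_K:
  assumes "\<And>u v. u \<in> D \<Longrightarrow> v \<in> D \<Longrightarrow> \<not> snd u < snd v \<Longrightarrow> \<zeta> u v = 0"
  shows "\<zeta> \<in> K"
proof -
  have sum_K: "(\<lambda>u v. \<Sum>a\<in>S. f a u v) \<in> K" if "finite S" "\<And>a. a \<in> S \<Longrightarrow> f a \<in> K"
    for S and f :: "box \<times> box \<Rightarrow> box \<Rightarrow> box \<Rightarrow> complex"
    using that by (induction S rule: finite_induct) (auto simp: K_zero K_add)
  let ?S = "{a \<in> D \<times> D. snd (fst a) < snd (snd a)}"
  have fin: "finite ?S" using finite_D by simp
  have "(\<lambda>u v. \<Sum>a\<in>?S. \<zeta> (fst a) (snd a) * unit (fst a) (snd a) u v) \<in> K"
    using fin by (intro sum_K K_scale unit_K) auto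
  then show ?thesis
  proof (rule K_cong)
    fix u v assume uv: "u \<in> D" "v \<in> D"
    have "(\<Sum>a\<in>?S. \<zeta> (fst a) (snd a) * unit (fst a) (snd a) u v) = (\<Sum>a\<in>?S. if a = (u, v) then \<zeta> u v else 0)"
      by (rule sum.cong) (auto simp: unit_def)
    then show "(\<Sum>a\<in>?S. \<zeta> (fst a) (snd a) * unit (fst a) (snd a) u v) = \<zeta> u v"
      using fin uv assms[OF uv] by simp
  qed
qed

end

section \<open>Vanishing on the row family\<close>

lemma poly_maps_tendsto:
  assumes "f \<in> poly_maps n"
    and "\<And>i j. i < n \<Longrightarrow> j < n \<Longrightarrow> ((\<lambda>s. Z s $$ (i, j)) \<longlongrightarrow> Z0 $$ (i, j)) F"
  shows "((\<lambda>s. f (Z s)) \<longlongrightarrow> f Z0) F"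
  using assms(1) by induction (auto intro!: tendsto_intros assms(2))

lemma poly_eq_sum_upto:
  fixes p :: "complex poly"
  assumes "degree p \<le> k"
  shows "poly p s = (\<Sum>e\<le>k. coeff p e * s ^ e)"
proof -
  have "(\<Sum>e\<le>degree p. coeff p e * s ^ e) = (\<Sum>e\<le>k. coeff p e * s ^ e)"
    using assms by (intro sum.mono_neutral_left) (auto simp: coeff_eq_0)
  then show ?thesis unfolding poly_altdef .
qed

lemma poly_cofinite_zero:
  fixes p :: "complex poly"
  assumes "finite {s. poly p s \<noteq> 0}"
  shows "p = 0"
proof (rule ccontr)
  assume "p \<noteq> 0"
  then have "finite ({s. poly p s = 0} \<union> {s. poly p s \<noteq> 0})" using assms poly_roots_finite by blast
  moreover have "{s. poly p s = 0} \<union> {s. poly p s \<noteq> 0} = UNIV" by auto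
  ultimately show False using infinite_UNIV_char_0[where 'a = complex] by simp
qed

context composition
begin

abbreviation "P' \<equiv> derived (SL n) (parabolic n c)"

definition invariant :: "(complex mat \<Rightarrow> complex) \<Rightarrow> bool" where
  "invariant f \<longleftrightarrow> (\<forall>g\<in>P'. \<forall>x\<in>nilradical n c. f (g * x * inv\<^bsub>SL n\<^esub> g) = f x)"

definition strict_upper :: "(box \<Rightarrow> box \<Rightarrow> complex) \<Rightarrow> bool" where
  "strict_upper \<zeta> \<longleftrightarrow> (\<forall>u\<in>D. \<forall>v\<in>D. \<not> snd u < snd v \<longrightarrow> \<zeta> u v = 0)"

lemma strict_upper_iff: "strict_upper \<zeta> \<longleftrightarrow> bmat \<zeta> \<in> nilradical n c"
  by (auto simp: strict_upper_def nilradical_iff)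

text \<open>The degree bound is uniform in \<zeta> and the coefficients depend polynomially on it,
  because the direction will itself vary with s when a limit is taken.\<close>

lemma poly_on_line:
  assumes "f \<in> poly_maps n"
  shows "\<exists>\<Phi>\<in>coeff_poly_maps n. \<exists>k. \<forall>\<zeta>. degree (\<Phi> (bmat \<zeta>)) \<le> k \<and>
    (\<forall>s. f (bmat (\<lambda>u v. \<eta> u v + s * \<zeta> u v)) = poly (\<Phi> (bmat \<zeta>)) s)"
  using assms
proof induction
  case (const a)
  show ?case by (rule bexI[of _ "\<lambda>_. [:a:]"]) (auto simp: coeff_poly_maps_const)
next
  case (entry i j)
  have "(\<lambda>A. [:\<eta> (bx i) (bx j):] + [:A $$ (i, j):] * [:0, 1:]) \<in> coeff_poly_maps n"
    using entry by (intro coeff_poly_maps_add coeff_poly_maps_mult coeff_poly_maps_entry coeff_poly_maps_const)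
  then show ?case
    by (rule bexI[rotated]) (use entry in \<open>auto simp: bmat_def intro!: exI[of _ 1]\<close>)
next
  case (add f g)
  obtain \<Phi> k where f: "\<Phi> \<in> coeff_poly_maps n" "\<forall>\<zeta>. degree (\<Phi> (bmat \<zeta>)) \<le> k \<and>
    (\<forall>s. f (bmat (\<lambda>u v. \<eta> u v + s * \<zeta> u v)) = poly (\<Phi> (bmat \<zeta>)) s)" using add.IH(1) by blast
  obtain \<Psi> l where g: "\<Psi> \<in> coeff_poly_maps n" "\<forall>\<zeta>. degree (\<Psi> (bmat \<zeta>)) \<le> l \<and>
    (\<forall>s. g (bmat (\<lambda>u v. \<eta> u v + s * \<zeta> u v)) = poly (\<Psi> (bmat \<zeta>)) s)" using add.IH(2) by blast
  have "degree (\<Phi> (bmat \<zeta>) + \<Psi> (bmat \<zeta>)) \<le> k + l" for \<zeta>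
    using f(2) g(2) by (intro degree_add_le) (auto intro: trans_le_add1 trans_le_add2)
  then show ?case
    using coeff_poly_maps_add[OF f(1) g(1)] f(2) g(2)
    by (intro bexI[of _ "\<lambda>A. \<Phi> A + \<Psi> A"] exI[of _ "k + l"]) auto
next
  case (mult f g)
  obtain \<Phi> k where f: "\<Phi> \<in> coeff_poly_maps n" "\<forall>\<zeta>. degree (\<Phi> (bmat \<zeta>)) \<le> k \<and>
    (\<forall>s. f (bmat (\<lambda>u v. \<eta> u v + s * \<zeta> u v)) = poly (\<Phi> (bmat \<zeta>)) s)" using mult.IH(1) by blast
  obtain \<Psi> l where g: "\<Psi> \<in> coeff_poly_maps n" "\<forall>\<zeta>. degree (\<Psi> (bmat \<zeta>)) \<le> l \<and>
    (\<forall>s. g (bmat (\<lambda>u v. \<eta> u v + s * \<zeta> u v)) = poly (\<Psi> (bmat \<zeta>)) s)" using mult.IH(2) by blast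
  have "degree (\<Phi> (bmat \<zeta>) * \<Psi> (bmat \<zeta>)) \<le> k + l" for \<zeta>
    using f(2) g(2) by (meson add_mono degree_mult_le order_trans)
  then show ?case
    using coeff_poly_maps_mult[OF f(1) g(1)] f(2) g(2)
    by (intro bexI[of _ "\<lambda>A. \<Phi> A * \<Psi> A"] exI[of _ "k + l"]) auto
qed

definition row_point :: "box \<Rightarrow> box \<Rightarrow> complex" where
  "row_point u v = (if u = prev v then 1 else 0)"

definition row_star :: "(nat \<Rightarrow> complex) \<Rightarrow> box \<Rightarrow> box \<Rightarrow> complex" where
  "row_star \<sigma> u v = (if u = prev v \<and> fst v = H (snd v) \<and> LN (snd v) then \<sigma> (snd v) else 0)"

abbreviation "row_family \<equiv> family (\<lambda>_. False)"

lemma row_family_eq: "row_family \<sigma> = bmat (\<lambda>u v. row_point u v + row_star (\<lambda>m. \<sigma> m - 1) u v)"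
  unfolding family_def by (rule bmat_cong) (auto simp: source_def prev_def row_point_def row_star_def)

lemma strict_upper_row: "strict_upper row_point" "strict_upper (row_star \<sigma>)"
  using prev_D(2) by (auto simp: strict_upper_def row_point_def row_star_def)

lemma bracket_eq: "bracket \<alpha> u v = (\<Sum>w\<in>D. \<alpha> u w * row_point w v) - (\<Sum>w\<in>D. row_point u w * \<alpha> w v)"
  by (simp add: bracket_def row_point_def)

lemma unipotent_conj:
  "unipotent \<alpha> t * bmat \<mu> * unipotent \<alpha> (- t) = bmat (\<lambda>u v. \<mu> u v
     + t * ((\<Sum>w\<in>D. \<alpha> u w * \<mu> w v) - (\<Sum>w\<in>D. \<mu> u w * \<alpha> w v))
     - t * t * (\<Sum>w\<in>D. (\<Sum>x\<in>D. \<alpha> u x * \<mu> x w) * \<alpha> w v))"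
  unfolding unipotent_def bmat_mult
proof (rule bmat_cong)
  fix u v assume uv: "u \<in> D" "v \<in> D"
  have left: "(\<Sum>x\<in>D. ((if u = x then 1 else 0) + t * \<alpha> u x) * \<mu> x w) = \<mu> u w + t * (\<Sum>x\<in>D. \<alpha> u x * \<mu> x w)" for w
  proof -
    have "(\<Sum>x\<in>D. ((if u = x then 1 else 0) + t * \<alpha> u x) * \<mu> x w)
        = (\<Sum>x\<in>D. if x = u then \<mu> u w else 0) + (\<Sum>x\<in>D. t * (\<alpha> u x * \<mu> x w))"
      unfolding sum.distrib[symmetric] by (rule sum.cong) (auto simp: algebra_simps)
    then show ?thesis using uv finite_D by (simp add: sum_distrib_left)
  qed
  have right: "(\<Sum>w\<in>D. f w * ((if w = v then 1 else 0) + - t * \<alpha> w v)) = f v - t * (\<Sum>w\<in>D. f w * \<alpha> w v)" for f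
  proof -
    have "(\<Sum>w\<in>D. f w * ((if w = v then 1 else 0) + - t * \<alpha> w v))
        = (\<Sum>w\<in>D. if w = v then f v else 0) - (\<Sum>w\<in>D. t * (f w * \<alpha> w v))"
      unfolding sum_subtractf[symmetric] by (rule sum.cong) (auto simp: algebra_simps)
    then show ?thesis using uv finite_D by (simp add: sum_distrib_left)
  qed
  show "(\<Sum>w\<in>D. (\<Sum>x\<in>D. ((if u = x then 1 else 0) + t * \<alpha> u x) * \<mu> x w) * ((if w = v then 1 else 0) + - t * \<alpha> w v))
    = \<mu> u v + t * ((\<Sum>w\<in>D. \<alpha> u w * \<mu> w v) - (\<Sum>w\<in>D. \<mu> u w * \<alpha> w v))
     - t * t * (\<Sum>w\<in>D. (\<Sum>x\<in>D. \<alpha> u x * \<mu> x w) * \<alpha> w v)"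
    unfolding left right by (simp add: algebra_simps sum.distrib sum_distrib_left)
qed

lemma nilpotent_direction_upper:
  assumes "nilpotent_direction \<alpha>" "u \<in> D" "v \<in> D" "\<alpha> u v \<noteq> 0"
  shows "snd u \<le> snd v"
proof (rule ccontr)
  assume "\<not> snd u \<le> snd v"
  moreover have "upper (unipotent \<alpha> 1)"
    using assms(1) derived_parabolic parabolic_iff unfolding nilpotent_direction_def by blast
  ultimately have "entry (unipotent \<alpha> 1) u v = 0" using assms(2,3) by (simp add: upper_def)
  moreover have "u \<noteq> v" using \<open>\<not> snd u \<le> snd v\<close> by auto
  ultimately show False using assms by (simp add: unipotent_def)
qed

lemma strict_upper_bracket:
  assumes "nilpotent_direction \<alpha>"
  shows "strict_upper (bracket \<alpha>)"
  unfolding strict_upper_def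
proof (intro ballI impI)
  fix u v assume uv: "u \<in> D" "v \<in> D" "\<not> snd u < snd v"
  have r: "snd w < snd w'" if "w \<in> D" "w' \<in> D" "row_point w w' \<noteq> 0" for w w'
    using strict_upper_row(1) that unfolding strict_upper_def by blast
  have "\<alpha> u w * row_point w v = 0" "row_point u w * \<alpha> w v = 0" if "w \<in> D" for w
    using r[OF that uv(2)] r[OF uv(1) that] nilpotent_direction_upper[OF assms uv(1) that]
      nilpotent_direction_upper[OF assms that uv(2)] uv(3) by (auto simp: not_less intro: ccontr)
  then show "bracket \<alpha> u v = 0" by (simp add: bracket_eq sum.neutral)
qed

text \<open>The lowest homogeneous component \<open>G\<close> of \<open>f\<close> at \<open>row_point\<close> is invariant under translation by
  tangent vectors of the orbit, so it is determined by its values on the span of \<open>row_star\<close>.\<close>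

lemma vanishing_on_row_family:
  assumes f: "f \<in> poly_maps n" "invariant f"
    and zero: "\<And>\<sigma>. (\<And>m. \<sigma> m \<noteq> 0) \<Longrightarrow> f (row_family \<sigma>) = 0"
    and x: "x \<in> nilradical n c"
  shows "f x = 0"
proof (rule ccontr)
  assume fx: "f x \<noteq> 0"
  obtain \<Phi> k where \<Phi>: "\<Phi> \<in> coeff_poly_maps n" and deg: "\<And>\<zeta>. degree (\<Phi> (bmat \<zeta>)) \<le> k"
    and line: "\<And>\<zeta> s. f (bmat (\<lambda>u v. row_point u v + s * \<zeta> u v)) = poly (\<Phi> (bmat \<zeta>)) s"
    using poly_on_line[OF f(1), of row_point] by blast
  define \<zeta>1 where "\<zeta>1 u v = entry x u v - row_point u v" for u v
  have "x = bmat (\<lambda>u v. row_point u v + 1 * \<zeta>1 u v)"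
    using nilradical_carrier[OF x] by (intro eq_bmatI) (auto simp: \<zeta>1_def)
  then have "\<Phi> (bmat \<zeta>1) \<noteq> 0" using line[of 1 \<zeta>1] fx by auto
  moreover have "strict_upper \<zeta>1"
    using x strict_upper_row(1) by (auto simp: strict_upper_def \<zeta>1_def nilradical_iff)
  ultimately have ex: "\<exists>d. \<exists>\<zeta>. strict_upper \<zeta> \<and> coeff (\<Phi> (bmat \<zeta>)) d \<noteq> 0"
    by (metis leading_coeff_0_iff)
  \<comment> \<open>The order of vanishing of f at the row point, taken over all strictly upper
    directions.\<close>
  define d where "d = (LEAST d. \<exists>\<zeta>. strict_upper \<zeta> \<and> coeff (\<Phi> (bmat \<zeta>)) d \<noteq> 0)"
  define G where "G \<zeta> = coeff (\<Phi> (bmat \<zeta>)) d" for \<zeta>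
  obtain \<zeta>0 where \<zeta>0: "strict_upper \<zeta>0" "G \<zeta>0 \<noteq> 0" using LeastI_ex[OF ex] unfolding d_def G_def by blast
  have low: "coeff (\<Phi> (bmat \<zeta>)) e = 0" if "strict_upper \<zeta>" "e < d" for \<zeta> e
    using not_less_Least[of e] that unfolding d_def by blast
  have dk: "d \<le> k" using deg[of \<zeta>0] \<zeta>0(2) le_degree[of "\<Phi> (bmat \<zeta>0)" d] unfolding G_def by linarith
  \<comment> \<open>On the line through the row point in a starred direction, all but finitely many
    points have nonzero parameters. So f vanishes on the whole line.\<close>
  have star: "G (row_star \<sigma>) = 0" for \<sigma>
  proof -
    have "finite (\<Union>m\<le>length c. {s. 1 + s * \<sigma> m = 0})"
    proof (intro finite_UN_I)
      fix m
      have "s = - 1 / \<sigma> m" if "1 + s * \<sigma> m = 0" for s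
      proof -
        have "s * \<sigma> m = - 1" using that by (simp add: add_eq_0_iff)
        moreover from this have "\<sigma> m \<noteq> 0" by auto
        ultimately show ?thesis by (metis nonzero_mult_div_cancel_right)
      qed
      then have "{s. 1 + s * \<sigma> m = 0} \<subseteq> {- 1 / \<sigma> m}" by blast
      then show "finite {s. 1 + s * \<sigma> m = 0}" using finite_subset by blast
    qed simp
    moreover have "poly (\<Phi> (bmat (row_star \<sigma>))) s = 0" if "s \<notin> (\<Union>m\<le>length c. {s. 1 + s * \<sigma> m = 0})" for s
    proof -
      define \<sigma>' where "\<sigma>' m = (if m \<le> length c then 1 + s * \<sigma> m else 1)" for m
      have "row_family \<sigma>' = bmat (\<lambda>u v. row_point u v + s * row_star \<sigma> u v)"
        unfolding row_family_eq using D_bounds by (intro bmat_cong) (auto simp: row_star_def \<sigma>'_def)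
      moreover have "\<sigma>' m \<noteq> 0" for m using that by (auto simp: \<sigma>'_def)
      ultimately show ?thesis using zero[of \<sigma>'] line by simp
    qed
    then have "{s. poly (\<Phi> (bmat (row_star \<sigma>))) s \<noteq> 0} \<subseteq> (\<Union>m\<le>length c. {s. 1 + s * \<sigma> m = 0})" by blast
    ultimately have "\<Phi> (bmat (row_star \<sigma>)) = 0" using poly_cofinite_zero finite_subset by blast
    then show ?thesis by (simp add: G_def)
  qed
  \<comment> \<open>Conjugation by \<open>unipotent \<alpha> (s * \<beta>)\<close> turns the
    direction \<zeta> at parameter s into \<zeta> + \<beta> [\<alpha>, y] + O(s) without changing f.
    Divide both expansions by \<open>s ^ d\<close> (the quotient is \<open>R\<close>) and let s tend
    to 0.\<close>
  have translate: "G (\<lambda>u v. \<zeta> u v + \<beta> * bracket \<alpha> u v) = G \<zeta>"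
    if \<alpha>: "nilpotent_direction \<alpha>" and \<zeta>: "strict_upper \<zeta>" for \<alpha> \<beta> \<zeta>
  proof -
    define \<mu> where "\<mu> s u v = row_point u v + s * \<zeta> u v" for s u v
    define \<xi> where "\<xi> s u v = \<zeta> u v + \<beta> * bracket \<alpha> u v
      + s * \<beta> * ((\<Sum>w\<in>D. \<alpha> u w * \<zeta> w v) - (\<Sum>w\<in>D. \<zeta> u w * \<alpha> w v))
      - s * \<beta> * \<beta> * (\<Sum>w\<in>D. (\<Sum>x\<in>D. \<alpha> u x * \<mu> s x w) * \<alpha> w v)" for s u v
    have conj: "unipotent \<alpha> (s * \<beta>) * bmat (\<mu> s) * inv\<^bsub>SL n\<^esub> (unipotent \<alpha> (s * \<beta>))
        = bmat (\<lambda>u v. row_point u v + s * \<xi> s u v)" for s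
    proof -
      have inv: "inv\<^bsub>SL n\<^esub> (unipotent \<alpha> (s * \<beta>)) = unipotent \<alpha> (- (s * \<beta>))"
        using \<alpha> unfolding nilpotent_direction_def by blast
      have first: "(\<Sum>w\<in>D. \<alpha> u w * \<mu> s w v) - (\<Sum>w\<in>D. \<mu> s u w * \<alpha> w v)
          = bracket \<alpha> u v + s * ((\<Sum>w\<in>D. \<alpha> u w * \<zeta> w v) - (\<Sum>w\<in>D. \<zeta> u w * \<alpha> w v))" for u v
        unfolding \<mu>_def bracket_eq by (simp add: algebra_simps sum.distrib sum_distrib_left)
      show ?thesis
        unfolding inv unipotent_conj first
      proof (rule bmat_cong)
        fix u v
        have "\<mu> s u v = row_point u v + s * \<zeta> u v" by (simp add: \<mu>_def)
        then show "\<mu> s u v + s * \<beta> * (bracket \<alpha> u v + s * ((\<Sum>w\<in>D. \<alpha> u w * \<zeta> w v) - (\<Sum>w\<in>D. \<zeta> u w * \<alpha> w v)))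
            - s * \<beta> * (s * \<beta>) * (\<Sum>w\<in>D. (\<Sum>x\<in>D. \<alpha> u x * \<mu> s x w) * \<alpha> w v) = row_point u v + s * \<xi> s u v"
          unfolding \<xi>_def by (simp only: algebra_simps)
      qed
    qed
    have \<mu>nil: "bmat (\<mu> s) \<in> nilradical n c" for s
      using strict_upper_row(1) \<zeta> unfolding strict_upper_iff[symmetric] by (auto simp: strict_upper_def \<mu>_def)
    have uP: "unipotent \<alpha> t \<in> P'" for t using \<alpha> unfolding nilpotent_direction_def by blast
    have \<xi>nil: "strict_upper (\<xi> s)" if "s \<noteq> 0" for s
    proof -
      have "strict_upper (\<lambda>u v. row_point u v + s * \<xi> s u v)"
        unfolding strict_upper_iff conj[symmetric]
        using conj_nilradical[OF _ \<mu>nil] uP derived_parabolic by blast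
      then show ?thesis using strict_upper_row(1) that by (auto simp: strict_upper_def)
    qed
    have eq: "poly (\<Phi> (bmat (\<xi> s))) s = poly (\<Phi> (bmat \<zeta>)) s" for s
    proof -
      have "f (unipotent \<alpha> (s * \<beta>) * bmat (\<mu> s) * inv\<^bsub>SL n\<^esub> (unipotent \<alpha> (s * \<beta>))) = f (bmat (\<mu> s))"
        using f(2) \<mu>nil uP unfolding invariant_def by blast
      moreover have "\<mu> s = (\<lambda>u v. row_point u v + s * \<zeta> u v)" by (intro ext) (simp add: \<mu>_def)
      ultimately show ?thesis unfolding conj line by (simp add: line)
    qed
    define R where "R \<theta> s = (\<Sum>e\<in>{d..k}. coeff (\<Phi> (bmat \<theta>)) e * s ^ (e - d))" for \<theta> s
    have R: "poly (\<Phi> (bmat \<theta>)) s = s ^ d * R \<theta> s" if "strict_upper \<theta>" for \<theta> s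
    proof -
      have "poly (\<Phi> (bmat \<theta>)) s = (\<Sum>e\<in>{d..k}. coeff (\<Phi> (bmat \<theta>)) e * s ^ e)"
        unfolding poly_eq_sum_upto[OF deg] using low[OF that]
        by (intro sum.mono_neutral_right) (auto simp: not_le)
      also have "\<dots> = s ^ d * R \<theta> s"
        unfolding R_def sum_distrib_left by (rule sum.cong) (auto simp: power_add[symmetric] mult_ac)
      finally show ?thesis .
    qed
    have limit: "((\<lambda>s. R (\<theta> s) s) \<longlongrightarrow> G (\<theta> 0)) (at 0)"
      if "\<And>u v. ((\<lambda>s. \<theta> s u v) \<longlongrightarrow> \<theta> 0 u v) (at 0)" for \<theta>
    proof -
      have "((\<lambda>s. coeff (\<Phi> (bmat (\<theta> s))) e) \<longlongrightarrow> coeff (\<Phi> (bmat (\<theta> 0))) e) (at 0)" for e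
        using poly_maps_tendsto[of "\<lambda>A. coeff (\<Phi> A) e" n "\<lambda>s. bmat (\<theta> s)" "bmat (\<theta> 0)"] \<Phi> that
        by (simp add: coeff_poly_maps_def bmat_def)
      then have "((\<lambda>s. R (\<theta> s) s) \<longlongrightarrow> (\<Sum>e\<in>{d..k}. coeff (\<Phi> (bmat (\<theta> 0))) e * 0 ^ (e - d))) (at 0)"
        unfolding R_def by (intro tendsto_intros)
      moreover have "(\<Sum>e\<in>{d..k}. coeff (\<Phi> (bmat (\<theta> 0))) e * 0 ^ (e - d)) = (\<Sum>e\<in>{d..k}. if e = d then G (\<theta> 0) else 0)"
        by (rule sum.cong) (auto simp: G_def)
      ultimately show ?thesis using dk by simp
    qed
    have "((\<lambda>s. R (\<xi> s) s) \<longlongrightarrow> G (\<xi> 0)) (at 0)"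
      by (rule limit) (auto simp: \<xi>_def \<mu>_def intro!: tendsto_eq_intros)
    moreover have "((\<lambda>s. R \<zeta> s) \<longlongrightarrow> G \<zeta>) (at 0)" using limit[of "\<lambda>_. \<zeta>"] by simp
    moreover have "R (\<xi> s) s = R \<zeta> s" if "s \<noteq> 0" for s
      using R[OF \<xi>nil[OF that], of s] R[OF \<zeta>, of s] eq[of s] that by simp
    then have "((\<lambda>s. R (\<xi> s) s) \<longlongrightarrow> G \<zeta>) (at 0) \<longleftrightarrow> ((\<lambda>s. R \<zeta> s) \<longlongrightarrow> G \<zeta>) (at 0)"
      by (intro filterlim_cong refl) (simp add: eventually_at_filter)
    ultimately have "G (\<xi> 0) = G \<zeta>" using LIM_unique by blast
    then show ?thesis by (simp add: \<xi>_def[abs_def])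
  qed
  have G_cong: "G \<zeta> = G \<xi>" if "\<And>u v. u \<in> D \<Longrightarrow> v \<in> D \<Longrightarrow> \<zeta> u v = \<xi> u v" for \<zeta> \<xi>
    unfolding G_def by (subst bmat_cong[OF that]) auto
  \<comment> \<open>Directions along which translation affects \<open>G\<close> just as a starred
    direction does. Quantifying over the base point and the scalar makes this closed under sums and
    multiples.\<close>
  define K where "K = {\<zeta>. strict_upper \<zeta> \<and> (\<exists>\<sigma>. \<forall>\<theta> \<beta>. strict_upper \<theta> \<longrightarrow>
    G (\<lambda>u v. \<theta> u v + \<beta> * \<zeta> u v) = G (\<lambda>u v. \<theta> u v + \<beta> * row_star \<sigma> u v))}"
  have star_lin: "row_star (\<lambda>m. \<sigma> m + \<tau> m) u v = row_star \<sigma> u v + row_star \<tau> u v"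
    "row_star (\<lambda>m. a * \<sigma> m) u v = a * row_star \<sigma> u v" "row_star (\<lambda>_. 0) u v = 0" for \<sigma> \<tau> a u v
    by (auto simp: row_star_def)
  have comb: "strict_upper (\<lambda>u v. \<theta> u v + \<beta> * \<zeta> u v)" if "strict_upper \<theta>" "strict_upper \<zeta>" for \<theta> \<zeta> \<beta>
    using that by (simp add: strict_upper_def)
  interpret tangent n c K
  proof unfold_locales
    show "(\<lambda>_ _. 0) \<in> K"
      unfolding K_def by (auto simp: strict_upper_def star_lin intro!: exI[of _ "\<lambda>_. 0"])
  next
    fix \<zeta> \<xi> assume "\<zeta> \<in> K" "\<xi> \<in> K"
    then obtain \<sigma> \<tau> where \<zeta>: "strict_upper \<zeta>" "\<And>\<theta> \<beta>. strict_upper \<theta> \<Longrightarrow>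
        G (\<lambda>u v. \<theta> u v + \<beta> * \<zeta> u v) = G (\<lambda>u v. \<theta> u v + \<beta> * row_star \<sigma> u v)"
      and \<xi>: "strict_upper \<xi>" "\<And>\<theta> \<beta>. strict_upper \<theta> \<Longrightarrow>
        G (\<lambda>u v. \<theta> u v + \<beta> * \<xi> u v) = G (\<lambda>u v. \<theta> u v + \<beta> * row_star \<tau> u v)"
      unfolding K_def by blast
    have "G (\<lambda>u v. \<theta> u v + \<beta> * (\<zeta> u v + \<xi> u v)) = G (\<lambda>u v. \<theta> u v + \<beta> * row_star (\<lambda>m. \<sigma> m + \<tau> m) u v)"
      if \<theta>: "strict_upper \<theta>" for \<theta> \<beta>
    proof -
      have "G (\<lambda>u v. \<theta> u v + \<beta> * (\<zeta> u v + \<xi> u v)) = G (\<lambda>u v. (\<theta> u v + \<beta> * \<zeta> u v) + \<beta> * \<xi> u v)"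
        by (simp add: algebra_simps)
      also have "\<dots> = G (\<lambda>u v. (\<theta> u v + \<beta> * \<zeta> u v) + \<beta> * row_star \<tau> u v)"
        by (rule \<xi>(2)[OF comb[OF \<theta> \<zeta>(1)]])
      also have "\<dots> = G (\<lambda>u v. (\<theta> u v + \<beta> * row_star \<tau> u v) + \<beta> * \<zeta> u v)"
        by (simp add: algebra_simps)
      also have "\<dots> = G (\<lambda>u v. (\<theta> u v + \<beta> * row_star \<tau> u v) + \<beta> * row_star \<sigma> u v)"
        by (rule \<zeta>(2)[OF comb[OF \<theta> strict_upper_row(2)]])
      finally show ?thesis by (simp add: star_lin algebra_simps)
    qed
    then show "(\<lambda>u v. \<zeta> u v + \<xi> u v) \<in> K"
      unfolding K_def using comb[OF \<zeta>(1) \<xi>(1), of 1] by auto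
  next
    fix \<zeta> a assume "\<zeta> \<in> K"
    then obtain \<sigma> where \<zeta>: "strict_upper \<zeta>" "\<And>\<theta> \<beta>. strict_upper \<theta> \<Longrightarrow>
        G (\<lambda>u v. \<theta> u v + \<beta> * \<zeta> u v) = G (\<lambda>u v. \<theta> u v + \<beta> * row_star \<sigma> u v)"
      unfolding K_def by blast
    have "G (\<lambda>u v. \<theta> u v + \<beta> * (a * \<zeta> u v)) = G (\<lambda>u v. \<theta> u v + \<beta> * row_star (\<lambda>m. a * \<sigma> m) u v)"
      if "strict_upper \<theta>" for \<theta> \<beta>
      using \<zeta>(2)[OF that, of "\<beta> * a"] by (simp add: star_lin mult.assoc)
    then show "(\<lambda>u v. a * \<zeta> u v) \<in> K"
      unfolding K_def using \<zeta>(1) by (auto simp: strict_upper_def)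
  next
    fix \<zeta> \<xi> assume "\<zeta> \<in> K" and eq: "\<And>u v. u \<in> D \<Longrightarrow> v \<in> D \<Longrightarrow> \<zeta> u v = \<xi> u v"
    moreover have "G (\<lambda>u v. \<theta> u v + \<beta> * \<zeta> u v) = G (\<lambda>u v. \<theta> u v + \<beta> * \<xi> u v)" for \<theta> \<beta>
      by (rule G_cong) (simp add: eq)
    ultimately show "\<xi> \<in> K" unfolding K_def by (auto simp: strict_upper_def)
  next
    fix \<alpha> assume \<alpha>: "nilpotent_direction \<alpha>"
    have "strict_upper \<theta> \<longrightarrow> G (\<lambda>u v. \<theta> u v + \<beta> * bracket \<alpha> u v) = G (\<lambda>u v. \<theta> u v + \<beta> * row_star (\<lambda>_. 0) u v)"
      for \<theta> \<beta>
      using translate[OF \<alpha>, of \<theta> \<beta>] by (simp add: star_lin)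
    then show "bracket \<alpha> \<in> K" unfolding K_def using strict_upper_bracket[OF \<alpha>] by blast
  next
    fix m assume m: "LN m" "m \<le> length c"
    have eq: "unit (prev (H m, m)) (H m, m) u v = row_star (\<lambda>j. if j = m then 1 else 0) u v" for u v
      using m by (cases v) (auto simp: unit_def row_star_def)
    have "unit (prev (H m, m)) (H m, m) = row_star (\<lambda>j. if j = m then 1 else 0)"
      by (intro ext eq)
    then show "unit (prev (H m, m)) (H m, m) \<in> K" unfolding K_def using strict_upper_row(2) by auto
  qed
  have "\<zeta>0 \<in> K" by (rule nilradical_K) (use \<zeta>0(1) in \<open>auto simp: strict_upper_def\<close>)
  then obtain \<sigma> where "\<And>\<theta> \<beta>. strict_upper \<theta> \<Longrightarrow>
      G (\<lambda>u v. \<theta> u v + \<beta> * \<zeta>0 u v) = G (\<lambda>u v. \<theta> u v + \<beta> * row_star \<sigma> u v)"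
    unfolding K_def by blast
  from this[of "\<lambda>_ _. 0" 1] have "G \<zeta>0 = G (row_star \<sigma>)" by (simp add: strict_upper_def)
  then show False using star \<zeta>0(2) by simp
qed

end

section \<open>The isomorphism\<close>

context composition
begin

definition neighboured :: "nat set" where
  "neighboured = {m. m \<le> length c \<and> LN m}"

definition left_neighbour :: "nat \<Rightarrow> nat" where
  "left_neighbour m = Max {i. 1 \<le> i \<and> i < m \<and> H i = H m}"

lemma finite_neighboured: "finite neighboured"
  by (simp add: neighboured_def)

lemma neighbours_left_neighbour:
  assumes "m \<in> neighboured"
  shows "neighbours n c (left_neighbour m) m"
proof -
  let ?S = "{i. 1 \<le> i \<and> i < m \<and> H i = H m}"
  have S: "finite ?S" "?S \<noteq> {}" using assms by (auto simp: neighboured_def has_left_neighbour_def)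
  have "left_neighbour m \<in> ?S" unfolding left_neighbour_def by (rule Max_in[OF S])
  moreover have "H j \<noteq> H m" if "left_neighbour m < j" "j < m" for j
  proof
    assume "H j = H m"
    then have "j \<in> ?S" using that by simp
    then have "j \<le> left_neighbour m" unfolding left_neighbour_def by (rule Max_ge[OF S(1)])
    then show False using that by simp
  qed
  ultimately show ?thesis
    using assms by unfold_locales (auto simp: neighboured_def)
qed

definition coordinate :: "nat \<Rightarrow> complex mat \<Rightarrow> complex" where
  "coordinate m = bs_invariant (left_neighbour m) m"

definition invariants :: "(complex mat \<Rightarrow> complex) set" where
  "invariants = {f \<in> poly_maps n. invariant f}"

lemma invariants_const: "(\<lambda>_. a) \<in> invariants"
  by (simp add: invariants_def invariant_def poly_maps.const)

lemma invariants_add: "f \<in> invariants \<Longrightarrow> g \<in> invariants \<Longrightarrow> (\<lambda>x. f x + g x) \<in> invariants"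
  by (simp add: invariants_def invariant_def poly_maps.add)

lemma invariants_diff: "f \<in> invariants \<Longrightarrow> g \<in> invariants \<Longrightarrow> (\<lambda>x. f x - g x) \<in> invariants"
  by (simp add: invariants_def invariant_def poly_maps_diff)

lemma invariants_mult: "f \<in> invariants \<Longrightarrow> g \<in> invariants \<Longrightarrow> (\<lambda>x. f x * g x) \<in> invariants"
  by (simp add: invariants_def invariant_def poly_maps.mult)

lemma coordinate_invariants: "m \<in> neighboured \<Longrightarrow> coordinate m \<in> invariants"
  using neighbours.bs_invariant_derived[OF neighbours_left_neighbour]
  by (simp add: invariants_def invariant_def coordinate_def bs_invariant_poly_maps)

lemma coordinate_section:
  assumes "m \<in> neighboured"
  shows "\<exists>\<epsilon>. \<epsilon> * \<epsilon> = 1 \<and> (\<forall>\<sigma>. coordinate m (family LN \<sigma>) = \<epsilon> * \<sigma> m)"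
proof -
  obtain \<epsilon> where "\<epsilon> * \<epsilon> = 1" "\<And>\<sigma>. bs_invariant (left_neighbour m) m (family LN \<sigma>) =
       \<epsilon> * \<sigma> m * (\<Prod>j | left_neighbour m < j \<and> j < m \<and> H j < H m \<and> LN j \<and> \<not> LN j. \<sigma> j)"
    by (rule neighbours.bs_invariant_family[OF neighbours_left_neighbour[OF assms], of LN]) blast
  then show ?thesis by (auto simp: coordinate_def)
qed

lemma coordinate_row_family:
  assumes "m \<in> neighboured"
  shows "\<exists>\<epsilon> J. \<epsilon> * \<epsilon> = 1 \<and> J \<subseteq> neighboured \<inter> {..<m} \<and>
    (\<forall>\<sigma>. coordinate m (row_family \<sigma>) = \<epsilon> * \<sigma> m * (\<Prod>j\<in>J. \<sigma> j))"
proof -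
  let ?J = "{j. left_neighbour m < j \<and> j < m \<and> H j < H m \<and> LN j \<and> \<not> False}"
  obtain \<epsilon> where e: "\<epsilon> * \<epsilon> = 1" "\<And>\<sigma>. bs_invariant (left_neighbour m) m (row_family \<sigma>) =
       \<epsilon> * \<sigma> m * (\<Prod>j\<in>?J. \<sigma> j)"
    by (rule neighbours.bs_invariant_family[OF neighbours_left_neighbour[OF assms], of "\<lambda>_. False"]) blast
  have "?J \<subseteq> neighboured \<inter> {..<m}" using assms by (auto simp: neighboured_def)
  then show ?thesis using e unfolding coordinate_def by blast
qed

definition section_sign :: "nat \<Rightarrow> complex" where
  "section_sign m = (SOME \<epsilon>. \<epsilon> * \<epsilon> = 1 \<and> (\<forall>\<sigma>. coordinate m (family LN \<sigma>) = \<epsilon> * \<sigma> m))"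

lemma section_sign:
  assumes "m \<in> neighboured"
  shows "section_sign m * section_sign m = 1" "coordinate m (family LN \<sigma>) = section_sign m * \<sigma> m"
  using someI_ex[OF coordinate_section[OF assms]] unfolding section_sign_def by blast+

text \<open>On the row family the invariants are monomials with unitriangular exponents, so the
  coordinates \<open>\<sigma> m\<close> are Laurent monomials in them.\<close>

definition generated :: "(complex mat \<Rightarrow> complex) set" where
  "generated = {q \<in> invariants. \<forall>x\<in>nilradical n c. \<forall>x'\<in>nilradical n c.
     (\<forall>m\<in>neighboured. coordinate m x = coordinate m x') \<longrightarrow> q x = q x'}"

section \<open>Invariants that factor through the minors, and their quotients\<close>

lemma generated_const: "(\<lambda>_. a) \<in> generated"
  by (simp add: generated_def invariants_const)

lemma generated_coordinate: "m \<in> neighboured \<Longrightarrow> coordinate m \<in> generated"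
  by (simp add: generated_def coordinate_invariants)

lemma generated_add: "p \<in> generated \<Longrightarrow> q \<in> generated \<Longrightarrow> (\<lambda>x. p x + q x) \<in> generated"
proof -
  assume p: "p \<in> generated" and q: "q \<in> generated"
  have "p x + q x = p x' + q x'"
    if "x \<in> nilradical n c" "x' \<in> nilradical n c" "\<forall>m\<in>neighboured. coordinate m x = coordinate m x'" for x x'
  proof -
    have "p x = p x'" "q x = q x'" using p q that unfolding generated_def by blast+
    then show ?thesis by simp
  qed
  moreover have "(\<lambda>x. p x + q x) \<in> invariants"
    using p q unfolding generated_def by (intro invariants_add) blast+
  ultimately show ?thesis unfolding generated_def by blast
qed

lemma generated_mult: "p \<in> generated \<Longrightarrow> q \<in> generated \<Longrightarrow> (\<lambda>x. p x * q x) \<in> generated"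
proof -
  assume p: "p \<in> generated" and q: "q \<in> generated"
  have "p x * q x = p x' * q x'"
    if "x \<in> nilradical n c" "x' \<in> nilradical n c" "\<forall>m\<in>neighboured. coordinate m x = coordinate m x'" for x x'
  proof -
    have "p x = p x'" "q x = q x'" using p q that unfolding generated_def by blast+
    then show ?thesis by simp
  qed
  moreover have "(\<lambda>x. p x * q x) \<in> invariants"
    using p q unfolding generated_def by (intro invariants_mult) blast+
  ultimately show ?thesis unfolding generated_def by blast
qed

lemma generated_prod: "(\<And>a. a \<in> S \<Longrightarrow> q a \<in> generated) \<Longrightarrow> (\<lambda>x. \<Prod>a\<in>S. q a x) \<in> generated"
  by (induction S rule: infinite_finite_induct) (auto intro: generated_const generated_mult)

lemma generated_power: "q \<in> generated \<Longrightarrow> (\<lambda>x. q x ^ k) \<in> generated"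
  by (induction k) (auto intro: generated_const generated_mult)

text \<open>A common denominator for all Laurent monomials in the minors.\<close>

definition discriminant :: "complex mat \<Rightarrow> complex" where
  "discriminant x = (\<Prod>m\<in>neighboured. coordinate m x)"

lemma discriminant_generated: "discriminant \<in> generated"
  unfolding discriminant_def[abs_def] by (intro generated_prod generated_coordinate)

text \<open>Functions of nonzero parameters that, after multiplication by a power of the common
  denominator, are given by an invariant depending only on the minors.\<close>

definition laurent :: "((nat \<Rightarrow> complex) \<Rightarrow> complex) set" where
  "laurent = {g. \<exists>k. \<exists>q\<in>generated. \<forall>\<sigma>. (\<forall>m. \<sigma> m \<noteq> 0) \<longrightarrow>
     g \<sigma> * discriminant (row_family \<sigma>) ^ k = q (row_family \<sigma>)}"

lemma laurent_generated: "q \<in> generated \<Longrightarrow> (\<lambda>\<sigma>. q (row_family \<sigma>)) \<in> laurent"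
  unfolding laurent_def by (auto intro!: exI[of _ 0] bexI[of _ q])

lemma laurent_const: "(\<lambda>_. a) \<in> laurent"
  using laurent_generated[OF generated_const] .

lemma laurent_add: "g \<in> laurent \<Longrightarrow> g' \<in> laurent \<Longrightarrow> (\<lambda>\<sigma>. g \<sigma> + g' \<sigma>) \<in> laurent"
proof -
  assume "g \<in> laurent" "g' \<in> laurent"
  then obtain k q k' q' where q: "q \<in> generated" "q' \<in> generated"
    and *: "\<And>\<sigma>. (\<forall>m. \<sigma> m \<noteq> 0) \<Longrightarrow> g \<sigma> * discriminant (row_family \<sigma>) ^ k = q (row_family \<sigma>)"
      "\<And>\<sigma>. (\<forall>m. \<sigma> m \<noteq> 0) \<Longrightarrow> g' \<sigma> * discriminant (row_family \<sigma>) ^ k' = q' (row_family \<sigma>)"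
    unfolding laurent_def by blast
  have "(\<lambda>x. q x * discriminant x ^ k' + q' x * discriminant x ^ k) \<in> generated"
    by (intro generated_add generated_mult generated_power discriminant_generated q)
  moreover have "(g \<sigma> + g' \<sigma>) * discriminant (row_family \<sigma>) ^ (k + k')
      = q (row_family \<sigma>) * discriminant (row_family \<sigma>) ^ k' + q' (row_family \<sigma>) * discriminant (row_family \<sigma>) ^ k"
    if "\<forall>m. \<sigma> m \<noteq> 0" for \<sigma>
    unfolding *[OF that, symmetric] by (simp add: power_add algebra_simps)
  ultimately show ?thesis unfolding laurent_def by (intro CollectI exI[of _ "k + k'"]) (rule bexI; simp)
qed

lemma laurent_mult: "g \<in> laurent \<Longrightarrow> g' \<in> laurent \<Longrightarrow> (\<lambda>\<sigma>. g \<sigma> * g' \<sigma>) \<in> laurent"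
proof -
  assume "g \<in> laurent" "g' \<in> laurent"
  then obtain k q k' q' where q: "q \<in> generated" "q' \<in> generated"
    and *: "\<And>\<sigma>. (\<forall>m. \<sigma> m \<noteq> 0) \<Longrightarrow> g \<sigma> * discriminant (row_family \<sigma>) ^ k = q (row_family \<sigma>)"
      "\<And>\<sigma>. (\<forall>m. \<sigma> m \<noteq> 0) \<Longrightarrow> g' \<sigma> * discriminant (row_family \<sigma>) ^ k' = q' (row_family \<sigma>)"
    unfolding laurent_def by blast
  have "(\<lambda>x. q x * q' x) \<in> generated" by (intro generated_mult q)
  moreover have "(g \<sigma> * g' \<sigma>) * discriminant (row_family \<sigma>) ^ (k + k') = q (row_family \<sigma>) * q' (row_family \<sigma>)"
    if "\<forall>m. \<sigma> m \<noteq> 0" for \<sigma>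
    unfolding *[OF that, symmetric] by (simp add: power_add algebra_simps)
  ultimately show ?thesis unfolding laurent_def by (intro CollectI exI[of _ "k + k'"]) (rule bexI; simp)
qed

lemma laurent_prod: "(\<And>a. a \<in> S \<Longrightarrow> g a \<in> laurent) \<Longrightarrow> (\<lambda>\<sigma>. \<Prod>a\<in>S. g a \<sigma>) \<in> laurent"
  by (induction S rule: infinite_finite_induct) (auto intro: laurent_const laurent_mult)

lemma laurent_cong:
  "g \<in> laurent \<Longrightarrow> (\<And>\<sigma>. (\<forall>m. \<sigma> m \<noteq> 0) \<Longrightarrow> g \<sigma> = g' \<sigma>) \<Longrightarrow> g' \<in> laurent"
  unfolding laurent_def by (auto; metis)

lemma laurent_inverse_coordinate:
  assumes "m \<in> neighboured" "\<And>\<sigma>. (\<forall>m. \<sigma> m \<noteq> 0) \<Longrightarrow> coordinate m (row_family \<sigma>) \<noteq> 0"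
  shows "(\<lambda>\<sigma>. inverse (coordinate m (row_family \<sigma>))) \<in> laurent"
proof -
  have "(\<lambda>x. \<Prod>j\<in>neighboured - {m}. coordinate j x) \<in> generated"
    by (intro generated_prod generated_coordinate) auto
  moreover have "inverse (coordinate m (row_family \<sigma>)) * discriminant (row_family \<sigma>) ^ 1
      = (\<Prod>j\<in>neighboured - {m}. coordinate j (row_family \<sigma>))" if "\<forall>m. \<sigma> m \<noteq> 0" for \<sigma>
    using assms(2)[OF that] prod.remove[OF finite_neighboured assms(1), of "\<lambda>j. coordinate j (row_family \<sigma>)"]
    by (simp add: discriminant_def)
  ultimately show ?thesis unfolding laurent_def by (intro CollectI exI[of _ 1]) (rule bexI; blast)
qed

text \<open>Solving the monomial for \<open>\<sigma> m\<close> divides by parameters of smaller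
  columns, so the inverses are carried along in the induction.\<close>

lemma laurent_parameter:
  "m \<in> neighboured \<Longrightarrow> (\<lambda>\<sigma>. \<sigma> m) \<in> laurent \<and> (\<lambda>\<sigma>. inverse (\<sigma> m)) \<in> laurent"
proof (induction m rule: less_induct)
  case (less m)
  obtain \<epsilon> J where e: "\<epsilon> * \<epsilon> = 1" and J: "J \<subseteq> neighboured \<inter> {..<m}"
    and eq: "\<And>\<sigma>. coordinate m (row_family \<sigma>) = \<epsilon> * \<sigma> m * (\<Prod>j\<in>J. \<sigma> j)"
    using coordinate_row_family[OF less.prems] by blast
  have e0: "\<epsilon> \<noteq> 0" using e by auto
  have P0: "(\<Prod>j\<in>J. \<sigma> j) \<noteq> 0" if "\<forall>m. \<sigma> m \<noteq> 0" for \<sigma> :: "nat \<Rightarrow> complex"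
    using that by (cases "finite J") auto
  have "(\<lambda>\<sigma>. inverse \<epsilon> * (coordinate m (row_family \<sigma>) * (\<Prod>j\<in>J. inverse (\<sigma> j)))) \<in> laurent"
    using less.IH J by (intro laurent_mult laurent_const laurent_prod laurent_generated generated_coordinate less.prems) auto
  then have 1: "(\<lambda>\<sigma>. \<sigma> m) \<in> laurent"
  proof (rule laurent_cong)
    fix \<sigma> :: "nat \<Rightarrow> complex"
    assume "\<forall>m. \<sigma> m \<noteq> 0"
    moreover have "(\<Prod>j\<in>J. inverse (\<sigma> j)) = inverse (\<Prod>j\<in>J. \<sigma> j)"
      using prod_inversef[of \<sigma> J] by (simp add: comp_def)
    ultimately show "inverse \<epsilon> * (coordinate m (row_family \<sigma>) * (\<Prod>j\<in>J. inverse (\<sigma> j))) = \<sigma> m"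
      using e0 P0 by (simp add: eq)
  qed
  have "(\<lambda>\<sigma>. \<epsilon> * (inverse (coordinate m (row_family \<sigma>)) * (\<Prod>j\<in>J. \<sigma> j))) \<in> laurent"
    using less.IH J e0 P0
    by (intro laurent_mult laurent_const laurent_prod laurent_inverse_coordinate less.prems) (auto simp: eq)
  then have "(\<lambda>\<sigma>. inverse (\<sigma> m)) \<in> laurent"
    by (rule laurent_cong) (use e0 P0 in \<open>simp add: eq field_simps\<close>)
  with 1 show ?case ..
qed

lemma laurent_poly_maps: "f \<in> poly_maps n \<Longrightarrow> (\<lambda>\<sigma>. f (row_family \<sigma>)) \<in> laurent"
proof (induction rule: poly_maps.induct)
  case (entry i j)
  let ?b = "bx i" and ?b' = "bx j"
  have D: "?b \<in> D" "?b' \<in> D" using entry bx_D by auto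
  have "row_family \<sigma> $$ (i, j) = row_point ?b ?b' + row_star (\<lambda>m. \<sigma> m - 1) ?b ?b'" for \<sigma>
    unfolding row_family_eq using entry by (simp add: bmat_def)
  moreover have "snd ?b' \<in> neighboured" if "LN (snd ?b')"
    using that D_bounds[OF D(2)] by (simp add: neighboured_def)
  ultimately show ?case
    using laurent_parameter[of "snd ?b'"] laurent_const
    by (cases "?b = prev ?b' \<and> fst ?b' = H (snd ?b') \<and> LN (snd ?b')") (simp_all add: row_point_def row_star_def)
qed (auto intro: laurent_const laurent_add laurent_mult)

lemma invariant_vanishing_on_section:
  assumes f: "f \<in> invariants" and zero: "\<And>\<sigma>. f (family LN \<sigma>) = 0" and x: "x \<in> nilradical n c"
  shows "f x = 0"
proof -
  obtain k q where q: "q \<in> generated"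
    and eq: "\<And>\<sigma>. (\<forall>m. \<sigma> m \<noteq> 0) \<Longrightarrow> f (row_family \<sigma>) * discriminant (row_family \<sigma>) ^ k = q (row_family \<sigma>)"
    using laurent_poly_maps[of f] f unfolding laurent_def invariants_def by blast
  have dk: "(\<lambda>x. discriminant x ^ k) \<in> generated" by (rule generated_power[OF discriminant_generated])
  have inv: "(\<lambda>x. f x * discriminant x ^ k - q x) \<in> invariants"
    using f dk q by (intro invariants_diff invariants_mult) (auto simp: generated_def)
  then have fq: "f x * discriminant x ^ k = q x" if "x \<in> nilradical n c" for x
    using vanishing_on_row_family[of "\<lambda>x. f x * discriminant x ^ k - q x" x] that eq
    by (auto simp: invariants_def)
  have "q x = 0" if x: "x \<in> nilradical n c" for x
  proof -
    \<comment> \<open>The signs square to 1, so the section point with these parameters has the same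
      minors as x. As q depends only on the minors, it may be evaluated at that point, where f
      vanishes.\<close>
    define \<sigma> where "\<sigma> m = section_sign m * coordinate m x" for m
    have "\<forall>m\<in>neighboured. coordinate m x = coordinate m (family LN \<sigma>)"
      using section_sign by (simp add: \<sigma>_def mult.assoc[symmetric])
    then have "q x = q (family LN \<sigma>)"
      using q x family_nilradical[of LN \<sigma>] unfolding generated_def by blast
    then show ?thesis using fq[OF family_nilradical[of LN \<sigma>]] zero by simp
  qed
  then have prod0: "f x * discriminant x ^ k = 0" if "x \<in> nilradical n c" for x using fq that by simp
  \<comment> \<open>A point at which no minor vanishes. On the line from y to x the product of f
    with the power of the discriminant is a product of two polynomials in s; the second is not zero,
    so the first is.\<close>
  define y where "y = row_family (\<lambda>_. 1)"
  have "coordinate m y \<noteq> 0" if "m \<in> neighboured" for m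
    using coordinate_row_family[OF that] unfolding y_def by auto
  then have y0: "discriminant y ^ k \<noteq> 0" using finite_neighboured by (simp add: discriminant_def)
  have yc: "y \<in> carrier_mat n n" and yn: "y \<in> nilradical n c"
    unfolding y_def by (simp_all add: family_nilradical)
  define \<zeta> where "\<zeta> u v = entry x u v - entry y u v" for u v
  have fp: "f \<in> poly_maps n" "(\<lambda>x. discriminant x ^ k) \<in> poly_maps n"
    using f dk by (auto simp: invariants_def generated_def)
  obtain p where p: "\<And>s. f (bmat (\<lambda>u v. entry y u v + s * \<zeta> u v)) = poly p s"
    using poly_on_line[OF fp(1), of "entry y"] by blast
  obtain r where r: "\<And>s. discriminant (bmat (\<lambda>u v. entry y u v + s * \<zeta> u v)) ^ k = poly r s"
    using poly_on_line[OF fp(2), of "entry y"] by blast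
  have "poly (p * r) s = 0" for s
  proof -
    have "bmat (\<lambda>u v. entry y u v + s * \<zeta> u v) \<in> nilradical n c"
      using x yn by (auto simp: strict_upper_iff[symmetric] strict_upper_def nilradical_iff \<zeta>_def)
    then show ?thesis using prod0 by (simp add: p[symmetric] r[symmetric])
  qed
  then have "p * r = 0" using poly_all_0_iff_0 by blast
  moreover have "bmat (\<lambda>u v. entry y u v + 0 * \<zeta> u v) = y" by (rule eq_bmatI[OF yc, symmetric]) simp
  then have "r \<noteq> 0" using r[of 0] y0 by auto
  ultimately have "p = 0" by simp
  moreover have "bmat (\<lambda>u v. entry y u v + 1 * \<zeta> u v) = x"
    by (rule eq_bmatI[OF nilradical_carrier[OF x], symmetric]) (simp add: \<zeta>_def)
  ultimately show ?thesis using p[of 1] by simp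
qed

lemma invariant_extension:
  assumes "f \<in> poly_maps n"
  shows "\<exists>g\<in>invariants. \<forall>\<sigma>. g (family LN \<sigma>) = f (family LN \<sigma>)"
  using assms
proof (induction rule: poly_maps.induct)
  case (const a)
  show ?case using invariants_const[of a] by (intro bexI[of _ "\<lambda>_. a"]) simp_all
next
  case (entry i j)
  let ?b = "bx i" and ?b' = "bx j"
  have D: "?b \<in> D" "?b' \<in> D" using entry bx_D by auto
  let ?m = "snd ?b'"
  let ?a = "if ?b = source LN ?b' then 1 else 0 :: complex"
  have eq: "family LN \<sigma> $$ (i, j) = ?a +
      (if fst ?b' = H ?m \<and> LN ?m \<and> ?b = track c LN (?m - 1) (fst ?b') then \<sigma> ?m else 0)" for \<sigma>
    using entry by (simp add: family_def bmat_def)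
  show ?case
  proof (cases "fst ?b' = H ?m \<and> LN ?m \<and> ?b = track c LN (?m - 1) (fst ?b')")
    case True
    then have m: "?m \<in> neighboured" using D_bounds[OF D(2)] by (simp add: neighboured_def)
    have "(\<lambda>x. ?a + section_sign ?m * coordinate ?m x) \<in> invariants"
      by (intro invariants_add invariants_mult invariants_const coordinate_invariants m)
    then show ?thesis
      using True section_sign[OF m] by (intro bexI[of _ "\<lambda>x. ?a + section_sign ?m * coordinate ?m x"])
        (simp_all add: eq mult.assoc[symmetric])
  next
    case False
    then show ?thesis using invariants_const[of ?a] by (intro bexI[of _ "\<lambda>_. ?a"]) (auto simp: eq)
  qed
next
  case (add f g)
  then obtain f' g' where "f' \<in> invariants" "g' \<in> invariants"
    "\<And>\<sigma>. f' (family LN \<sigma>) = f (family LN \<sigma>)" "\<And>\<sigma>. g' (family LN \<sigma>) = g (family LN \<sigma>)" by blast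
  then show ?case by (intro bexI[of _ "\<lambda>x. f' x + g' x"]) (auto intro: invariants_add)
next
  case (mult f g)
  then obtain f' g' where "f' \<in> invariants" "g' \<in> invariants"
    "\<And>\<sigma>. f' (family LN \<sigma>) = f (family LN \<sigma>)" "\<And>\<sigma>. g' (family LN \<sigma>) = g (family LN \<sigma>)" by blast
  then show ?case by (intro bexI[of _ "\<lambda>x. f' x * g' x"]) (auto intro: invariants_mult)
qed

text \<open>Invariance is tested on restricted functions; since P' preserves the nilradical, this
  agrees with invariance of the polynomial itself.\<close>

lemma invariant_algebra_carrier:
  "carrier (invariant_algebra n P' (nilradical n c)) = (\<lambda>f. restrict f (nilradical n c)) ` invariants"
  (is "?L = ?R")
proof -
  have "restrict f (nilradical n c) (g * x * inv\<^bsub>SL n\<^esub> g) = f (g * x * inv\<^bsub>SL n\<^esub> g)"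
    if "g \<in> P'" "x \<in> nilradical n c" for f :: "complex mat \<Rightarrow> complex" and g x
    using conj_nilradical[of g x] derived_parabolic that by auto
  then have "(\<forall>g\<in>P'. \<forall>x\<in>nilradical n c. restrict f (nilradical n c) (g * x * inv\<^bsub>SL n\<^esub> g) = restrict f (nilradical n c) x)
      \<longleftrightarrow> invariant f" for f
    by (simp add: invariant_def)
  then show ?thesis
    by (auto simp: invariant_algebra_def coord_algebra_def invariants_def simp del: restrict_apply)
qed

lemma weierstrass: "weierstrass_section n P' (nilradical n c) (section_point n c) (section_space n c)"
proof -
  let ?N = "nilradical n c" and ?T = "range (family LN)"
  let ?A = "invariant_algebra n P' ?N" and ?B = "coord_algebra n ?T"
  let ?h = "\<lambda>f. restrict f ?T"
  have sub: "?T \<subseteq> ?N" using family_nilradical by blast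
  have rr: "restrict (restrict f ?N) ?T = restrict f ?T" for f :: "complex mat \<Rightarrow> complex"
    using sub by (auto simp: restrict_def fun_eq_iff)
  have img: "?h ` carrier ?A = carrier ?B"
  proof
    show "?h ` carrier ?A \<subseteq> carrier ?B"
      unfolding invariant_algebra_carrier using rr by (auto simp: coord_algebra_def invariants_def)
    show "carrier ?B \<subseteq> ?h ` carrier ?A"
    proof
      fix g assume "g \<in> carrier ?B"
      then obtain f where f: "f \<in> poly_maps n" "g = restrict f ?T" by (auto simp: coord_algebra_def)
      then obtain f' where f': "f' \<in> invariants" "\<And>\<sigma>. f' (family LN \<sigma>) = f (family LN \<sigma>)"
        using invariant_extension by blast
      then have "g = ?h (restrict f' ?N)" unfolding rr f(2) by (intro restrict_ext) auto
      then show "g \<in> ?h ` carrier ?A" unfolding invariant_algebra_carrier using f'(1) by blast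
    qed
  qed
  have inj: "inj_on ?h (carrier ?A)"
  proof (rule inj_onI)
    fix f1 f2 assume "f1 \<in> carrier ?A" "f2 \<in> carrier ?A" and eq: "?h f1 = ?h f2"
    then obtain g1 g2 where g: "g1 \<in> invariants" "g2 \<in> invariants" "f1 = restrict g1 ?N" "f2 = restrict g2 ?N"
      unfolding invariant_algebra_carrier by blast
    have "restrict g1 ?T = restrict g2 ?T" using eq unfolding g(3,4) rr .
    then have "g1 (family LN \<sigma>) = g2 (family LN \<sigma>)" for \<sigma> by (metis rangeI restrict_apply')
    then have "g1 x - g2 x = 0" if "x \<in> ?N" for x
      using invariant_vanishing_on_section[OF invariants_diff[OF g(1,2)] _ that] by simp
    then show "f1 = f2" unfolding g(3,4) by (intro restrict_ext) auto
  qed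
  have "?h (f \<otimes>\<^bsub>?A\<^esub> g) = ?h f \<otimes>\<^bsub>?B\<^esub> ?h g" "?h (f \<oplus>\<^bsub>?A\<^esub> g) = ?h f \<oplus>\<^bsub>?B\<^esub> ?h g"
    "?h \<one>\<^bsub>?A\<^esub> = \<one>\<^bsub>?B\<^esub>" "?h (a \<odot>\<^bsub>?A\<^esub> f) = a \<odot>\<^bsub>?B\<^esub> ?h f" for f g a
    using sub by (auto simp: invariant_algebra_def coord_algebra_def restrict_def fun_eq_iff)
  moreover have "?h f \<in> carrier ?B" if "f \<in> carrier ?A" for f using img that by blast
  ultimately have "?h \<in> algebra_iso ?A ?B"
    unfolding algebra_iso_def ring_iso_def Ring.ring_hom_def using img inj by (simp add: bij_betw_def)
  then show ?thesis
    unfolding weierstrass_section_def translate_section using sub by blast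
qed

end

section \<open>Translation from e + V to V\<close>

lemma poly_maps_translate:
  assumes "e \<in> carrier_mat n n" "f \<in> poly_maps n"
  shows "\<exists>g\<in>poly_maps n. \<forall>v\<in>carrier_mat n n. g v = f (e + v)"
  using assms(2)
proof (induction rule: poly_maps.induct)
  case (const a)
  show ?case using poly_maps.const by (intro bexI[of _ "\<lambda>_. a"]) auto
next
  case (entry i j)
  then show ?case using assms(1)
    by (intro bexI[of _ "\<lambda>v. e $$ (i, j) + v $$ (i, j)"]) (auto intro!: poly_maps.intros)
next
  case (add f g)
  then obtain f' g' where "f' \<in> poly_maps n" "g' \<in> poly_maps n"
    "\<forall>v\<in>carrier_mat n n. f' v = f (e + v)" "\<forall>v\<in>carrier_mat n n. g' v = g (e + v)" by blast
  then show ?case by (intro bexI[of _ "\<lambda>x. f' x + g' x"]) (auto intro: poly_maps.add)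
next
  case (mult f g)
  then obtain f' g' where "f' \<in> poly_maps n" "g' \<in> poly_maps n"
    "\<forall>v\<in>carrier_mat n n. f' v = f (e + v)" "\<forall>v\<in>carrier_mat n n. g' v = g (e + v)" by blast
  then show ?case by (intro bexI[of _ "\<lambda>x. f' x * g' x"]) (auto intro: poly_maps.mult)
qed

lemma translate_algebra_iso:
  assumes e: "e \<in> carrier_mat n n" and V: "V \<subseteq> carrier_mat n n"
  shows "(\<lambda>f. \<lambda>v\<in>V. f (e + v)) \<in> algebra_iso (coord_algebra n (translate e V)) (coord_algebra n V)"
proof -
  let ?T = "translate e V" and ?h = "\<lambda>f. \<lambda>v\<in>V. f (e + v)"
  have T: "e + v \<in> ?T" if "v \<in> V" for v using that by (auto simp: translate_def)
  have hr: "?h (restrict f ?T) = (\<lambda>v\<in>V. f (e + v))" for f :: "complex mat \<Rightarrow> complex"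
    using T by (intro restrict_ext) auto
  have carr: "carrier (coord_algebra n X) = (\<lambda>f. restrict f X) ` poly_maps n" for X
    by (simp add: coord_algebra_def)
  have img: "?h ` carrier (coord_algebra n ?T) = carrier (coord_algebra n V)"
  proof
    show "?h ` carrier (coord_algebra n ?T) \<subseteq> carrier (coord_algebra n V)"
    proof
      fix g assume "g \<in> ?h ` carrier (coord_algebra n ?T)"
      then obtain f where f: "f \<in> poly_maps n" "g = (\<lambda>v\<in>V. f (e + v))" unfolding carr using hr by auto
      obtain f' where "f' \<in> poly_maps n" "\<forall>v\<in>carrier_mat n n. f' v = f (e + v)"
        using poly_maps_translate[OF e f(1)] by blast
      then have "f' \<in> poly_maps n" "g = restrict f' V" unfolding f(2) using V by (auto intro!: restrict_ext)
      then show "g \<in> carrier (coord_algebra n V)" unfolding carr by blast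
    qed
    show "carrier (coord_algebra n V) \<subseteq> ?h ` carrier (coord_algebra n ?T)"
    proof
      fix g assume "g \<in> carrier (coord_algebra n V)"
      then obtain f where f: "f \<in> poly_maps n" "g = restrict f V" unfolding carr by blast
      have me: "- e \<in> carrier_mat n n" using e by simp
      obtain f' where f': "f' \<in> poly_maps n" "\<forall>v\<in>carrier_mat n n. f' v = f (- e + v)"
        using poly_maps_translate[OF me f(1)] by blast
      have "f' (e + v) = f v" if "v \<in> V" for v
      proof -
        have v: "v \<in> carrier_mat n n" using that V by blast
        have "- e + (e + v) = v" using e v by (intro eq_matI) auto
        then show ?thesis using f'(2) e v by simp
      qed
      then have "g = ?h (restrict f' ?T)" unfolding hr f(2) by (intro restrict_ext) simp
      then show "g \<in> ?h ` carrier (coord_algebra n ?T)" unfolding carr using f'(1) by blast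
    qed
  qed
  have inj: "inj_on ?h (carrier (coord_algebra n ?T))"
  proof (rule inj_onI)
    fix f1 f2 assume "f1 \<in> carrier (coord_algebra n ?T)" "f2 \<in> carrier (coord_algebra n ?T)" and eq: "?h f1 = ?h f2"
    then obtain g1 g2 where g: "f1 = restrict g1 ?T" "f2 = restrict g2 ?T" unfolding carr by blast
    have "f1 (e + v) = f2 (e + v)" if "v \<in> V" for v using fun_cong[OF eq, of v] that by simp
    then have "f1 x = f2 x" if "x \<in> ?T" for x using that by (auto simp: translate_def)
    then show "f1 = f2" unfolding g by (intro restrict_ext) simp
  qed
  let ?A = "coord_algebra n ?T" and ?B = "coord_algebra n V"
  have "?h (f \<otimes>\<^bsub>?A\<^esub> g) = ?h f \<otimes>\<^bsub>?B\<^esub> ?h g" "?h (f \<oplus>\<^bsub>?A\<^esub> g) = ?h f \<oplus>\<^bsub>?B\<^esub> ?h g"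
    "?h \<one>\<^bsub>?A\<^esub> = \<one>\<^bsub>?B\<^esub>" "?h (a \<odot>\<^bsub>?A\<^esub> f) = a \<odot>\<^bsub>?B\<^esub> ?h f" for f g a
    using T by (auto simp: coord_algebra_def restrict_def fun_eq_iff)
  moreover have "?h f \<in> carrier ?B" if "f \<in> carrier ?A" for f using img that by blast
  ultimately show ?thesis
    unfolding algebra_iso_def ring_iso_def Ring.ring_hom_def using img inj by (simp add: bij_betw_def)
qed

theorem mainTheorem2:
  fixes n :: nat and c :: "nat list"
  assumes "n > 0"
    and "0 \<notin> set c"
    and "sum_list c = n"
  shows
    "let P' = derived (SL n) (parabolic n c);
         e = section_point n c;
         V = section_space n c
     in weierstrass_section n P' (nilradical n c) e V \<and>
        (\<lambda>f. \<lambda>v\<in>V. f (e + v))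
          \<in> algebra_iso (coord_algebra n (translate e V)) (coord_algebra n V)"
proof -
  interpret composition n c using assms by unfold_locales
  have "section_space n c \<subseteq> carrier_mat n n"
    unfolding section_space_eq star_matrix_def by auto
  moreover have "section_point n c \<in> carrier_mat n n" by (simp add: section_point_eq)
  ultimately show ?thesis
    unfolding Let_def using weierstrass translate_algebra_iso by blast
qed

end
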